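(* Let $m\ge2$ be an integer and $C>0$. There is a constant $L_{C,m}>0$ depending only on $C$ and $m$ such that the following holds. Let $0\le\mu<1$, $\zeta>0$, $\mu_0>0$, $\delta>0$. Suppose the density function $f=\sum_{k=1}^m\pi_k\prod_{j=1}^{2m-1}f_{kj}$ on $[0,1]^{2m-1}$ is $(\mu,\zeta)$-estimable, and $\|f_{kj}\|_\infty\le C$ for all $k,j$. Let $A\subset[0,1]$ be a (measurable) subset such that: 1. the Lebesgue measure of $A$ satisfies $\mu_{Leb}(A)\ge\mu_0$; 2. the numbers $a_k=\int_A f_{k(2m-1)}(x)\,dx$, $k\in[m]$, satisfy $\min_{k\in[m]}a_k\ge\delta$ and $\min_{k\ne k'}|a_k-a_{k'}|\ge\delta$. Then for a density estimator $\hat f$ satisfying $\|\hat f-f\|_2\le\epsilon$ for some $\epsilon<\frac{\zeta(1-\mu)^m}{4(m-1)!}$, the Recovery Algorithm described in the context, run with input $\hat f$ and the set $A$, outputs functions $\hat f_{11},\dots,\hat f_{m1}$ such that, for some permutation $\sigma:[m]\to[m]$ and all $k\in[m]$, $$\|\hat f_{k1}-f_{\sigma(k)1}\|_2\le\frac{L_{C,m}\,\epsilon}{\zeta^3(1-\mu)^{3m}\,\delta\sqrt{\mu_0}}.$$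
   Context: Notation: $[n]=\{1,\dots,n\}$. The expression $f=\sum_{k=1}^m\pi_k\prod_{j=1}^{2m-1}f_{kj}$ means $f(x_1,\dots,x_{2m-1})=\sum_k\pi_k\prod_j f_{kj}(x_j)$, with $\pi_k>0$, $\sum_k\pi_k=1$, and each $f_{kj}$ a probability density on $[0,1]$. Norms $\|\cdot\|_1,\|\cdot\|_2$ are $L^1$, $L^2$ norms for Lebesgue measure. $\mu$-incoherence: elements $g_1,\dots,g_m$ of a Hilbert space are $\mu$-incoherent ($0\le\mu<1$) if $|\langle g_k,g_{k'}\rangle|\le\mu\|g_k\|_2\|g_{k'}\|_2$ for all $k\neq k'$. The density $f$ is $(\mu,\zeta)$-estimable if (1) all $f_{kj}$ are square integrable and for each $j$ the family $\{f_{kj}\}_{k=1}^m$ is $\mu$-incoherent (in $L^2$) with $\mu<1$; (2) $\min_k\pi_k\ge\zeta>0$. Recovery Algorithm. Input: an estimator $\hat f$ of the density $f$ on $[0,1]^{2m-1}$, and a chosen subset $A\subset[0,1]$. Write $y=(x_1,\dots,x_{m-1})$, $z=(x_m,\dots,x_{2m-2})$. Step 1. Compute $\hat T_+(y,z)=\int\hat f(y,z,x_{2m-1})\,dx_{2m-1}$, viewed as the kernel of an operator on $L^2([0,1]^{m-1})$. Step 2. Let $\hat T_{+,m}(y,z)=\sum_{k=1}^m\hat\lambda_k\hat\phi_k(y)\hat\psi_k(z)$ be the truncation of the singular value decomposition of $\hat T_+$ to its top $m$ singular values (a minimizer of $\|T-\hat T_+\|_{\mathrm{op}}$ over operators $T$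 of rank at most $m$), where $\hat\lambda_k$ are the singular values and $\{\hat\phi_k\}$, $\{\hat\psi_k\}$ are orthonormal. Step 3. For $l,t\in[m]$ compute $$\hat\eta_{lt}=\frac1{\hat\lambda_t}\int_{x_{2m-1}\in A}\int\int\hat\phi_l(y)\,\hat f(y,z,x_{2m-1})\,\hat\psi_t(z)\,dy\,dz\,dx_{2m-1},$$ and let $\hat\eta_A=(\hat\eta_{lt})\in\mathbb{R}^{m\times m}$. Step 4. Let $\hat w_1,\dots,\hat w_m$ be $\ell^2$-unit eigenvectors of $\hat\eta_A$, with $\hat w_{kh}$ the $h$-th coordinate of $\hat w_k$. Step 5. For $k\in[m]$ set $\hat g_k(y)=\sum_{h=1}^m\hat w_{kh}\hat\phi_h(y)$, $\hat h_k=\hat g_k/\|\hat g_k\|_1$, and output $\hat f_{k1}(x_1)=\int\hat h_k(x_1,\dots,x_{m-1})\,dx_2\cdots dx_{m-1}$.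
   Formalization: The unit eigenvectors in Step 4 are taken to span all eigenspaces (over the complex numbers), with sign/phase chosen so that each ĝ_k has nonnegative integral; for arbitrary signs or repeated eigenvectors the claim fails, e.g. f̂=f with ŵ_k replaced by its negative. *)

theory Defs
  imports
    "HOL-Analysis.Analysis"
    "HOL-Combinatorics.Permutations"
    "Jordan_Normal_Form.Char_Poly"
begin

(* Components, coordinates and singular values are all numbered from 0: a point of [0,1]^(2m-1)
   is a function on {..<2*m-1}, with y = (x_0,...,x_(m-2)), z = (x_(m-1),...,x_(2m-3)), and last
   coordinate x_(2m-2). *)

abbreviation unit_interval :: "real measure" where
  "unit_interval \<equiv> lebesgue_on {0..1}"

definition cube :: "nat set \<Rightarrow> (nat \<Rightarrow> real) measure" where
  "cube I = PiM I (\<lambda>_. unit_interval)"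

abbreviation (input) y_cube :: "nat \<Rightarrow> (nat \<Rightarrow> real) measure" where
  "y_cube m \<equiv> cube {..<m - 1}"

abbreviation (input) z_cube :: "nat \<Rightarrow> (nat \<Rightarrow> real) measure" where
  "z_cube m \<equiv> cube {m - 1..<2 * m - 2}"

definition point :: "nat \<Rightarrow> (nat \<Rightarrow> real) \<Rightarrow> (nat \<Rightarrow> real) \<Rightarrow> real \<Rightarrow> (nat \<Rightarrow> real)" where
  "point m y z x = (merge {..<m - 1} {m - 1..<2 * m - 2} (y, z)) (2 * m - 2 := x)"


definition sq_integrable ::
    "'a measure \<Rightarrow> ('a \<Rightarrow> 'b::{banach, second_countable_topology}) \<Rightarrow> bool" where
  "sq_integrable M f \<longleftrightarrow> f \<in> borel_measurable M \<and> integrable M (\<lambda>x. (norm (f x))\<^sup>2)"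

definition L2_norm ::
    "'a measure \<Rightarrow> ('a \<Rightarrow> 'b::{banach, second_countable_topology}) \<Rightarrow> real" where
  "L2_norm M f = sqrt (LINT x|M. (norm (f x))\<^sup>2)"

definition L1_norm ::
    "'a measure \<Rightarrow> ('a \<Rightarrow> 'b::{banach, second_countable_topology}) \<Rightarrow> real" where
  "L1_norm M f = (LINT x|M. norm (f x))"

definition L2_inner :: "'a measure \<Rightarrow> ('a \<Rightarrow> real) \<Rightarrow> ('a \<Rightarrow> real) \<Rightarrow> real" where
  "L2_inner M f g = (LINT x|M. f x * g x)"

definition orthonormal_L2 :: "'a measure \<Rightarrow> (nat \<Rightarrow> 'a \<Rightarrow> real) \<Rightarrow> bool" where
  "orthonormal_L2 M \<phi> \<longleftrightarrow>
     (\<forall>i. sq_integrable M (\<phi> i)) \<and> (\<forall>i j. L2_inner M (\<phi> i) (\<phi> j) = of_bool (i = j))"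

definition incoherent :: "real \<Rightarrow> 'a measure \<Rightarrow> nat \<Rightarrow> (nat \<Rightarrow> 'a \<Rightarrow> real) \<Rightarrow> bool" where
  "incoherent \<mu> M m g \<longleftrightarrow>
     (\<forall>k<m. \<forall>k'<m. k \<noteq> k' \<longrightarrow>
        \<bar>L2_inner M (g k) (g k')\<bar> \<le> \<mu> * L2_norm M (g k) * L2_norm M (g k'))"


definition prob_density :: "real measure \<Rightarrow> (real \<Rightarrow> real) \<Rightarrow> bool" where
  "prob_density M g \<longleftrightarrow> integrable M g \<and> (AE x in M. 0 \<le> g x) \<and> (LINT x|M. g x) = 1"

definition mixture_weights :: "nat \<Rightarrow> (nat \<Rightarrow> real) \<Rightarrow> bool" where
  "mixture_weights m \<pi> \<longleftrightarrow> (\<forall>k<m. 0 < \<pi> k) \<and> (\<Sum>k<m. \<pi> k) = 1"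

definition mixture ::
    "nat \<Rightarrow> (nat \<Rightarrow> real) \<Rightarrow> (nat \<Rightarrow> nat \<Rightarrow> real \<Rightarrow> real) \<Rightarrow> (nat \<Rightarrow> real) \<Rightarrow> real" where
  "mixture m \<pi> fc x = (\<Sum>k<m. \<pi> k * (\<Prod>j<2 * m - 1. fc k j (x j)))"

definition estimable ::
    "real \<Rightarrow> real \<Rightarrow> nat \<Rightarrow> (nat \<Rightarrow> real) \<Rightarrow> (nat \<Rightarrow> nat \<Rightarrow> real \<Rightarrow> real) \<Rightarrow> bool" where
  "estimable \<mu> \<zeta> m \<pi> fc \<longleftrightarrow>
     0 \<le> \<mu> \<and> \<mu> < 1 \<and>
     (\<forall>k<m. \<forall>j<2 * m - 1. sq_integrable unit_interval (fc k j)) \<and>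
     (\<forall>j<2 * m - 1. incoherent \<mu> unit_interval m (\<lambda>k. fc k j)) \<and>
     0 < \<zeta> \<and> (\<forall>k<m. \<zeta> \<le> \<pi> k)"


definition T_plus ::
    "nat \<Rightarrow> ((nat \<Rightarrow> real) \<Rightarrow> real) \<Rightarrow> (nat \<Rightarrow> real) \<Rightarrow> (nat \<Rightarrow> real) \<Rightarrow> real" where
  "T_plus m fhat y z = (LINT x|unit_interval. fhat (point m y z x))"

(* The sequences are infinite, possibly padded with zero singular values.  Convergence of the
   kernels in L2 is Hilbert-Schmidt convergence of the operators. *)
definition is_SVD ::
    "'a measure \<Rightarrow> 'b measure \<Rightarrow> ('a \<Rightarrow> 'b \<Rightarrow> real) \<Rightarrow>
     (nat \<Rightarrow> real) \<Rightarrow> (nat \<Rightarrow> 'a \<Rightarrow> real) \<Rightarrow> (nat \<Rightarrow> 'b \<Rightarrow> real) \<Rightarrow> bool" where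
  "is_SVD M N T s \<phi> \<psi> \<longleftrightarrow>
     (\<forall>k. 0 \<le> s k) \<and> decseq s \<and> orthonormal_L2 M \<phi> \<and> orthonormal_L2 N \<psi> \<and>
     (\<lambda>n. L2_norm (M \<Otimes>\<^sub>M N) (\<lambda>(y, z). T y z - (\<Sum>k<n. s k * \<phi> k y * \<psi> k z)))
       \<longlonglongrightarrow> 0"

definition eta ::
    "nat \<Rightarrow> ((nat \<Rightarrow> real) \<Rightarrow> real) \<Rightarrow> real set \<Rightarrow> (nat \<Rightarrow> real) \<Rightarrow>
     (nat \<Rightarrow> (nat \<Rightarrow> real) \<Rightarrow> real) \<Rightarrow> (nat \<Rightarrow> (nat \<Rightarrow> real) \<Rightarrow> real) \<Rightarrow> nat \<Rightarrow> nat \<Rightarrow> real" where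
  "eta m fhat A s \<phi> \<psi> l t =
     1 / s t *
     (LINT x:A|unit_interval. LINT z|z_cube m. LINT y|y_cube m.
        \<phi> l y * fhat (point m y z x) * \<psi> t z)"

(* The real matrix eta may have non-real eigenvalues, so its eigenvectors are taken over the
   complex numbers. *)
definition eta_matrix ::
    "nat \<Rightarrow> ((nat \<Rightarrow> real) \<Rightarrow> real) \<Rightarrow> real set \<Rightarrow> (nat \<Rightarrow> real) \<Rightarrow>
     (nat \<Rightarrow> (nat \<Rightarrow> real) \<Rightarrow> real) \<Rightarrow> (nat \<Rightarrow> (nat \<Rightarrow> real) \<Rightarrow> real) \<Rightarrow> complex mat" where
  "eta_matrix m fhat A s \<phi> \<psi> =
     mat m m (\<lambda>(l, t). complex_of_real (eta m fhat A s \<phi> \<psi> l t))"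

(* The last conjunct makes w a full list of eigenvectors: it spans every eigenspace.  Hence w is an
   eigenbasis if H is diagonalizable, and a suitable w (with repetitions) exists also if H is not. *)
definition unit_eigenvectors :: "nat \<Rightarrow> complex mat \<Rightarrow> (nat \<Rightarrow> complex vec) \<Rightarrow> bool" where
  "unit_eigenvectors m H w \<longleftrightarrow>
     (\<forall>k<m. (\<exists>a. eigenvector H (w k) a) \<and> (\<Sum>h<m. (cmod (vec_index (w k) h))\<^sup>2) = 1) \<and>
     (\<forall>v a. eigenvector H v a \<longrightarrow>
        (\<exists>c. \<forall>h<m. vec_index v h = (\<Sum>k<m. c k * vec_index (w k) h)))"

definition g_hat ::
    "nat \<Rightarrow> (nat \<Rightarrow> (nat \<Rightarrow> real) \<Rightarrow> real) \<Rightarrow> complex vec \<Rightarrow> (nat \<Rightarrow> real) \<Rightarrow> complex" where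
  "g_hat m \<phi> v y = (\<Sum>h<m. vec_index v h * complex_of_real (\<phi> h y))"

definition h_hat ::
    "nat \<Rightarrow> (nat \<Rightarrow> (nat \<Rightarrow> real) \<Rightarrow> real) \<Rightarrow> complex vec \<Rightarrow> (nat \<Rightarrow> real) \<Rightarrow> complex" where
  "h_hat m \<phi> v y = g_hat m \<phi> v y / complex_of_real (L1_norm (y_cube m) (g_hat m \<phi> v))"

definition first_marginal ::
    "nat \<Rightarrow> ((nat \<Rightarrow> real) \<Rightarrow> complex) \<Rightarrow> real \<Rightarrow> complex" where
  "first_marginal m h x = (LINT y|cube {1..<m - 1}. h (y(0 := x)))"

(* "out" is a possible output of the Recovery Algorithm: the singular value decomposition and the
   eigenvectors are arbitrary, except that a unit eigenvector is determined only up to a phase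
   (a sign, if real), and the phase is fixed by making the integral of g_hat nonnegative.
   Without this, replacing an eigenvector by its negative would negate the output. *)
definition recovery_output ::
    "nat \<Rightarrow> ((nat \<Rightarrow> real) \<Rightarrow> real) \<Rightarrow> real set \<Rightarrow> (nat \<Rightarrow> real \<Rightarrow> complex) \<Rightarrow> bool" where
  "recovery_output m fhat A out \<longleftrightarrow>
     (\<exists>s \<phi> \<psi> w.
        is_SVD (y_cube m) (z_cube m) (T_plus m fhat) s \<phi> \<psi> \<and>
        unit_eigenvectors m (eta_matrix m fhat A s \<phi> \<psi>) w \<and>
        (\<forall>k<m. (LINT y|y_cube m. g_hat m \<phi> (w k) y) \<in> \<real>\<^sub>\<ge>\<^sub>0) \<and>
        (\<forall>k<m. out k = first_marginal m (h_hat m \<phi> (w k))))"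

end

theory Submission
  imports Defs "HOL-Probability.Infinite_Product_Measure"
begin

text \<open>
  Write \<open>G\<^sub>k\<close> and \<open>H\<^sub>k\<close> for the product densities in the variables \<open>y\<close> and \<open>z\<close>. Without noise the two
  kernels of the algorithm are \<open>\<Sum>\<pi>\<^sub>k G\<^sub>k \<otimes> H\<^sub>k\<close> and \<open>\<Sum>\<pi>\<^sub>k a\<^sub>k G\<^sub>k \<otimes> H\<^sub>k\<close>, so in the basis of singular vectors
  the matrix \<open>\<eta>\<close> is \<open>B diag(a) B\<^sup>-\<^sup>1\<close> with \<open>B l k = \<langle>\<phi> l, G k\<rangle>\<close>, and its eigenvectors are the coordinate
  vectors of the \<open>G\<^sub>k\<close>.

  Incoherence bounds the Gram matrices of the \<open>G\<^sub>k\<close> and the \<open>H\<^sub>k\<close> from below: a tensor product of \<open>m - 1\<close>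
  functions, the \<open>j\<close>-th orthogonal to the \<open>j\<close>-th of the \<open>m - 1\<close> competitors, isolates one coefficient of a
  combination. Weyl's inequality then bounds the first \<open>m\<close> noisy singular values from below by \<open>1 / q\<close>, where
  \<open>q\<close> is of order \<open>1 / (\<zeta> (1 - \<mu>)\<^sup>m)\<close>, and hence \<open>B\<^sup>-\<^sup>1\<close> from above. The noisy \<open>\<eta>\<close> satisfies
  \<open>B\<^sup>-\<^sup>1 \<eta> = diag(a) B\<^sup>-\<^sup>1 + X\<close> with \<open>X\<close> of size \<open>q\<^sup>2 \<epsilon>\<close>. If \<open>X\<close> is small compared to the gap \<open>\<delta>\<close>, a sign
  change of the characteristic polynomial near every \<open>a\<^sub>k\<close> yields \<open>m\<close> distinct eigenvalues, which matches the
  eigenvectors with the components; in the coordinates \<open>B\<^sup>-\<^sup>1 w\<close> an eigenvector \<open>w\<close> is concentrated on its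
  component. If \<open>X\<close> is not small, the claimed bound is so weak that every assignment satisfies it. A lower bound
  of order \<open>1 / q\<close> for the normalizing \<open>L\<^sup>1\<close>-norm contributes the third factor \<open>q\<close>.
\<close>

section \<open>Linear algebra with explicit indices\<close>

text \<open>A trivial kernel forces a nonzero determinant, so the matrix is a unit of the matrix
  ring. Both inverse laws are unpacked into entrywise sums, the form in which the coefficient
  estimates below use them.\<close>

lemma injective_imp_inverse:
  fixes B :: "nat \<Rightarrow> nat \<Rightarrow> real"
  assumes "\<And>x. (\<And>i. i < m \<Longrightarrow> (\<Sum>j<m. B i j * x j) = 0) \<Longrightarrow> (\<And>j. j < m \<Longrightarrow> x j = 0)"
  obtains W where
    "\<And>i j. i < m \<Longrightarrow> j < m \<Longrightarrow> (\<Sum>k<m. B i k * W k j) = of_bool (i = j)"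
    "\<And>i j. i < m \<Longrightarrow> j < m \<Longrightarrow> (\<Sum>k<m. W i k * B k j) = of_bool (i = j)"
proof -
  define A where "A = mat m m (\<lambda>(i, j). B i j)"
  have A: "A \<in> carrier_mat m m" by (simp add: A_def)
  have "Determinant.det A \<noteq> 0"
  proof
    assume "Determinant.det A = 0"
    then obtain v where v: "v \<in> carrier_vec m" "v \<noteq> 0\<^sub>v m" "A *\<^sub>v v = 0\<^sub>v m"
      using det_0_iff_vec_prod_zero[OF A] by auto
    have "(\<Sum>j<m. B i j * vec_index v j) = 0" if "i < m" for i
    proof -
      have "vec_index (A *\<^sub>v v) i = 0" using v that by simp
      then show ?thesis using v(1) that by (simp add: A_def scalar_prod_def lessThan_atLeast0)
    qed
    then have "vec_index v j = 0" if "j < m" for j using assms that by blast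
    then show False using v by auto
  qed
  then have "A \<in> Units (ring_mat TYPE(real) m b)" for b by (rule det_non_zero_imp_unit[OF A])
  then obtain W where W: "W \<in> carrier_mat m m" "W * A = 1\<^sub>m m" "A * W = 1\<^sub>m m"
    unfolding Units_def ring_mat_def by auto
  show thesis
  proof (rule that[of "\<lambda>i j. W $$ (i, j)"])
    fix i j assume ij: "i < m" "j < m"
    have "(A * W) $$ (i, j) = of_bool (i = j)" using W ij by simp
    then show "(\<Sum>k<m. B i k * W $$ (k, j)) = of_bool (i = j)"
      using W(1) ij by (simp add: A_def scalar_prod_def lessThan_atLeast0)
    have "(W * A) $$ (i, j) = of_bool (i = j)" using W ij by simp
    then show "(\<Sum>k<m. W $$ (i, k) * B k j) = of_bool (i = j)"
      using W(1) ij by (simp add: A_def scalar_prod_def lessThan_atLeast0)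
  qed
qed

lemma right_inverse_imp_left_inverse:
  fixes B W :: "nat \<Rightarrow> nat \<Rightarrow> real"
  assumes "\<And>i j. i < m \<Longrightarrow> j < m \<Longrightarrow> (\<Sum>k<m. B i k * W k j) = of_bool (i = j)" "i < m" "j < m"
  shows "(\<Sum>k<m. W i k * B k j) = of_bool (i = j)"
proof -
  let ?B = "mat m m (\<lambda>(i, j). B i j)" and ?W = "mat m m (\<lambda>(i, j). W i j)"
  have "?B * ?W = 1\<^sub>m m"
    by (rule eq_matI) (auto simp: scalar_prod_def lessThan_atLeast0[symmetric] assms(1))
  then have "?W * ?B = 1\<^sub>m m" by (rule mat_mult_left_right_inverse[rotated 2]) auto
  then have "(?W * ?B) $$ (i, j) = of_bool (i = j)" using assms(2,3) by simp
  then show ?thesis using assms(2,3) by (simp add: scalar_prod_def lessThan_atLeast0)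
qed

text \<open>Padding the \<open>n\<close> equations with zero rows gives a square singular matrix,
  whose kernel vector solves the system. It supplies the test vector for Weyl's inequality.\<close>

lemma underdetermined_system:
  fixes B :: "nat \<Rightarrow> nat \<Rightarrow> real"
  assumes "n < m"
  obtains x where "\<exists>j<m. x j \<noteq> 0" "\<And>i. i < n \<Longrightarrow> (\<Sum>j<m. B i j * x j) = 0"
proof -
  define A where "A = mat m m (\<lambda>(i, j). if i < n then B i j else 0)"
  have A: "A \<in> carrier_mat m m" by (simp add: A_def)
  \<comment> \<open>Row \<open>n\<close> of the padded matrix is zero, so every term of the Leibniz
    formula has a zero factor.\<close>
  have "Determinant.det A = 0"
    using assms
    by (subst det_def'[OF A])
       (auto simp: A_def intro!: sum.neutral bexI[of _ n] dest: permutes_in_image[of _ _ n])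
  then obtain v where v: "v \<in> carrier_vec m" "v \<noteq> 0\<^sub>v m" "A *\<^sub>v v = 0\<^sub>v m"
    using det_0_iff_vec_prod_zero[OF A] by auto
  show thesis
  proof (rule that[of "vec_index v"])
    show "\<exists>j<m. vec_index v j \<noteq> 0" using v(1,2) by (metis carrier_vecD eq_vecI index_zero_vec)
    fix i assume "i < n"
    moreover have "vec_index (A *\<^sub>v v) i = 0" using v assms \<open>i < n\<close> by simp
    ultimately show "(\<Sum>j<m. B i j * vec_index v j) = 0"
      using v(1) assms by (simp add: A_def scalar_prod_def lessThan_atLeast0)
  qed
qed

section \<open>Diagonally dominant matrices and localization of eigenvalues\<close>

lemma diag_dominant_kernel:
  fixes E :: "nat \<Rightarrow> nat \<Rightarrow> real"
  assumes E: "\<And>i j. i < m \<Longrightarrow> j < m \<Longrightarrow> \<bar>E i j\<bar> \<le> \<kappa>" and d: "\<And>i. i < m \<Longrightarrow> m * \<kappa> < \<bar>d i\<bar>"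
    and x: "\<And>i. i < m \<Longrightarrow> d i * x i + (\<Sum>j<m. E i j * x j) = 0" and "j < m"
  shows "x j = 0"
proof -
  \<comment> \<open>In the row where \<open>x\<close> is largest in modulus, the perturbation
    contributes at most \<open>m * \<kappa> * b\<close>, too little to cancel the diagonal term
    unless \<open>b = 0\<close>.\<close>
  define b where "b = Max ((\<lambda>i. \<bar>x i\<bar>) ` {..<m})"
  have "b \<in> (\<lambda>i. \<bar>x i\<bar>) ` {..<m}" unfolding b_def using \<open>j < m\<close> by (intro Max_in) auto
  then obtain k where k: "k < m" "b = \<bar>x k\<bar>" by auto
  have b: "\<bar>x i\<bar> \<le> b" if "i < m" for i unfolding b_def using that by (intro Max_ge) auto
  have "\<bar>d k\<bar> * b = \<bar>\<Sum>j<m. E k j * x j\<bar>"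
    using x[OF k(1)] k(2) by (simp add: abs_mult[symmetric] eq_neg_iff_add_eq_0[symmetric])
  also have "\<dots> \<le> (\<Sum>j<m. \<bar>E k j\<bar> * \<bar>x j\<bar>)" by (metis (no_types, lifting) abs_mult sum.cong sum_abs)
  also have "\<dots> \<le> (\<Sum>j<m. \<kappa> * b)"
    using E[OF k(1)] b by (intro sum_mono mult_mono) (auto intro: order_trans[OF abs_ge_zero])
  also have "\<dots> = (m * \<kappa>) * b" by simp
  finally have "(\<bar>d k\<bar> - m * \<kappa>) * b \<le> 0" by (simp add: algebra_simps)
  then have "b \<le> 0" using d[OF k(1)] by (simp add: mult_le_0_iff)
  then show ?thesis using b[OF \<open>j < m\<close>] by simp
qed

text \<open>A homotopy argument: scaling the perturbation by \<open>s\<close> from 0 to 1 keeps the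
  matrix diagonally dominant, so the determinant, a polynomial in \<open>s\<close>, never vanishes
  and keeps the sign that it has at \<open>s = 0\<close>, namely that of the product of the diagonal
  entries.\<close>

lemma diag_dominant_det:
  fixes E :: "nat \<Rightarrow> nat \<Rightarrow> real"
  assumes E: "\<And>i j. i < m \<Longrightarrow> j < m \<Longrightarrow> \<bar>E i j\<bar> \<le> \<kappa>" and d: "\<And>i. i < m \<Longrightarrow> m * \<kappa> < \<bar>d i\<bar>"
  shows "0 < Determinant.det (mat m m (\<lambda>(i, j). of_bool (i = j) * d i + E i j)) * (\<Prod>i<m. d i)"
proof -
  define A where "A s = mat m m (\<lambda>(i, j). of_bool (i = j) * d i + s * E i j)" for s :: real
  have A: "A s \<in> carrier_mat m m" for s by (simp add: A_def)
  have det: "Determinant.det (A s) = (\<Sum>p | p permutes {0..<m}.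
      signof p * (\<Prod>i = 0..<m. of_bool (i = p i) * d i + s * E i (p i)))" for s
    by (subst det_def'[OF A]) (auto simp: A_def intro!: sum.cong prod.cong)
  have cont: "continuous_on {0..1} (\<lambda>s. Determinant.det (A s) * (\<Prod>i<m. d i))"
    unfolding det by (intro continuous_intros)
  have nz: "Determinant.det (A s) \<noteq> 0" if s: "0 \<le> s" "s \<le> 1" for s
  proof
    assume "Determinant.det (A s) = 0"
    then obtain v where v: "v \<in> carrier_vec m" "v \<noteq> 0\<^sub>v m" "A s *\<^sub>v v = 0\<^sub>v m"
      using det_0_iff_vec_prod_zero[OF A] by auto
    have eq: "d i * vec_index v i + (\<Sum>j<m. (s * E i j) * vec_index v j) = 0" if "i < m" for i
    proof -
      have "vec_index (A s *\<^sub>v v) i = 0" using v that by simp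
      moreover have "(\<Sum>j<m. of_bool (i = j) * d i * vec_index v j) = d i * vec_index v i"
        using that by (subst sum.remove[of _ i]) auto
      ultimately show ?thesis using v(1) that
        by (simp add: A_def scalar_prod_def lessThan_atLeast0 ring_distribs sum.distrib)
    qed
    have "\<bar>s * E i j\<bar> \<le> \<kappa>" if "i < m" "j < m" for i j
      using mult_mono[OF s(2) E[OF that]] s by (auto simp: abs_mult)
    then have "vec_index v j = 0" if "j < m" for j
      using diag_dominant_kernel[of m "\<lambda>i j. s * E i j" \<kappa> d "vec_index v"] d eq that by blast
    then show False using v by auto
  qed
  have dnz: "d i \<noteq> 0" if "i < m" for i
    using d[OF that] mult_nonneg_nonneg[OF of_nat_0_le_iff[of m] order_trans[OF abs_ge_zero E[OF that that]]]
    by auto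
  have "Determinant.det (A 0) = (\<Prod>i<m. d i)"
  proof -
    have "Determinant.det (A 0) = prod_list (diag_mat (A 0))"
      by (rule det_upper_triangular[OF _ A]) (auto simp: A_def)
    also have "\<dots> = (\<Prod>i<m. d i)"
      by (auto simp: prod_list_diag_prod A_def lessThan_atLeast0 intro!: prod.cong)
    finally show ?thesis .
  qed
  moreover have "(\<Prod>i<m. d i) \<noteq> 0" using dnz by simp
  ultimately have 0: "0 < Determinant.det (A 0) * (\<Prod>i<m. d i)" by (metis not_real_square_gt_zero)
  have "0 < Determinant.det (A 1) * (\<Prod>i<m. d i)"
  proof (rule ccontr)
    assume "\<not> ?thesis"
    then obtain s where "0 \<le> s" "s \<le> 1" "Determinant.det (A s) * (\<Prod>i<m. d i) = 0"
      using IVT2'[of "\<lambda>s. Determinant.det (A s) * (\<Prod>i<m. d i)" 1 0 0] 0 cont by auto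
    then show False using nz \<open>(\<Prod>i<m. d i) \<noteq> 0\<close> by simp
  qed
  then show ?thesis by (simp add: A_def)
qed

text \<open>At distance exactly \<open>\<delta> / 2\<close> from \<open>a k\<close> the matrix
  \<open>t - diag(a) - E\<close> is diagonally dominant, so its determinant has the sign of the
  product of the \<open>t - a i\<close>. Only the factor with \<open>i = k\<close> changes sign
  across the interval, hence the determinant vanishes inside. The eigenvalue found in this way is
  real and has a real eigenvector.\<close>

lemma perturbed_diagonal_eigenvalue:
  fixes E :: "nat \<Rightarrow> nat \<Rightarrow> real"
  assumes E: "\<And>i j. i < m \<Longrightarrow> j < m \<Longrightarrow> \<bar>E i j\<bar> \<le> \<kappa>" and \<kappa>: "m * \<kappa> < \<delta> / 2"
    and gap: "\<And>i j. i < m \<Longrightarrow> j < m \<Longrightarrow> i \<noteq> j \<Longrightarrow> \<delta> \<le> \<bar>a i - a j\<bar>" and "k < m"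
  obtains t x where "\<bar>t - a k\<bar> < \<delta> / 2" "\<exists>j<m. x j \<noteq> 0"
    "\<And>i. i < m \<Longrightarrow> a i * x i + (\<Sum>j<m. E i j * x j) = t * x i"
proof -
  define A where "A t = mat m m (\<lambda>(i, j). of_bool (i = j) * (t - a i) + - E i j)" for t :: real
  have A: "A t \<in> carrier_mat m m" for t by (simp add: A_def)
  define p where "p t = Determinant.det (A t)" for t
  have det: "p t = (\<Sum>p | p permutes {0..<m}.
      signof p * (\<Prod>i = 0..<m. of_bool (i = p i) * (t - a i) + - E i (p i)))" for t
    unfolding p_def by (subst det_def'[OF A]) (auto simp: A_def intro!: sum.cong prod.cong)
  have cont: "continuous_on S p" for S
    unfolding det by (intro continuous_intros)
  have \<kappa>0: "0 \<le> \<kappa>" using E[OF \<open>k < m\<close> \<open>k < m\<close>] by linarith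
  have \<delta>: "0 < \<delta>" using \<kappa> \<kappa>0 mult_nonneg_nonneg[of "real m" \<kappa>] by linarith
  have dom: "m * \<kappa> < \<bar>t - a i\<bar>" if t: "\<bar>t - a k\<bar> = \<delta> / 2" and "i < m" for t i
  proof (cases "i = k")
    case False
    then have "\<delta> \<le> \<bar>a i - a k\<bar>" using gap \<open>k < m\<close> that by auto
    then show ?thesis using t \<kappa> by linarith
  qed (use t \<kappa> in simp)
  have pos: "0 < p t * (\<Prod>i<m. t - a i)" if t: "\<bar>t - a k\<bar> = \<delta> / 2" for t
    unfolding p_def A_def using E dom[OF t] by (intro diag_dominant_det[where \<kappa> = \<kappa>]) auto
  let ?l = "a k - \<delta> / 2" and ?u = "a k + \<delta> / 2"
  \<comment> \<open>\<open>P\<close> collects the factors with \<open>i \<noteq> k\<close>; by the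
    gap condition each has the same sign at both ends of the interval.\<close>
  define P where "P t = (\<Prod>i\<in>{..<m} - {k}. t - a i)" for t
  have split: "(\<Prod>i<m. t - a i) = (t - a k) * P t" for t
    unfolding P_def using \<open>k < m\<close> by (subst prod.remove[of _ k]) auto
  have PP: "0 < P ?l * P ?u"
    unfolding P_def prod.distrib[symmetric]
  proof (rule prod_pos)
    fix i assume "i \<in> {..<m} - {k}"
    then have "\<delta> \<le> \<bar>a i - a k\<bar>" using gap \<open>k < m\<close> by auto
    then consider "a i \<le> a k - \<delta>" | "a k + \<delta> \<le> a i" by linarith
    then show "0 < (?l - a i) * (?u - a i)"
      by cases (use \<delta> in \<open>auto simp: zero_less_mult_iff\<close>)
  qed
  have l: "p ?l * P ?l < 0" using pos[of ?l] \<delta> unfolding split by (simp add: zero_less_mult_iff mult_less_0_iff)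
  have u: "0 < p ?u * P ?u" using pos[of ?u] \<delta> unfolding split by (simp add: zero_less_mult_iff mult_less_0_iff)
  have ends: "p ?l < 0 \<and> 0 < p ?u \<or> p ?u < 0 \<and> 0 < p ?l"
    using l u PP by (auto simp: zero_less_mult_iff mult_less_0_iff)
  then obtain t where t: "?l \<le> t" "t \<le> ?u" "p t = 0"
    using IVT'[of p ?l 0 ?u] IVT2'[of p ?u 0 ?l] cont \<delta> by force
  \<comment> \<open>The strict inequality makes the intervals around different \<open>a k\<close>
    disjoint, which the matching of eigenvectors relies on.\<close>
  have "t \<noteq> ?l" "t \<noteq> ?u" using t(3) ends by auto
  then have t': "\<bar>t - a k\<bar> < \<delta> / 2" using t(1,2) by linarith
  obtain v where v: "v \<in> carrier_vec m" "v \<noteq> 0\<^sub>v m" "A t *\<^sub>v v = 0\<^sub>v m"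
    using det_0_iff_vec_prod_zero[OF A] t(3) unfolding p_def by blast
  show thesis
  proof (rule that[OF t', of "vec_index v"])
    show "\<exists>j<m. vec_index v j \<noteq> 0" using v(1,2) by (metis carrier_vecD eq_vecI index_zero_vec)
    fix i assume "i < m"
    have "vec_index (A t *\<^sub>v v) i = 0" using v \<open>i < m\<close> by simp
    moreover have "(\<Sum>j<m. of_bool (i = j) * (t - a i) * vec_index v j) = (t - a i) * vec_index v i"
      using \<open>i < m\<close> by (subst sum.remove[of _ i]) auto
    ultimately show "a i * vec_index v i + (\<Sum>j<m. E i j * vec_index v j) = t * vec_index v i"
      using v(1) \<open>i < m\<close>
      by (simp add: A_def scalar_prod_def lessThan_atLeast0 ring_distribs sum.distrib sum_negf sum_subtractf)
  qed
qed

text \<open>Applying \<open>\<eta> - \<alpha> n\<close> to the expansion of \<open>v\<close> removes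
  the last vector and multiplies \<open>v\<close> by \<open>t - \<alpha> n\<close>. If this factor
  is nonzero, dividing by it expresses \<open>v\<close> by one vector fewer; the induction must end
  with some \<open>\<alpha> k = t\<close> because \<open>v\<close> is not zero. The family may
  contain repetitions.\<close>

lemma eigenvalue_of_spanning_family:
  fixes \<eta> :: "nat \<Rightarrow> nat \<Rightarrow> complex" and n :: nat
  assumes w: "\<And>k i. k < n \<Longrightarrow> i < m \<Longrightarrow> (\<Sum>j<m. \<eta> i j * w k j) = \<alpha> k * w k i"
    and v: "\<And>i. i < m \<Longrightarrow> (\<Sum>j<m. \<eta> i j * v j) = t * v i" "\<exists>j<m. v j \<noteq> 0"
    and span: "\<And>i. i < m \<Longrightarrow> v i = (\<Sum>k<n. c k * w k i)"
  shows "\<exists>k<n. \<alpha> k = t"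
  using w span
proof (induction n arbitrary: c)
  case 0
  then show ?case using v(2) by auto
next
  case (Suc n)
  show ?case
  proof (cases "\<alpha> n = t")
    case False
    have "\<exists>k<n. \<alpha> k = t"
    proof (rule Suc.IH)
      show "v i = (\<Sum>k<n. (\<alpha> k - \<alpha> n) * c k / (t - \<alpha> n) * w k i)" if i: "i < m" for i
      proof -
        have "t * v i = (\<Sum>j<m. \<eta> i j * (\<Sum>k<Suc n. c k * w k j))"
          using v(1)[OF i] Suc.prems(2) by simp
        also have "\<dots> = (\<Sum>k<Suc n. c k * (\<Sum>j<m. \<eta> i j * w k j))"
          unfolding sum_distrib_left by (subst sum.swap) (simp add: mult_ac)
        also have "\<dots> = (\<Sum>k<Suc n. c k * (\<alpha> k * w k i))"
          using Suc.prems(1) i by simp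
        finally have "(t - \<alpha> n) * v i = (\<Sum>k<Suc n. c k * (\<alpha> k * w k i)) - \<alpha> n * (\<Sum>k<Suc n. c k * w k i)"
          using Suc.prems(2)[OF i] by (simp add: algebra_simps)
        also have "\<dots> = (\<Sum>k<n. (\<alpha> k - \<alpha> n) * c k * w k i)"
          by (simp add: sum_distrib_left sum_subtractf[symmetric] algebra_simps)
        finally show ?thesis using False
          by (simp add: sum_divide_distrib[symmetric] field_simps)
      qed
    qed (use Suc.prems in auto)
    then show ?thesis using less_Suc_eq by blast
  qed auto
qed

section \<open>Square integrable functions\<close>

lemma sq_integrableD:
  assumes "sq_integrable M f"
  shows "f \<in> borel_measurable M" "integrable M (\<lambda>x. (norm (f x))\<^sup>2)"
  using assms by (auto simp: sq_integrable_def)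

lemma sq_integrable_norm: "sq_integrable M f \<Longrightarrow> sq_integrable M (\<lambda>x. norm (f x))"
  by (auto simp: sq_integrable_def)

lemma sq_integrable_of_real:
  "sq_integrable M f \<Longrightarrow> sq_integrable M (\<lambda>x. complex_of_real (f x))"
  by (auto simp: sq_integrable_def)

lemma sq_integrable_add:
  assumes "sq_integrable M f" "sq_integrable M g"
  shows "sq_integrable M (\<lambda>x. f x + g x)"
  unfolding sq_integrable_def
proof
  note [measurable] = sq_integrableD(1)[OF assms(1)] sq_integrableD(1)[OF assms(2)]
  show "(\<lambda>x. f x + g x) \<in> borel_measurable M" by measurable
  show "integrable M (\<lambda>x. (norm (f x + g x))\<^sup>2)"
  proof (rule Bochner_Integration.integrable_bound)
    show "integrable M (\<lambda>x. 2 * (norm (f x))\<^sup>2 + 2 * (norm (g x))\<^sup>2)"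
      using sq_integrableD(2)[OF assms(1)] sq_integrableD(2)[OF assms(2)] by auto
    have "(norm (a + b))\<^sup>2 \<le> 2 * (norm a)\<^sup>2 + 2 * (norm b)\<^sup>2" for a b :: 'b
    proof -
      have "(norm (a + b))\<^sup>2 \<le> (norm a + norm b)\<^sup>2" by (intro power_mono norm_triangle_ineq) auto
      also have "\<dots> \<le> 2 * (norm a)\<^sup>2 + 2 * (norm b)\<^sup>2"
        using zero_le_power2[of "norm a - norm b"] by (simp add: power2_eq_square algebra_simps)
      finally show ?thesis .
    qed
    then show "AE x in M. norm ((norm (f x + g x))\<^sup>2) \<le> norm (2 * (norm (f x))\<^sup>2 + 2 * (norm (g x))\<^sup>2)"
      by simp
  qed measurable
qed

lemma sq_integrable_cmult:
  fixes f :: "'a \<Rightarrow> 'b::{banach, second_countable_topology, real_normed_field}"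
  assumes "sq_integrable M f"
  shows "sq_integrable M (\<lambda>x. c * f x)"
  using assms by (auto simp: sq_integrable_def norm_mult power_mult_distrib)

lemma sq_integrable_diff:
  fixes f :: "'a \<Rightarrow> 'b::{banach, second_countable_topology, real_normed_field}"
  assumes "sq_integrable M f" "sq_integrable M g"
  shows "sq_integrable M (\<lambda>x. f x - g x)"
  using sq_integrable_add[OF assms(1) sq_integrable_cmult[OF assms(2), of "-1"]] by simp

lemma sq_integrable_sum:
  assumes "\<And>i. i \<in> I \<Longrightarrow> sq_integrable M (f i)"
  shows "sq_integrable M (\<lambda>x. \<Sum>i\<in>I. f i x)"
  using assms
proof (induction I rule: infinite_finite_induct)
  case (insert i I)
  then show ?case by (simp add: sq_integrable_add)
qed (auto simp: sq_integrable_def)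

lemmas sq_integrable_intros =
  sq_integrable_add sq_integrable_diff sq_integrable_sum sq_integrable_cmult sq_integrable_of_real

lemma integrable_mult_sq:
  fixes f :: "'a \<Rightarrow> real"
  assumes "sq_integrable M f" "sq_integrable M g"
  shows "integrable M (\<lambda>x. f x * g x)"
proof (rule Bochner_Integration.integrable_bound)
  note [measurable] = sq_integrableD(1)[OF assms(1)] sq_integrableD(1)[OF assms(2)]
  show "integrable M (\<lambda>x. (norm (f x))\<^sup>2 + (norm (g x))\<^sup>2)"
    using sq_integrableD(2)[OF assms(1)] sq_integrableD(2)[OF assms(2)] by auto
  show "(\<lambda>x. f x * g x) \<in> borel_measurable M" by measurable
  have "\<bar>a * b\<bar> \<le> a\<^sup>2 + b\<^sup>2" for a b :: real
    using zero_le_power2[of "\<bar>a\<bar> - \<bar>b\<bar>"] mult_nonneg_nonneg[OF abs_ge_zero[of a] abs_ge_zero[of b]]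
    unfolding power2_diff abs_mult power2_abs by linarith
  then show "AE x in M. norm (f x * g x) \<le> norm ((norm (f x))\<^sup>2 + (norm (g x))\<^sup>2)" by simp
qed

lemma (in prob_space) integrable_sq:
  assumes "sq_integrable M f"
  shows "integrable M f"
proof (rule Bochner_Integration.integrable_bound)
  show "integrable M (\<lambda>x. 1 + (norm (f x))\<^sup>2)"
    using sq_integrableD(2)[OF assms] by auto
  have "a \<le> 1 + a\<^sup>2" for a :: real
    using zero_le_power2[of "a - 1/2"] by (simp add: power2_eq_square algebra_simps)
  then show "AE x in M. norm (f x) \<le> norm (1 + (norm (f x))\<^sup>2)" by simp
qed (rule sq_integrableD(1)[OF assms])

section \<open>Inequalities for the norm and the inner product\<close>

lemma L2_norm_nonneg: "0 \<le> L2_norm M f"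
  by (simp add: L2_norm_def)

lemma L2_norm_sq: "(L2_norm M f)\<^sup>2 = (LINT x|M. (norm (f x))\<^sup>2)"
  by (simp add: L2_norm_def)

lemma L2_inner_self: "L2_inner M f f = (L2_norm M f)\<^sup>2"
  unfolding L2_norm_sq L2_inner_def by (simp add: power2_eq_square)

lemma L2_norm_eq: "L2_norm M (\<lambda>x. norm (f x)) = L2_norm M f"
  by (simp add: L2_norm_def)

lemma L2_norm_of_real: "L2_norm M (\<lambda>x. complex_of_real (f x)) = L2_norm M f"
  by (simp add: L2_norm_def)

lemma L2_norm_cmult:
  fixes f :: "'a \<Rightarrow> 'b::{banach, second_countable_topology, real_normed_field}"
  shows "L2_norm M (\<lambda>x. c * f x) = norm c * L2_norm M f"
  by (simp add: L2_norm_def norm_mult power_mult_distrib real_sqrt_mult)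

lemma L2_inner_commute: "L2_inner M f g = L2_inner M g f"
  by (simp add: L2_inner_def mult.commute)

lemma L2_inner_sum_left:
  assumes "\<And>i. i \<in> I \<Longrightarrow> sq_integrable M (f i)" "sq_integrable M g"
  shows "L2_inner M (\<lambda>x. \<Sum>i\<in>I. c i * f i x) g = (\<Sum>i\<in>I. c i * L2_inner M (f i) g)"
proof -
  have "L2_inner M (\<lambda>x. \<Sum>i\<in>I. c i * f i x) g = (LINT x|M. (\<Sum>i\<in>I. c i * (f i x * g x)))"
    by (simp add: L2_inner_def sum_distrib_right mult.assoc)
  also have "\<dots> = (\<Sum>i\<in>I. c i * L2_inner M (f i) g)"
    unfolding L2_inner_def using assms by (subst Bochner_Integration.integral_sum) (auto intro!: integrable_mult_sq)
  finally show ?thesis .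
qed

lemma L2_inner_sum_right:
  assumes "\<And>i. i \<in> I \<Longrightarrow> sq_integrable M (f i)" "sq_integrable M g"
  shows "L2_inner M g (\<lambda>x. \<Sum>i\<in>I. c i * f i x) = (\<Sum>i\<in>I. c i * L2_inner M g (f i))"
  using L2_inner_sum_left[OF assms] by (simp add: L2_inner_commute[of M g])

lemma L2_inner_diff_left:
  assumes "sq_integrable M f" "sq_integrable M h" "sq_integrable M g"
  shows "L2_inner M (\<lambda>x. f x - h x) g = L2_inner M f g - L2_inner M h g"
  unfolding L2_inner_def left_diff_distrib
  by (intro Bochner_Integration.integral_diff integrable_mult_sq assms)

lemma L2_inner_diff_right:
  assumes "sq_integrable M f" "sq_integrable M h" "sq_integrable M g"
  shows "L2_inner M g (\<lambda>x. f x - h x) = L2_inner M g f - L2_inner M g h"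
  using L2_inner_diff_left[OF assms] by (simp add: L2_inner_commute[of M g])

lemma L2_inner_add_left:
  assumes "sq_integrable M f" "sq_integrable M h" "sq_integrable M g"
  shows "L2_inner M (\<lambda>x. f x + h x) g = L2_inner M f g + L2_inner M h g"
  unfolding L2_inner_def distrib_right
  by (intro Bochner_Integration.integral_add integrable_mult_sq assms)

lemma L2_inner_cmult_left: "L2_inner M (\<lambda>x. c * f x) g = c * L2_inner M f g"
  by (simp add: L2_inner_def mult.assoc)

lemma L2_inner_cmult_right: "L2_inner M g (\<lambda>x. c * f x) = c * L2_inner M g f"
  by (simp add: L2_inner_def mult.left_commute)

text \<open>The squared norm of \<open>s * f - t * g\<close> is a nonnegative quadratic form in
  \<open>s\<close> and \<open>t\<close>; both cases evaluate it at a suitable point.\<close>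

lemma L2_Cauchy_Schwarz:
  assumes "sq_integrable M f" "sq_integrable M g"
  shows "\<bar>L2_inner M f g\<bar> \<le> L2_norm M f * L2_norm M g"
proof -
  have quad: "0 \<le> s\<^sup>2 * (L2_norm M f)\<^sup>2 - 2 * s * t * L2_inner M f g + t\<^sup>2 * (L2_norm M g)\<^sup>2" for s t
  proof -
    have "0 \<le> L2_inner M (\<lambda>x. s * f x - t * g x) (\<lambda>x. s * f x - t * g x)"
      by (simp add: L2_inner_self)
    also have "\<dots> = s * (s * L2_inner M f f - t * L2_inner M f g)
        - t * (s * L2_inner M g f - t * L2_inner M g g)"
      using assms by (simp add: L2_inner_diff_left L2_inner_diff_right L2_inner_cmult_left
          L2_inner_cmult_right sq_integrable_intros algebra_simps)
    also have "\<dots> = s\<^sup>2 * (L2_norm M f)\<^sup>2 - 2 * s * t * L2_inner M f g + t\<^sup>2 * (L2_norm M g)\<^sup>2"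
      by (simp add: L2_inner_self L2_inner_commute[of M g f] power2_eq_square algebra_simps)
    finally show ?thesis .
  qed
  define a b c where "a = L2_norm M f" "b = L2_norm M g" "c = L2_inner M f g"
  have ab: "0 \<le> a" "0 \<le> b" by (simp_all add: a_b_c_def L2_norm_nonneg)
  have q: "0 \<le> s\<^sup>2 * a\<^sup>2 - 2 * s * t * c + t\<^sup>2 * b\<^sup>2" for s t using quad[of s t] by (simp add: a_b_c_def)
  have "\<bar>c\<bar> \<le> a * b"
  proof (cases "b = 0")
    case False
    have "0 \<le> b\<^sup>2 * (a\<^sup>2 * b\<^sup>2 - c\<^sup>2)"
      using q[of "b\<^sup>2" c] by (simp add: power2_eq_square algebra_simps)
    then have "c\<^sup>2 \<le> (a * b)\<^sup>2" using False by (simp add: zero_le_mult_iff power_mult_distrib)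
    then show ?thesis using ab abs_le_square_iff[of c "a * b"] by simp
  next
    case True
    have "c = 0"
    proof (rule ccontr)
      assume "c \<noteq> 0"
      \<comment> \<open>With \<open>b = 0\<close> the form is linear in \<open>t\<close> for
        \<open>s = 1\<close>, and this \<open>t\<close> gives it the value -1.\<close>
      then show False using q[of 1 "(a\<^sup>2 + 1) / (2 * c)"] True by simp
    qed
    then show ?thesis using ab by simp
  qed
  then show ?thesis by (simp add: a_b_c_def)
qed

lemma L2_norm_mono:
  assumes "sq_integrable M g" "f \<in> borel_measurable M" "AE x in M. norm (f x) \<le> norm (g x)"
  shows "L2_norm M f \<le> L2_norm M g"
proof -
  have "(LINT x|M. (norm (f x))\<^sup>2) \<le> (LINT x|M. (norm (g x))\<^sup>2)"
    using assms(3) sq_integrableD(2)[OF assms(1)] by (intro integral_mono_AE') (auto elim!: eventually_mono)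
  then show ?thesis by (simp add: L2_norm_def)
qed

text \<open>\<open>L2_inner\<close> is defined for real functions while \<open>f\<close> and
  \<open>g\<close> may be vector-valued, so the functions are first replaced by their pointwise
  norms.\<close>

lemma L2_norm_triangle:
  assumes "sq_integrable M f" "sq_integrable M g"
  shows "L2_norm M (\<lambda>x. f x + g x) \<le> L2_norm M f + L2_norm M g"
proof (rule power2_le_imp_le)
  let ?f = "\<lambda>x. norm (f x)" and ?g = "\<lambda>x. norm (g x)"
  note n = sq_integrable_norm[OF assms(1)] sq_integrable_norm[OF assms(2)]
  have "L2_norm M (\<lambda>x. f x + g x) \<le> L2_norm M (\<lambda>x. ?f x + ?g x)"
    using sq_integrableD(1)[OF sq_integrable_add[OF assms]]
    by (intro L2_norm_mono sq_integrable_add n) (auto intro: norm_triangle_ineq)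
  then have "(L2_norm M (\<lambda>x. f x + g x))\<^sup>2 \<le> (L2_norm M (\<lambda>x. ?f x + ?g x))\<^sup>2"
    by (intro power_mono L2_norm_nonneg)
  also have "\<dots> = (L2_norm M ?f)\<^sup>2 + 2 * L2_inner M ?f ?g + (L2_norm M ?g)\<^sup>2"
  proof -
    let ?s = "\<lambda>x. ?f x + ?g x"
    have add: "L2_inner M ?s h = L2_inner M ?f h + L2_inner M ?g h" if "sq_integrable M h" for h
      using n that by (intro L2_inner_add_left)
    have "L2_inner M ?s ?s = L2_inner M ?s ?f + L2_inner M ?s ?g"
      using add[OF sq_integrable_add[OF n]] by (simp only: L2_inner_commute[of M ?f ?s] L2_inner_commute[of M ?g ?s])
    then show ?thesis
      by (simp only: add[OF n(1)] add[OF n(2)] L2_inner_self L2_inner_commute[of M ?g ?f])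
  qed
  also have "\<dots> \<le> (L2_norm M f + L2_norm M g)\<^sup>2"
    using L2_Cauchy_Schwarz[OF n] by (simp add: L2_norm_eq power2_eq_square algebra_simps)
  finally show "(L2_norm M (\<lambda>x. f x + g x))\<^sup>2 \<le> (L2_norm M f + L2_norm M g)\<^sup>2" .
qed (simp add: L2_norm_nonneg)

lemma L2_norm_triangle_diff:
  fixes f :: "'a \<Rightarrow> 'b::{banach, second_countable_topology, real_normed_field}"
  assumes "sq_integrable M f" "sq_integrable M g"
  shows "L2_norm M (\<lambda>x. f x - g x) \<le> L2_norm M f + L2_norm M g"
  using L2_norm_triangle[OF assms(1) sq_integrable_cmult[OF assms(2), of "-1"]] L2_norm_cmult[of M "-1" g]
  by simp

lemma L2_norm_sum:
  fixes f :: "'i \<Rightarrow> 'a \<Rightarrow> 'b::{banach, second_countable_topology, real_normed_field}"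
  assumes "\<And>i. i \<in> I \<Longrightarrow> sq_integrable M (f i)"
  shows "L2_norm M (\<lambda>x. \<Sum>i\<in>I. c i * f i x) \<le> (\<Sum>i\<in>I. norm (c i) * L2_norm M (f i))"
  using assms
proof (induction I rule: infinite_finite_induct)
  case (insert i I)
  have "L2_norm M (\<lambda>x. c i * f i x + (\<Sum>i\<in>I. c i * f i x))
    \<le> L2_norm M (\<lambda>x. c i * f i x) + L2_norm M (\<lambda>x. \<Sum>i\<in>I. c i * f i x)"
    using insert.prems by (intro L2_norm_triangle sq_integrable_intros) auto
  then show ?case using insert by (simp add: L2_norm_cmult)
qed (auto simp: L2_norm_def)

lemma (in prob_space) L2_norm_le_bound:
  assumes "AE x in M. norm (f x) \<le> R" "0 \<le> R"
  shows "L2_norm M f \<le> R"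
proof -
  have "(LINT x|M. (norm (f x))\<^sup>2) \<le> (LINT x|M. R\<^sup>2)"
    using assms(1) by (intro integral_mono_AE') (auto elim!: eventually_mono intro!: power_mono)
  also have "\<dots> = R\<^sup>2" by (simp add: prob_space)
  finally show ?thesis using assms(2) by (simp add: L2_norm_def real_le_lsqrt)
qed

lemma (in prob_space) L1_norm_le_L2_norm:
  assumes "sq_integrable M f"
  shows "L1_norm M f \<le> L2_norm M f"
proof -
  have 1: "sq_integrable M (\<lambda>x. 1 :: real)" by (auto simp: sq_integrable_def)
  have "L1_norm M f = L2_inner M (\<lambda>x. norm (f x)) (\<lambda>x. 1)"
    by (simp add: L1_norm_def L2_inner_def)
  also have "\<dots> \<le> L2_norm M f"
    using L2_Cauchy_Schwarz[OF sq_integrable_norm[OF assms] 1]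
    by (simp add: L2_norm_eq L2_norm_def[of M "\<lambda>x. 1"] prob_space)
  finally show ?thesis .
qed

section \<open>Finite parts of orthonormal systems\<close>

lemma orthonormal_L2_D:
  assumes "orthonormal_L2 M \<phi>"
  shows "sq_integrable M (\<phi> i)" "L2_inner M (\<phi> i) (\<phi> j) = of_bool (i = j)"
  using assms by (auto simp: orthonormal_L2_def)

lemma orthonormal_L2_norm: "orthonormal_L2 M \<phi> \<Longrightarrow> L2_norm M (\<phi> i) = 1"
  using L2_inner_self[of M "\<phi> i"] orthonormal_L2_D(2)[of M \<phi> i i] L2_norm_nonneg[of M "\<phi> i"]
  by (simp add: power2_eq_1_iff)

lemma orthonormal_inner_sum:
  assumes "orthonormal_L2 M \<phi>"
  shows "L2_inner M (\<phi> i) (\<lambda>x. \<Sum>k<n. c k * \<phi> k x) = (if i < n then c i else 0)"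
proof -
  have "L2_inner M (\<phi> i) (\<lambda>x. \<Sum>k<n. c k * \<phi> k x) = (\<Sum>k<n. c k * L2_inner M (\<phi> i) (\<phi> k))"
    by (rule L2_inner_sum_right) (auto intro!: orthonormal_L2_D[OF assms])
  also have "\<dots> = (\<Sum>k<n. if i = k then c k else 0)"
    by (rule sum.cong) (auto simp: orthonormal_L2_D(2)[OF assms])
  finally show ?thesis by simp
qed

lemma orthonormal_norm_sum:
  assumes "orthonormal_L2 M \<phi>"
  shows "L2_norm M (\<lambda>x. \<Sum>k<n. c k * \<phi> k x) = L2_set c {..<n}"
proof -
  let ?u = "\<lambda>x. \<Sum>k<n. c k * \<phi> k x"
  have "L2_inner M ?u ?u = (\<Sum>k<n. c k * L2_inner M (\<phi> k) ?u)"
    by (rule L2_inner_sum_left) (auto intro!: sq_integrable_intros orthonormal_L2_D[OF assms])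
  also have "\<dots> = (\<Sum>k<n. (c k)\<^sup>2)"
    by (rule sum.cong) (auto simp: orthonormal_inner_sum[OF assms] power2_eq_square)
  finally have "(L2_norm M ?u)\<^sup>2 = (\<Sum>k<n. (c k)\<^sup>2)" by (simp add: L2_inner_self)
  then have "sqrt (\<Sum>k<n. (c k)\<^sup>2) = L2_norm M ?u" by (rule real_sqrt_unique) (rule L2_norm_nonneg)
  then show ?thesis by (simp add: L2_set_def)
qed

text \<open>Pairing \<open>u\<close> with its projection \<open>?p\<close> gives the square of the
  coefficient norm \<open>?l\<close>, and \<open>?p\<close> has norm \<open>?l\<close>;
  Cauchy-Schwarz then cancels one factor \<open>?l\<close>.\<close>

lemma Bessel_L2:
  assumes "orthonormal_L2 M \<phi>" "sq_integrable M u"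
  shows "L2_set (\<lambda>k. L2_inner M (\<phi> k) u) {..<n} \<le> L2_norm M u"
proof -
  let ?c = "\<lambda>k. L2_inner M (\<phi> k) u"
  let ?p = "\<lambda>x. \<Sum>k<n. ?c k * \<phi> k x"
  let ?l = "L2_set ?c {..<n}"
  have p: "sq_integrable M ?p" by (auto intro!: sq_integrable_intros orthonormal_L2_D[OF assms(1)])
  have "?l * ?l = (\<Sum>k<n. ?c k * ?c k)"
    by (simp add: L2_set_def sum_nonneg power2_eq_square)
  also have "\<dots> = L2_inner M ?p u"
    by (subst L2_inner_sum_left) (auto intro!: orthonormal_L2_D[OF assms(1)] assms(2))
  also have "\<dots> \<le> L2_norm M ?p * L2_norm M u"
    using L2_Cauchy_Schwarz[OF p assms(2)] by linarith
  also have "L2_norm M ?p = ?l" by (rule orthonormal_norm_sum[OF assms(1)])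
  finally show ?thesis
    using L2_set_nonneg[of ?c "{..<n}"] L2_norm_nonneg[of M u] by (metis mult_le_cancel_left_pos order_le_less)
qed

section \<open>Tensor products and partial integrals on a product of probability spaces\<close>

context pair_prob_space
begin

lemma sq_integrable_tensor:
  fixes u :: "_ \<Rightarrow> real" and v :: "_ \<Rightarrow> real"
  assumes "sq_integrable M1 u" "sq_integrable M2 v"
  shows "sq_integrable (M1 \<Otimes>\<^sub>M M2) (\<lambda>(x, y). u x * v y)"
  unfolding sq_integrable_def
proof
  note [measurable] = sq_integrableD(1)[OF assms(1)] sq_integrableD(1)[OF assms(2)]
  show "(\<lambda>(x, y). u x * v y) \<in> borel_measurable (M1 \<Otimes>\<^sub>M M2)" by measurable
  have "integrable (M1 \<Otimes>\<^sub>M M2) (\<lambda>z. (u (fst z))\<^sup>2 * (v (snd z))\<^sup>2)"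
    using sq_integrableD(2)[OF assms(1)] sq_integrableD(2)[OF assms(2)]
    by (intro Fubini_integrable) auto
  then show "integrable (M1 \<Otimes>\<^sub>M M2) (\<lambda>z. (norm (case z of (x, y) \<Rightarrow> u x * v y))\<^sup>2)"
    by (simp add: case_prod_beta power_mult_distrib abs_mult)
qed

lemma L2_inner_tensor:
  assumes "sq_integrable M1 u" "sq_integrable M2 v" "sq_integrable M1 u'" "sq_integrable M2 v'"
  shows "L2_inner (M1 \<Otimes>\<^sub>M M2) (\<lambda>(x, y). u x * v y) (\<lambda>(x, y). u' x * v' y)
    = L2_inner M1 u u' * L2_inner M2 v v'"
proof -
  have "integrable (M1 \<Otimes>\<^sub>M M2) (\<lambda>z. (case z of (x, y) \<Rightarrow> u x * v y) * (case z of (x, y) \<Rightarrow> u' x * v' y))"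
    by (intro integrable_mult_sq sq_integrable_tensor assms)
  then have "integrable (M1 \<Otimes>\<^sub>M M2) (\<lambda>(x, y). (u x * u' x) * (v y * v' y))"
    by (simp add: case_prod_unfold mult_ac)
  note integral_fst[OF this]
  moreover have "L2_inner (M1 \<Otimes>\<^sub>M M2) (\<lambda>(x, y). u x * v y) (\<lambda>(x, y). u' x * v' y)
    = (LINT z|(M1 \<Otimes>\<^sub>M M2). (case z of (x, y) \<Rightarrow> (u x * u' x) * (v y * v' y)))"
    by (simp add: L2_inner_def case_prod_unfold mult_ac)
  ultimately show ?thesis by (simp add: L2_inner_def)
qed

lemma L2_norm_tensor:
  assumes "sq_integrable M1 u" "sq_integrable M2 v"
  shows "L2_norm (M1 \<Otimes>\<^sub>M M2) (\<lambda>(x, y). u x * v y :: real) = L2_norm M1 u * L2_norm M2 v"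
  using L2_inner_tensor[OF assms assms]
  unfolding L2_inner_self power_mult_distrib[symmetric]
  by (rule power2_eq_imp_eq) (auto intro: L2_norm_nonneg mult_nonneg_nonneg)

text \<open>Averaging over a probability space contracts the norm: on each fibre the norm of the
  integral is at most the L2 norm of the fibre, and Fubini adds up the squares.\<close>

lemma partial_integral_L2:
  fixes f :: "_ \<Rightarrow> 'c::{banach, second_countable_topology}"
  assumes f: "sq_integrable (M1 \<Otimes>\<^sub>M M2) f"
  shows "sq_integrable M1 (\<lambda>x. LINT y|M2. f (x, y))"
    and "L2_norm M1 (\<lambda>x. LINT y|M2. f (x, y)) \<le> L2_norm (M1 \<Otimes>\<^sub>M M2) f"
proof -
  note [measurable] = sq_integrableD(1)[OF f]
  have i1: "integrable (M1 \<Otimes>\<^sub>M M2) (\<lambda>z. (norm (f z))\<^sup>2)" by (rule sq_integrableD(2)[OF f])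
  have meas: "(\<lambda>x. LINT y|M2. f (x, y)) \<in> borel_measurable M1"
    by (rule M2.borel_measurable_lebesgue_integral) measurable
  have bound: "AE x in M1. (norm (LINT y|M2. f (x, y)))\<^sup>2 \<le> (LINT y|M2. (norm (f (x, y)))\<^sup>2)"
    using AE_integrable_fst'[OF i1] AE_space
  proof eventually_elim
    case (elim x)
    then have "(\<lambda>y. f (x, y)) \<in> borel_measurable M2" by simp
    with elim have "sq_integrable M2 (\<lambda>y. f (x, y))" by (simp add: sq_integrable_def)
    from M2.L1_norm_le_L2_norm[OF this]
    have "norm (LINT y|M2. f (x, y)) \<le> L2_norm M2 (\<lambda>y. f (x, y))"
      unfolding L1_norm_def by (rule order_trans[OF integral_norm_bound])
    then have "(norm (LINT y|M2. f (x, y)))\<^sup>2 \<le> (L2_norm M2 (\<lambda>y. f (x, y)))\<^sup>2"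
      by (intro power_mono) auto
    then show ?case by (simp add: L2_norm_sq)
  qed
  have i2: "integrable M1 (\<lambda>x. LINT y|M2. (norm (f (x, y)))\<^sup>2)" by (rule integrable_fst'[OF i1])
  have "integrable M1 (\<lambda>x. (norm (LINT y|M2. f (x, y)))\<^sup>2)"
    by (rule Bochner_Integration.integrable_bound[OF i2]) (use meas bound in \<open>auto elim!: eventually_mono intro: order_trans\<close>)
  then show "sq_integrable M1 (\<lambda>x. LINT y|M2. f (x, y))" using meas by (simp add: sq_integrable_def)
  have "(LINT x|M1. (norm (LINT y|M2. f (x, y)))\<^sup>2) \<le> (LINT x|M1. LINT y|M2. (norm (f (x, y)))\<^sup>2)"
    by (rule integral_mono_AE) fact+
  also have "\<dots> = (LINT z|(M1 \<Otimes>\<^sub>M M2). (norm (f z))\<^sup>2)" by (rule integral_fst'[OF i1])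
  finally show "L2_norm M1 (\<lambda>x. LINT y|M2. f (x, y)) \<le> L2_norm (M1 \<Otimes>\<^sub>M M2) f"
    by (simp add: L2_norm_def)
qed

end

section \<open>Singular value decomposition of a perturbed mixture\<close>

context pair_prob_space
begin

text \<open>The exact mixture kernel, its restriction to \<open>A\<close> and the partial sums of a
  singular value decomposition all have this shape.\<close>

definition rank_kernel :: "nat \<Rightarrow> (nat \<Rightarrow> real) \<Rightarrow> (nat \<Rightarrow> 'a \<Rightarrow> real) \<Rightarrow> (nat \<Rightarrow> 'b \<Rightarrow> real) \<Rightarrow> 'a \<times> 'b \<Rightarrow> real"
  where "rank_kernel n c g h = (\<lambda>(y, z). \<Sum>k<n. c k * g k y * h k z)"

lemma rank_kernel_eq: "rank_kernel n c g h = (\<lambda>p. \<Sum>k<n. c k * (case p of (y, z) \<Rightarrow> g k y * h k z))"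
  by (auto simp: rank_kernel_def mult.assoc)

lemma sq_integrable_rank_kernel:
  assumes "\<And>k. k < n \<Longrightarrow> sq_integrable M1 (g k)" "\<And>k. k < n \<Longrightarrow> sq_integrable M2 (h k)"
  shows "sq_integrable (M1 \<Otimes>\<^sub>M M2) (rank_kernel n c g h)"
  unfolding rank_kernel_eq by (intro sq_integrable_intros sq_integrable_tensor assms) auto

lemma rank_kernel_inner:
  assumes "\<And>k. k < n \<Longrightarrow> sq_integrable M1 (g k)" "\<And>k. k < n \<Longrightarrow> sq_integrable M2 (h k)"
    and "sq_integrable M1 u" "sq_integrable M2 v"
  shows "L2_inner (M1 \<Otimes>\<^sub>M M2) (rank_kernel n c g h) (\<lambda>(y, z). u y * v z)
    = (\<Sum>k<n. c k * (L2_inner M1 (g k) u * L2_inner M2 (h k) v))"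
proof -
  have "L2_inner (M1 \<Otimes>\<^sub>M M2) (rank_kernel n c g h) (\<lambda>(y, z). u y * v z)
    = (\<Sum>k<n. c k * L2_inner (M1 \<Otimes>\<^sub>M M2) (\<lambda>(y, z). g k y * h k z) (\<lambda>(y, z). u y * v z))"
    unfolding rank_kernel_eq using assms by (intro L2_inner_sum_left sq_integrable_tensor) auto
  also have "\<dots> = (\<Sum>k<n. c k * (L2_inner M1 (g k) u * L2_inner M2 (h k) v))"
    using assms by (intro sum.cong refl arg_cong[where f = "(*) _"] L2_inner_tensor) auto
  finally show ?thesis .
qed

text \<open>Cauchy-Schwarz against the tensor of \<open>u\<close> and \<open>v\<close>: a
  Hilbert-Schmidt error controls the bilinear form of the kernel.\<close>

lemma kernel_form_close:
  assumes "sq_integrable (M1 \<Otimes>\<^sub>M M2) K"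
    and gh: "\<And>k. k < n \<Longrightarrow> sq_integrable M1 (g k)" "\<And>k. k < n \<Longrightarrow> sq_integrable M2 (h k)"
    and uv: "sq_integrable M1 u" "sq_integrable M2 v"
    and "L2_norm (M1 \<Otimes>\<^sub>M M2) (\<lambda>p. K p - rank_kernel n c g h p) \<le> \<epsilon>"
  shows "\<bar>L2_inner (M1 \<Otimes>\<^sub>M M2) K (\<lambda>(y, z). u y * v z)
      - (\<Sum>k<n. c k * (L2_inner M1 (g k) u * L2_inner M2 (h k) v))\<bar> \<le> \<epsilon> * (L2_norm M1 u * L2_norm M2 v)"
proof -
  let ?S = "rank_kernel n c g h"
  have S: "sq_integrable (M1 \<Otimes>\<^sub>M M2) ?S" by (rule sq_integrable_rank_kernel[OF gh])
  have T: "sq_integrable (M1 \<Otimes>\<^sub>M M2) (\<lambda>(y, z). u y * v z)" by (rule sq_integrable_tensor[OF uv])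
  have "\<bar>L2_inner (M1 \<Otimes>\<^sub>M M2) (\<lambda>p. K p - ?S p) (\<lambda>(y, z). u y * v z)\<bar>
    \<le> L2_norm (M1 \<Otimes>\<^sub>M M2) (\<lambda>p. K p - ?S p) * L2_norm (M1 \<Otimes>\<^sub>M M2) (\<lambda>(y, z). u y * v z)"
    by (intro L2_Cauchy_Schwarz sq_integrable_diff assms S T)
  also have "\<dots> \<le> \<epsilon> * (L2_norm M1 u * L2_norm M2 v)"
    using assms(6) by (simp add: L2_norm_tensor[OF uv] mult_right_mono L2_norm_nonneg)
  finally show ?thesis
    by (simp add: L2_inner_diff_left[OF assms(1) S T] rank_kernel_inner[OF gh uv])
qed

text \<open>Converts the Hilbert-Schmidt convergence in \<open>is_SVD\<close> into convergence of
  bilinear forms, evaluated at arbitrary square integrable \<open>u\<close> and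
  \<open>v\<close>.\<close>

lemma SVD_form:
  assumes svd: "is_SVD M1 M2 K s \<phi> \<psi>" and K: "sq_integrable (M1 \<Otimes>\<^sub>M M2) (\<lambda>(y, z). K y z)"
    and uv: "sq_integrable M1 u" "sq_integrable M2 v"
  shows "(\<lambda>n. \<Sum>k<n. s k * (L2_inner M1 (\<phi> k) u * L2_inner M2 (\<psi> k) v))
    \<longlonglongrightarrow> L2_inner (M1 \<Otimes>\<^sub>M M2) (\<lambda>(y, z). K y z) (\<lambda>(y, z). u y * v z)"
proof -
  have ortho: "orthonormal_L2 M1 \<phi>" "orthonormal_L2 M2 \<psi>" using svd by (auto simp: is_SVD_def)
  define e where "e n = L2_norm (M1 \<Otimes>\<^sub>M M2) (\<lambda>p. (case p of (y, z) \<Rightarrow> K y z) - rank_kernel n s \<phi> \<psi> p)" for n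
  have "e \<longlonglongrightarrow> 0"
    using svd unfolding is_SVD_def e_def by (simp add: rank_kernel_def case_prod_unfold)
  then have lim: "(\<lambda>n. e n * (L2_norm M1 u * L2_norm M2 v)) \<longlonglongrightarrow> 0" by (rule tendsto_mult_left_zero)
  show ?thesis
  proof (rule LIM_zero_cancel, rule Lim_null_comparison[OF _ lim], intro always_eventually allI)
    fix n
    show "norm ((\<Sum>k<n. s k * (L2_inner M1 (\<phi> k) u * L2_inner M2 (\<psi> k) v))
        - L2_inner (M1 \<Otimes>\<^sub>M M2) (\<lambda>(y, z). K y z) (\<lambda>(y, z). u y * v z))
      \<le> e n * (L2_norm M1 u * L2_norm M2 v)"
      using kernel_form_close[OF K orthonormal_L2_D(1)[OF ortho(1)] orthonormal_L2_D(1)[OF ortho(2)] uv, where c = s and n = n and \<epsilon> = "e n"]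
      by (simp add: e_def abs_minus_commute)
  qed
qed

end

text \<open>Here \<open>\<gamma>\<close> bounds both Gram matrices from below, \<open>R\<close>
  bounds the norms of the components, and \<open>1 / q\<close> is the guaranteed margin. The product
  \<open>\<zeta> * \<gamma>\<close> bounds the \<open>m\<close>-th singular value of the exact
  kernel from below; one \<open>\<epsilon>\<close> is lost in Weyl's inequality and a second one in
  comparing the singular values with the matrix \<open>Z\<close>.\<close>

locale perturbed_mixture = pair_prob_space M N
  for M :: "'a measure" and N :: "'b measure" +
  fixes m :: nat and G :: "nat \<Rightarrow> 'a \<Rightarrow> real" and H :: "nat \<Rightarrow> 'b \<Rightarrow> real"
    and K :: "'a \<Rightarrow> 'b \<Rightarrow> real" and s :: "nat \<Rightarrow> real"
    and \<phi> :: "nat \<Rightarrow> 'a \<Rightarrow> real" and \<psi> :: "nat \<Rightarrow> 'b \<Rightarrow> real"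
    and \<pi> :: "nat \<Rightarrow> real" and \<zeta> \<gamma> \<epsilon> R q :: real
  assumes m: "0 < m"
    and sqG: "k < m \<Longrightarrow> sq_integrable M (G k)" and sqH: "k < m \<Longrightarrow> sq_integrable N (H k)"
    and G_le: "k < m \<Longrightarrow> L2_norm M (G k) \<le> R" and H_le: "k < m \<Longrightarrow> L2_norm N (H k) \<le> R"
    and gramG: "\<gamma> * (\<Sum>k<m. (c k)\<^sup>2) \<le> (L2_norm M (\<lambda>y. \<Sum>k<m. c k * G k y))\<^sup>2"
    and gramH: "\<gamma> * (\<Sum>k<m. (c k)\<^sup>2) \<le> (L2_norm N (\<lambda>y. \<Sum>k<m. c k * H k y))\<^sup>2"
    and \<gamma>: "0 < \<gamma>" and \<zeta>: "0 < \<zeta>"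
    and weights: "k < m \<Longrightarrow> \<zeta> \<le> \<pi> k" "k < m \<Longrightarrow> \<pi> k \<le> 1"
    and sqK: "sq_integrable (M \<Otimes>\<^sub>M N) (\<lambda>(y, z). K y z)"
    and K_close: "L2_norm (M \<Otimes>\<^sub>M N) (\<lambda>p. (case p of (y, z) \<Rightarrow> K y z) - rank_kernel m \<pi> G H p) \<le> \<epsilon>"
    and svd: "is_SVD M N K s \<phi> \<psi>"
    and q: "0 < q" "1 / q \<le> \<zeta> * \<gamma> - 2 * \<epsilon>"
begin

lemma ortho: "orthonormal_L2 M \<phi>" "orthonormal_L2 N \<psi>" and s_nonneg: "0 \<le> s k" and s_dec: "decseq s"
  using svd by (auto simp: is_SVD_def)

lemmas sq_basis = orthonormal_L2_D(1)[OF ortho(1)] orthonormal_L2_D(1)[OF ortho(2)]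

lemma \<epsilon>: "0 \<le> \<epsilon>" by (rule order_trans[OF L2_norm_nonneg K_close])

definition form :: "('a \<Rightarrow> real) \<Rightarrow> ('b \<Rightarrow> real) \<Rightarrow> real" where
  "form u v = L2_inner (M \<Otimes>\<^sub>M N) (\<lambda>(y, z). K y z) (\<lambda>(y, z). u y * v z)"

lemma form_SVD:
  assumes "sq_integrable M u" "sq_integrable N v"
  shows "(\<lambda>n. \<Sum>k<n. s k * (L2_inner M (\<phi> k) u * L2_inner N (\<psi> k) v)) \<longlonglongrightarrow> form u v"
  unfolding form_def
  by (rule SVD_form[where K = K and s = s and \<phi> = \<phi> and \<psi> = \<psi>, OF svd sqK assms])

lemma form_close:
  assumes "sq_integrable M u" "sq_integrable N v"
  shows "\<bar>form u v - (\<Sum>k<m. \<pi> k * (L2_inner M (G k) u * L2_inner N (H k) v))\<bar>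
    \<le> \<epsilon> * (L2_norm M u * L2_norm N v)"
  unfolding form_def
  by (rule kernel_form_close[where g = G and h = H and c = \<pi> and n = m, OF sqK _ _ assms K_close])
     (auto intro: sqG sqH)

text \<open>Weyl's inequality: a combination of the \<open>H k\<close> orthogonal to the first \<open>m - 1\<close> right singular
  vectors is not stretched by more than the \<open>m\<close>-th singular value.\<close>

lemma singular_value_lower:
  assumes "t < m"
  shows "1 / q + \<epsilon> \<le> s t"
proof -
  obtain c where c0: "\<exists>j<m. c j \<noteq> 0"
    and c: "\<And>i. i < m - 1 \<Longrightarrow> (\<Sum>j<m. L2_inner N (\<psi> i) (H j) * c j) = 0"
    using underdetermined_system[of "m - 1" m "\<lambda>i j. L2_inner N (\<psi> i) (H j)"] m by auto
  define v where "v z = (\<Sum>k<m. c k * H k z)" for z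
  define h where "h k = L2_inner N (H k) v" for k
  \<comment> \<open>\<open>u\<close> is the image of \<open>v\<close> under the exact operator, so
    the exact form at \<open>u\<close> and \<open>v\<close> equals the squared norm of
    \<open>u\<close>.\<close>
  define u where "u y = (\<Sum>k<m. (\<pi> k * h k) * G k y)" for y
  have sqv: "sq_integrable N v" unfolding v_def by (intro sq_integrable_intros sqH) auto
  have squ: "sq_integrable M u" unfolding u_def by (intro sq_integrable_intros sqG) auto
  let ?s = "s (m - 1)" and ?u = "L2_norm M u" and ?v = "L2_norm N v"
  have orth: "L2_inner N (\<psi> i) v = 0" if "i < m - 1" for i
    unfolding v_def using c[OF that] by (subst L2_inner_sum_right) (auto simp: sqH sq_basis mult.commute)
  \<comment> \<open>The first \<open>m - 1\<close> terms of the expansion vanish by orthogonality,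
    the remaining singular values are at most \<open>?s\<close>, and Bessel bounds the two
    coefficient sequences.\<close>
  have "form u v \<le> ?s * (?u * ?v)"
  proof (rule LIMSEQ_le_const2[OF form_SVD[OF squ sqv]], intro exI allI impI)
    fix n
    have "(\<Sum>k<n. s k * (L2_inner M (\<phi> k) u * L2_inner N (\<psi> k) v))
      \<le> (\<Sum>k<n. ?s * (\<bar>L2_inner M (\<phi> k) u\<bar> * \<bar>L2_inner N (\<psi> k) v\<bar>))"
    proof (rule sum_mono)
      fix k
      show "s k * (L2_inner M (\<phi> k) u * L2_inner N (\<psi> k) v)
        \<le> ?s * (\<bar>L2_inner M (\<phi> k) u\<bar> * \<bar>L2_inner N (\<psi> k) v\<bar>)"
      proof (cases "k < m - 1")
        case False
        then have "s k \<le> ?s" using s_dec by (simp add: decseq_def)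
        then have "s k * (\<bar>L2_inner M (\<phi> k) u\<bar> * \<bar>L2_inner N (\<psi> k) v\<bar>)
          \<le> ?s * (\<bar>L2_inner M (\<phi> k) u\<bar> * \<bar>L2_inner N (\<psi> k) v\<bar>)"
          by (rule mult_right_mono) simp
        moreover have "s k * (L2_inner M (\<phi> k) u * L2_inner N (\<psi> k) v)
          \<le> s k * (\<bar>L2_inner M (\<phi> k) u\<bar> * \<bar>L2_inner N (\<psi> k) v\<bar>)"
          unfolding abs_mult[symmetric] by (rule mult_left_mono[OF abs_ge_self s_nonneg])
        ultimately show ?thesis by linarith
      qed (simp add: orth)
    qed
    also have "\<dots> \<le> ?s * (L2_set (\<lambda>k. L2_inner M (\<phi> k) u) {..<n} * L2_set (\<lambda>k. L2_inner N (\<psi> k) v) {..<n})"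
      unfolding sum_distrib_left[symmetric] by (intro mult_left_mono L2_set_mult_ineq s_nonneg)
    also have "\<dots> \<le> ?s * (?u * ?v)"
      by (intro mult_left_mono mult_mono Bessel_L2 ortho squ sqv s_nonneg L2_norm_nonneg L2_set_nonneg)
    finally show "(\<Sum>k<n. s k * (L2_inner M (\<phi> k) u * L2_inner N (\<psi> k) v)) \<le> ?s * (?u * ?v)" .
  qed
  moreover have "(\<Sum>k<m. \<pi> k * (L2_inner M (G k) u * L2_inner N (H k) v)) = ?u\<^sup>2"
  proof -
    have "?u\<^sup>2 = L2_inner M u u" by (simp add: L2_inner_self)
    also have "\<dots> = (\<Sum>k<m. (\<pi> k * h k) * L2_inner M (G k) u)"
    proof -
      have "L2_inner M (\<lambda>y. \<Sum>k<m. (\<pi> k * h k) * G k y) u = (\<Sum>k<m. (\<pi> k * h k) * L2_inner M (G k) u)"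
        by (rule L2_inner_sum_left) (auto intro: sqG squ)
      then show ?thesis by (simp only: u_def[abs_def, symmetric])
    qed
    finally show ?thesis by (simp add: h_def mult_ac)
  qed
  ultimately have "?u * ?u \<le> ((?s + \<epsilon>) * ?v) * ?u"
    using form_close[OF squ sqv] by (simp add: power2_eq_square algebra_simps)
  then have upper: "?u \<le> (?s + \<epsilon>) * ?v"
    using L2_norm_nonneg[of M u] L2_norm_nonneg[of N v] s_nonneg[of "m - 1"] \<epsilon>
    by (cases "?u = 0") (auto simp: mult_le_cancel_right)
  have "0 < (\<Sum>k<m. (c k)\<^sup>2)"
    using c0 by (auto simp: sum_nonneg intro!: sum_pos2)
  then have vpos: "0 < ?v\<^sup>2" using gramH[of c] \<gamma> unfolding v_def[abs_def] by (meson less_le_trans mult_pos_pos)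
  \<comment> \<open>It remains to show that the exact operator stretches \<open>v\<close> by at
    least \<open>\<zeta> * \<gamma>\<close>. The Gram bound for \<open>H\<close> gives that the
    squared length of \<open>h\<close> is at least \<open>\<gamma>\<close> times the squared norm of
    \<open>v\<close>; the Gram bound for \<open>G\<close>, with weights at least
    \<open>\<zeta>\<close>, then bounds \<open>u\<close> from below by \<open>h\<close>.\<close>
  have "?v\<^sup>2 = (\<Sum>k<m. c k * h k)"
  proof -
    have "L2_inner N (\<lambda>z. \<Sum>k<m. c k * H k z) v = (\<Sum>k<m. c k * L2_inner N (H k) v)"
      by (rule L2_inner_sum_left) (auto intro: sqH sqv)
    then show ?thesis by (simp only: v_def[abs_def, symmetric] L2_inner_self h_def)
  qed
  also have "\<dots> \<le> (\<Sum>k<m. \<bar>c k\<bar> * \<bar>h k\<bar>)" by (intro sum_mono) (metis abs_ge_self abs_mult)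
  also have "\<dots> \<le> L2_set c {..<m} * L2_set h {..<m}" by (rule L2_set_mult_ineq)
  finally have "(?v\<^sup>2)\<^sup>2 \<le> (L2_set c {..<m} * L2_set h {..<m})\<^sup>2" by (intro power_mono) auto
  also have "\<dots> = (\<Sum>k<m. (c k)\<^sup>2) * (\<Sum>k<m. (h k)\<^sup>2)"
    by (simp add: power_mult_distrib L2_set_def sum_nonneg)
  finally have "\<gamma> * (?v\<^sup>2)\<^sup>2 \<le> (\<gamma> * (\<Sum>k<m. (c k)\<^sup>2)) * (\<Sum>k<m. (h k)\<^sup>2)" using \<gamma> by simp
  also have "\<dots> \<le> ?v\<^sup>2 * (\<Sum>k<m. (h k)\<^sup>2)"
    using gramH[of c] by (intro mult_right_mono) (auto simp: v_def[abs_def] sum_nonneg)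
  finally have "?v\<^sup>2 * (\<gamma> * ?v\<^sup>2) \<le> ?v\<^sup>2 * (\<Sum>k<m. (h k)\<^sup>2)" by (simp only: power2_eq_square mult_ac)
  then have hv: "\<gamma> * ?v\<^sup>2 \<le> (\<Sum>k<m. (h k)\<^sup>2)" unfolding mult_le_cancel_left_pos[OF vpos] .
  have "(\<zeta> * \<gamma> * ?v)\<^sup>2 = \<gamma> * \<zeta>\<^sup>2 * (\<gamma> * ?v\<^sup>2)" by (simp add: power2_eq_square mult_ac)
  also have "\<dots> \<le> \<gamma> * \<zeta>\<^sup>2 * (\<Sum>k<m. (h k)\<^sup>2)" using hv \<gamma> by (intro mult_left_mono) auto
  also have "\<dots> = \<gamma> * (\<Sum>k<m. (\<zeta> * h k)\<^sup>2)" by (simp add: sum_distrib_left power_mult_distrib mult_ac)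
  also have "\<dots> \<le> \<gamma> * (\<Sum>k<m. (\<pi> k * h k)\<^sup>2)"
    using \<gamma> \<zeta> weights(1) unfolding power_mult_distrib
    by (intro mult_left_mono sum_mono mult_right_mono power_mono) auto
  also have "\<dots> \<le> ?u\<^sup>2" unfolding u_def[abs_def] by (rule gramG)
  finally have "\<zeta> * \<gamma> * ?v \<le> ?u" by (rule power2_le_imp_le) (rule L2_norm_nonneg)
  with upper have "(\<zeta> * \<gamma>) * ?v \<le> (?s + \<epsilon>) * ?v" by linarith
  then have "\<zeta> * \<gamma> \<le> ?s + \<epsilon>" using vpos L2_norm_nonneg[of N v] by (auto simp: mult_le_cancel_right)
  moreover have "?s \<le> s t" using s_dec assms by (simp add: decseq_def)
  ultimately show ?thesis using q(2) by linarith
qed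

lemma singular_value_pos: "t < m \<Longrightarrow> 0 < s t"
  using singular_value_lower[of t] divide_pos_pos[of 1 q] q(1) \<epsilon> by linarith

lemma form_basis:
  "form (\<lambda>y. \<Sum>l<m. x l * \<phi> l y) (\<lambda>z. \<Sum>t<m. v t * \<psi> t z) = (\<Sum>t<m. s t * (x t * v t))" (is "form ?x ?v = ?r")
proof (rule LIMSEQ_unique[OF form_SVD])
  show "sq_integrable M ?x" "sq_integrable N ?v" by (intro sq_integrable_intros sq_basis)+
  show "(\<lambda>n. \<Sum>k<n. s k * (L2_inner M (\<phi> k) ?x * L2_inner N (\<psi> k) ?v)) \<longlonglongrightarrow> ?r"
  proof (rule tendsto_eventually, rule eventually_sequentiallyI[of m])
    fix n assume "m \<le> n"
    then have n: "{..<n} = {..<m} \<union> {m..<n}" by auto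
    show "(\<Sum>k<n. s k * (L2_inner M (\<phi> k) ?x * L2_inner N (\<psi> k) ?v)) = ?r"
      unfolding n by (subst sum.union_disjoint) (auto simp: orthonormal_inner_sum ortho)
  qed
qed

text \<open>\<open>B\<close> and \<open>D\<close> hold the coordinates of the components in the
  singular bases. \<open>Z\<close>, which factors as \<open>B\<close> times
  \<open>diag(\<pi>)\<close> times the transpose of \<open>D\<close>, is the exact kernel compressed
  to the first \<open>m\<close> singular vectors.\<close>

definition B :: "nat \<Rightarrow> nat \<Rightarrow> real" where "B l k = L2_inner M (\<phi> l) (G k)"
definition D :: "nat \<Rightarrow> nat \<Rightarrow> real" where "D t k = L2_inner N (\<psi> t) (H k)"
definition Z :: "nat \<Rightarrow> nat \<Rightarrow> real" where "Z l t = (\<Sum>k<m. \<pi> k * (B l k * D t k))"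

text \<open>Compressed to the first \<open>m\<close> singular vectors, the noisy form is
  \<open>diag(s)\<close> and the exact one is \<open>Z\<close>. This is the bound
  \<open>\<epsilon>\<close> on the operator norm of their difference, in bilinear form.\<close>

lemma Z_close:
  "\<bar>(\<Sum>t<m. s t * (x t * v t)) - (\<Sum>l<m. x l * (\<Sum>t<m. Z l t * v t))\<bar> \<le> \<epsilon> * (L2_set x {..<m} * L2_set v {..<m})"
proof -
  let ?x = "\<lambda>y. \<Sum>l<m. x l * \<phi> l y" and ?v = "\<lambda>z. \<Sum>t<m. v t * \<psi> t z"
  have sq: "sq_integrable M ?x" "sq_integrable N ?v" by (intro sq_integrable_intros sq_basis)+
  have "L2_inner M (G k) ?x = (\<Sum>l<m. x l * B l k)" "L2_inner N (H k) ?v = (\<Sum>t<m. v t * D t k)" if "k < m" for k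
    unfolding B_def D_def using that
    by (simp_all add: L2_inner_sum_right sq_basis sqG sqH L2_inner_commute)
  then have "(\<Sum>k<m. \<pi> k * (L2_inner M (G k) ?x * L2_inner N (H k) ?v))
    = (\<Sum>k<m. \<Sum>l<m. \<Sum>t<m. x l * (\<pi> k * (B l k * D t k) * v t))"
    by (simp add: sum_product sum_distrib_left mult_ac)
  also have "\<dots> = (\<Sum>l<m. x l * (\<Sum>t<m. Z l t * v t))"
    unfolding Z_def sum_distrib_left sum_distrib_right
    by (rule trans[OF sum.swap], rule sum.cong[OF refl], rule trans[OF sum.swap]) (simp add: mult_ac)
  finally show ?thesis
    using form_close[OF sq] by (simp add: form_basis orthonormal_norm_sum ortho)
qed

text \<open>Testing \<open>Z_close\<close> with \<open>x = diag(s) v\<close> shows that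
  \<open>diag(s) v\<close> is at most \<open>\<epsilon>\<close> times the length of \<open>v\<close>
  longer than \<open>Z v\<close>. The extra \<open>\<epsilon>\<close> in
  \<open>singular_value_lower\<close> absorbs exactly this loss, so \<open>q\<close> bounds the
  inverse of \<open>Z\<close>.\<close>

lemma Z_lower: "L2_set v {..<m} \<le> q * L2_set (\<lambda>l. \<Sum>t<m. Z l t * v t) {..<m}"
proof -
  define x where "x t = s t * v t" for t
  let ?Zv = "\<lambda>l. \<Sum>t<m. Z l t * v t"
  let ?x = "L2_set x {..<m}" and ?v = "L2_set v {..<m}" and ?z = "L2_set ?Zv {..<m}"
  have "?x * ?x = (\<Sum>t<m. (x t)\<^sup>2)" by (simp add: L2_set_def sum_nonneg)
  also have "\<dots> = (\<Sum>t<m. s t * (x t * v t))" by (simp add: x_def power2_eq_square mult_ac)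
  also have "\<dots> \<le> (\<Sum>l<m. x l * ?Zv l) + \<epsilon> * (?x * ?v)" using Z_close[of x v] by linarith
  also have "(\<Sum>l<m. x l * ?Zv l) \<le> (\<Sum>l<m. \<bar>x l\<bar> * \<bar>?Zv l\<bar>)" by (intro sum_mono) (metis abs_ge_self abs_mult)
  also have "\<dots> \<le> ?x * ?z" by (rule L2_set_mult_ineq)
  finally have "?x * ?x \<le> ?x * (?z + \<epsilon> * ?v)" by (simp add: algebra_simps)
  then have "?x \<le> ?z + \<epsilon> * ?v"
    using \<epsilon> L2_set_nonneg[of x "{..<m}"] L2_set_nonneg[of v "{..<m}"] L2_set_nonneg[of ?Zv "{..<m}"]
    by (cases "?x = 0") (auto simp: mult_le_cancel_left)
  moreover have "(1 / q + \<epsilon>) * ?v \<le> ?x"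
  proof -
    have "0 \<le> 1 / q + \<epsilon>" using q(1) \<epsilon> by simp
    then have "(1 / q + \<epsilon>) * ?v = L2_set (\<lambda>t. (1 / q + \<epsilon>) * v t) {..<m}" by (rule L2_set_right_distrib)
    also have "\<dots> = L2_set (\<lambda>t. (1 / q + \<epsilon>) * \<bar>v t\<bar>) {..<m}" by (simp add: L2_set_def power_mult_distrib)
    also have "\<dots> \<le> L2_set (\<lambda>t. s t * \<bar>v t\<bar>) {..<m}"
      using \<open>0 \<le> 1 / q + \<epsilon>\<close> by (intro L2_set_mono mult_right_mono singular_value_lower) auto
    also have "\<dots> = ?x" by (simp add: L2_set_def power_mult_distrib x_def)
    finally show ?thesis .
  qed
  ultimately have "(1 / q) * ?v \<le> ?z" by (simp add: algebra_simps)
  then show ?thesis using q(1) by (simp add: field_simps)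
qed

lemma B_le: "l < m \<Longrightarrow> k < m \<Longrightarrow> \<bar>B l k\<bar> \<le> R"
proof -
  assume lk: "l < m" "k < m"
  then show ?thesis
    using L2_Cauchy_Schwarz[OF sq_basis(1) sqG, of k l] G_le[of k]
    by (simp add: B_def orthonormal_L2_norm[OF ortho(1)])
qed

text \<open>The part of \<open>G k\<close> outside the span of the first \<open>m\<close> left
  singular vectors. The functions formed from eigenvectors lie in that span, so it is an unavoidable
  error term.\<close>

definition residual :: "nat \<Rightarrow> 'a \<Rightarrow> real" where "residual k y = G k y - (\<Sum>l<m. B l k * \<phi> l y)"

lemma sq_residual: "k < m \<Longrightarrow> sq_integrable M (residual k)"
  unfolding residual_def[abs_def]
  by (rule sq_integrable_diff[OF sqG]) (auto intro!: sq_integrable_sum sq_integrable_cmult sq_basis)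

text \<open>Invertibility of \<open>Z\<close> yields both the inverse of \<open>B\<close> and, for
  each \<open>k\<close>, a function \<open>v\<close> in the span of the right singular vectors that
  the exact operator maps to \<open>G k\<close>. The noisy operator maps this \<open>v\<close> into
  the span of the first \<open>m\<close> left singular vectors, so the residual is at most
  \<open>\<epsilon>\<close> times the norm of \<open>v\<close>.\<close>

lemma inverse_and_residual:
  obtains Bi where
    "\<And>i j. i < m \<Longrightarrow> j < m \<Longrightarrow> (\<Sum>k<m. B i k * Bi k j) = of_bool (i = j)"
    "\<And>i j. i < m \<Longrightarrow> j < m \<Longrightarrow> (\<Sum>k<m. Bi i k * B k j) = of_bool (i = j)"
    "\<And>i j. i < m \<Longrightarrow> j < m \<Longrightarrow> \<bar>Bi i j\<bar> \<le> R * q"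
    "\<And>k. k < m \<Longrightarrow> L2_norm M (residual k) \<le> \<epsilon> * (q * R)"
proof -
  have inj: "x j = 0" if "\<And>i. i < m \<Longrightarrow> (\<Sum>j<m. Z i j * x j) = 0" and j: "j < m" for x j
  proof -
    have "L2_set x {..<m} \<le> 0" using Z_lower[of x] that(1) by (simp add: L2_set_0')
    then have "L2_set x {..<m} = 0" using L2_set_nonneg by (metis order_antisym)
    then show "x j = 0" using j by (simp add: L2_set_eq_0_iff)
  qed
  obtain W where W: "\<And>i j. i < m \<Longrightarrow> j < m \<Longrightarrow> (\<Sum>k<m. Z i k * W k j) = of_bool (i = j)"
  proof (rule injective_imp_inverse[of m Z])
    fix x j assume "\<And>i. i < m \<Longrightarrow> (\<Sum>j<m. Z i j * x j) = 0" "j < m"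
    then show "x j = 0" by (rule inj)
  next
    fix W assume "\<And>i j. i < m \<Longrightarrow> j < m \<Longrightarrow> (\<Sum>k<m. Z i k * W k j) = of_bool (i = j)"
    then show thesis by (rule that)
  qed
  have W_le: "L2_set (\<lambda>t. W t l) {..<m} \<le> q" if "l < m" for l
  proof -
    have "L2_set (\<lambda>i. \<Sum>t<m. Z i t * W t l) {..<m} = L2_set (\<lambda>i. of_bool (i = l)) {..<m}"
      using W that by (intro L2_set_cong) auto
    also have "\<dots> = 1" using that by (simp add: L2_set_def of_bool_def if_distrib[of "\<lambda>x. x\<^sup>2"] cong: if_cong)
    finally show ?thesis using Z_lower[of "\<lambda>t. W t l"] by simp
  qed
  \<comment> \<open>The factorization of \<open>Z\<close> shows that \<open>diag(\<pi>)\<close>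
    times the transpose of \<open>D\<close> times \<open>W\<close> is a right inverse of
    \<open>B\<close>.\<close>
  define Bi where "Bi k l = \<pi> k * (\<Sum>t<m. W t l * D t k)" for k l
  have D_sum: "(\<Sum>t<m. v t * D t k) = L2_inner N (\<lambda>z. \<Sum>t<m. v t * \<psi> t z) (H k)" if "k < m" for v k
    unfolding D_def by (rule L2_inner_sum_left[symmetric]) (use that in \<open>auto intro: sq_basis sqH\<close>)
  have BBi: "(\<Sum>k<m. B i k * Bi k j) = of_bool (i = j)" if "i < m" "j < m" for i j
  proof -
    have "(\<Sum>k<m. B i k * Bi k j) = (\<Sum>t<m. Z i t * W t j)"
      unfolding Bi_def Z_def sum_distrib_left sum_distrib_right by (subst sum.swap) (simp add: mult_ac)
    then show ?thesis using W that by simp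
  qed
  have BiB: "(\<Sum>k<m. Bi i k * B k j) = of_bool (i = j)" if "i < m" "j < m" for i j
    by (rule right_inverse_imp_left_inverse[OF BBi that])
  have \<pi>1: "\<bar>\<pi> k\<bar> \<le> 1" if "k < m" for k using weights[OF that] \<zeta> by simp
  have Bi_le: "\<bar>Bi k l\<bar> \<le> R * q" if "k < m" "l < m" for k l
  proof -
    have "\<bar>\<Sum>t<m. W t l * D t k\<bar> \<le> L2_norm N (\<lambda>z. \<Sum>t<m. W t l * \<psi> t z) * L2_norm N (H k)"
      unfolding D_sum[OF that(1)] by (intro L2_Cauchy_Schwarz sq_integrable_intros sq_basis sqH that)
    also have "\<dots> \<le> q * R"
      using W_le[OF that(2)] H_le[OF that(1)] q(1)
      by (intro mult_mono) (auto simp: orthonormal_norm_sum ortho L2_norm_nonneg)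
    finally show ?thesis
      using mult_mono[OF \<pi>1[OF that(1)]] by (fastforce simp: Bi_def abs_mult mult.commute)
  qed
  have res: "L2_norm M (residual k) \<le> \<epsilon> * (q * R)" if k: "k < m" for k
  proof -
    \<comment> \<open>\<open>V\<close> is the inverse of \<open>Z\<close> applied to column
      \<open>k\<close> of \<open>B\<close>; pairing with it isolates the component \<open>k\<close>
      in the exact form.\<close>
    define V where "V t = (\<Sum>l<m. W t l * B l k)" for t
    have ZV: "(\<Sum>t<m. Z i t * V t) = B i k" if "i < m" for i
    proof -
      have "(\<Sum>t<m. Z i t * V t) = (\<Sum>l<m. (\<Sum>t<m. Z i t * W t l) * B l k)"
        unfolding V_def sum_distrib_left sum_distrib_right by (subst sum.swap) (simp add: mult_ac)
      also have "\<dots> = (\<Sum>l<m. if i = l then B l k else 0)" using W that by (intro sum.cong) auto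
      finally show ?thesis using that by simp
    qed
    have "L2_set V {..<m} \<le> q * L2_set (\<lambda>i. B i k) {..<m}"
      using Z_lower[of V] ZV by (simp cong: L2_set_cong_simp)
    also have "\<dots> \<le> q * R"
      using order_trans[OF Bessel_L2[OF ortho(1) sqG[OF k], of m] G_le[OF k]] q(1)
      unfolding B_def by (intro mult_left_mono) auto
    finally have V_le: "L2_set V {..<m} \<le> q * R" .
    define v where "v z = (\<Sum>t<m. V t * \<psi> t z)" for z
    let ?r = "residual k"
    have sqv: "sq_integrable N v" unfolding v_def by (intro sq_integrable_intros sq_basis)
    have sqp: "sq_integrable M (\<lambda>y. \<Sum>l<m. B l k * \<phi> l y)" by (intro sq_integrable_intros sq_basis)
    have v_inner: "L2_inner N (\<psi> n) v = (if n < m then V n else 0)" for n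
      unfolding v_def by (rule orthonormal_inner_sum[OF ortho(2)])
    have r_orth: "L2_inner M (\<phi> n) ?r = 0" if "n < m" for n
      unfolding residual_def[abs_def] using that
      by (simp add: L2_inner_diff_right sqG[OF k] sqp sq_basis orthonormal_inner_sum[OF ortho(1)] B_def[symmetric])
    \<comment> \<open>Each term vanishes: the residual is orthogonal to \<open>\<phi> k\<close> for
      \<open>k < m\<close>, and \<open>v\<close> has no coordinate along \<open>\<psi> k\<close> for
      \<open>k \<ge> m\<close>.\<close>
    have "(\<lambda>n. \<Sum>k<n. s k * (L2_inner M (\<phi> k) ?r * L2_inner N (\<psi> k) v)) = (\<lambda>n. 0)"
      using r_orth by (intro ext sum.neutral) (auto simp: v_inner)
    then have f0: "form ?r v = 0" using form_SVD[OF sq_residual[OF k] sqv] by (simp add: LIMSEQ_const_iff)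
    have "(\<Sum>j<m. \<pi> j * (L2_inner M (G j) ?r * L2_inner N (H j) v)) = (\<Sum>j<m. if j = k then L2_inner M (G j) ?r else 0)"
    proof (rule sum.cong)
      fix j assume "j \<in> {..<m}"
      then have j: "j < m" by simp
      have "\<pi> j * L2_inner N (H j) v = \<pi> j * (\<Sum>t<m. V t * D t j)"
        unfolding v_def D_sum[OF j] by (simp add: L2_inner_commute)
      also have "\<dots> = (\<Sum>l<m. Bi j l * B l k)"
        unfolding V_def Bi_def sum_distrib_left sum_distrib_right by (subst sum.swap) (simp add: mult_ac)
      also have "\<dots> = of_bool (j = k)" by (rule BiB[OF j k])
      finally show "\<pi> j * (L2_inner M (G j) ?r * L2_inner N (H j) v) = (if j = k then L2_inner M (G j) ?r else 0)"
        by (auto simp: mult_ac)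
    qed simp
    then have "\<bar>L2_inner M (G k) ?r\<bar> \<le> \<epsilon> * (L2_norm M ?r * L2_norm N v)"
      using form_close[OF sq_residual[OF k] sqv] k by (simp add: f0)
    \<comment> \<open>The projection of \<open>G k\<close> is orthogonal to the residual, so the
      pairing is the squared residual norm.\<close>
    also have "L2_inner M (G k) ?r = L2_inner M ?r ?r"
    proof -
      have "L2_inner M (\<lambda>y. \<Sum>l<m. B l k * \<phi> l y) ?r = (\<Sum>l<m. B l k * L2_inner M (\<phi> l) ?r)"
        by (rule L2_inner_sum_left) (auto intro: sq_basis sq_residual[OF k])
      also have "\<dots> = 0" by (simp add: r_orth)
      finally show ?thesis
        using L2_inner_diff_left[OF sqG[OF k] sqp sq_residual[OF k]] by (simp add: residual_def[abs_def])
    qed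
    also have "\<bar>L2_inner M ?r ?r\<bar> = L2_norm M ?r * L2_norm M ?r" by (simp add: L2_inner_self power2_eq_square)
    finally have "L2_norm M ?r * L2_norm M ?r \<le> L2_norm M ?r * (\<epsilon> * L2_norm N v)" by (simp add: mult_ac)
    then have "L2_norm M ?r \<le> \<epsilon> * L2_norm N v"
      using \<epsilon> L2_norm_nonneg[of M ?r] L2_norm_nonneg[of N v]
      by (cases "L2_norm M ?r = 0") (auto simp: mult_le_cancel_left)
    also have "\<dots> \<le> \<epsilon> * (q * R)"
      unfolding v_def orthonormal_norm_sum[OF ortho(2)] by (intro mult_left_mono V_le \<epsilon>)
    finally show ?thesis .
  qed
  show thesis by (rule that[OF BBi BiB Bi_le res])
qed

end

section \<open>Perturbation of the eigenvectors\<close>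

lemma inverse_apply:
  fixes z :: "nat \<Rightarrow> complex"
  assumes "\<And>i j. i < m \<Longrightarrow> j < m \<Longrightarrow> (\<Sum>k<m. B i k * W k j) = of_bool (i = j)" "i < m"
  shows "(\<Sum>k<m. complex_of_real (B i k) * (\<Sum>l<m. complex_of_real (W k l) * z l)) = z i"
proof -
  have "(\<Sum>k<m. complex_of_real (B i k) * (\<Sum>l<m. complex_of_real (W k l) * z l))
    = (\<Sum>l<m. complex_of_real (\<Sum>k<m. B i k * W k l) * z l)"
    unfolding sum_distrib_left of_real_sum sum_distrib_right by (subst sum.swap) (simp add: mult_ac)
  also have "\<dots> = (\<Sum>l<m. if i = l then z l else 0)"
    using assms by (intro sum.cong) auto
  finally show ?thesis using assms(2) by simp
qed

lemma norm_sum_mult_le: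
  fixes x z :: "nat \<Rightarrow> complex"
  assumes "\<And>k. k < m \<Longrightarrow> norm (x k) \<le> b" "\<And>k. k < m \<Longrightarrow> norm (z k) \<le> c" "0 \<le> b"
  shows "norm (\<Sum>k<m. x k * z k) \<le> m * (b * c)"
proof -
  have "norm (\<Sum>k<m. x k * z k) \<le> (\<Sum>k<m. norm (x k * z k))" by (rule norm_sum)
  also have "\<dots> \<le> (\<Sum>k<m. b * c)"
    unfolding norm_mult using assms by (intro sum_mono mult_mono) auto
  finally show ?thesis by simp
qed

text \<open>\<open>Bi\<close> is the inverse of \<open>B\<close>, and \<open>\<eta>\<close> is the
  real matrix computed by the algorithm. Its closeness is stated for
  \<open>\<eta> l t * s t\<close>, which undoes the division by the singular value and leaves a
  bilinear form of the kernel restricted to \<open>A\<close>.\<close>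

locale perturbed_spectrum = perturbed_mixture M N m G H K s \<phi> \<psi> \<pi> \<zeta> \<gamma> \<epsilon> R q
  for M :: "'a measure" and N :: "'b measure" and m G H K s \<phi> \<psi> \<pi> \<zeta> \<gamma> \<epsilon> R q +
  fixes Bi :: "nat \<Rightarrow> nat \<Rightarrow> real" and a :: "nat \<Rightarrow> real" and \<eta> :: "nat \<Rightarrow> nat \<Rightarrow> real" and \<delta> :: real
  assumes BBi: "i < m \<Longrightarrow> j < m \<Longrightarrow> (\<Sum>k<m. B i k * Bi k j) = of_bool (i = j)"
    and BiB: "i < m \<Longrightarrow> j < m \<Longrightarrow> (\<Sum>k<m. Bi i k * B k j) = of_bool (i = j)"
    and Bi_le: "i < m \<Longrightarrow> j < m \<Longrightarrow> \<bar>Bi i j\<bar> \<le> R * q"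
    and residual_le: "k < m \<Longrightarrow> L2_norm M (residual k) \<le> \<epsilon> * (q * R)"
    and a: "k < m \<Longrightarrow> 0 \<le> a k" "k < m \<Longrightarrow> a k \<le> 1"
    and gap: "i < m \<Longrightarrow> j < m \<Longrightarrow> i \<noteq> j \<Longrightarrow> \<delta> \<le> \<bar>a i - a j\<bar>"
    and \<delta>: "0 < \<delta>" "\<delta> \<le> 1"
    and \<eta>_close: "l < m \<Longrightarrow> t < m \<Longrightarrow>
      \<bar>\<eta> l t * s t - (\<Sum>k<m. (\<pi> k * a k) * (B l k * D t k))\<bar> \<le> \<epsilon>"
    and R1: "1 \<le> R" and q1: "1 \<le> q"
    and G_bound: "k < m \<Longrightarrow> AE y in M. \<bar>G k y\<bar> \<le> R"
    and G_nonneg: "k < m \<Longrightarrow> AE y in M. 0 \<le> G k y"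
    and G_mass: "k < m \<Longrightarrow> (LINT y|M. G k y) = 1"
begin

text \<open>The defect in the similarity of \<open>\<eta>\<close> to \<open>diag(a)\<close> by means
  of \<open>B\<close>. In its entrywise bound \<open>\<theta>\<close>, one factor \<open>q\<close>
  comes from \<open>Bi\<close> and the other from dividing by a singular value.\<close>

definition X :: "nat \<Rightarrow> nat \<Rightarrow> real" where "X k t = (\<Sum>l<m. Bi k l * \<eta> l t) - a k * Bi k t"

definition \<theta> :: real where "\<theta> = 2 * m * R * q\<^sup>2 * \<epsilon>"

lemma \<theta>_nonneg: "0 \<le> \<theta>" using R1 \<epsilon> by (simp add: \<theta>_def)

text \<open>\<open>Z_close\<close> tested on unit coordinate vectors.\<close>

lemma Z_entry: "l < m \<Longrightarrow> t < m \<Longrightarrow> \<bar>of_bool (l = t) * s t - Z l t\<bar> \<le> \<epsilon>"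
proof -
  assume lt: "l < m" "t < m"
  have unit: "L2_set (\<lambda>i. of_bool (i = j)) {..<m} = 1" if "j < m" for j
    using that by (simp add: L2_set_def of_bool_def if_distrib[of "\<lambda>x. x\<^sup>2"] cong: if_cong)
  have pick: "(\<Sum>i<m. of_bool (i = j) * f i) = f j" if "j < m" for f :: "nat \<Rightarrow> real" and j
  proof -
    have "(\<Sum>i<m. of_bool (i = j) * f i) = (\<Sum>i<m. if i = j then f i else 0)" by (rule sum.cong) auto
    then show ?thesis using that by simp
  qed
  have "(\<Sum>i<m. s i * (of_bool (i = l) * of_bool (i = t))) = of_bool (l = t) * s t"
    using pick[OF lt(2), of "\<lambda>i. s i * of_bool (i = l)"] by (auto simp: mult_ac)
  moreover have "(\<Sum>i<m. of_bool (i = l) * (\<Sum>j<m. Z i j * of_bool (j = t))) = Z l t"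
    unfolding pick[OF lt(1)] using pick[OF lt(2), of "Z l"] by (simp only: mult.commute)
  ultimately show ?thesis
    using Z_close[of "\<lambda>i. of_bool (i = l)" "\<lambda>i. of_bool (i = t)"] lt by (simp only: unit mult_1_right)
qed

lemma Bi_rank_sum:
  assumes "k < m"
  shows "(\<Sum>l<m. Bi k l * (\<Sum>j<m. c j * (B l j * D t j))) = c k * D t k"
proof -
  have "(\<Sum>l<m. Bi k l * (\<Sum>j<m. c j * (B l j * D t j))) = (\<Sum>j<m. (\<Sum>l<m. Bi k l * B l j) * (c j * D t j))"
    unfolding sum_distrib_left sum_distrib_right by (subst sum.swap) (simp add: mult_ac)
  also have "\<dots> = (\<Sum>j<m. if k = j then c j * D t j else 0)"
    using BiB assms by (intro sum.cong) auto
  finally show ?thesis using assms by simp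
qed

text \<open>Multiply \<open>X k t\<close> by \<open>s t\<close> and replace both
  \<open>\<eta> l t * s t\<close> and the entries of \<open>diag(s)\<close> by their exact
  counterparts, with errors \<open>E1\<close> and \<open>E2\<close>. Since \<open>Bi\<close> inverts
  \<open>B\<close>, the exact parts both become \<open>\<pi> k * a k * D t k\<close> and cancel;
  dividing by \<open>s t\<close> costs at most a factor \<open>q\<close>.\<close>

lemma X_le:
  assumes "k < m" "t < m"
  shows "\<bar>X k t\<bar> \<le> \<theta>"
proof -
  define E1 where "E1 l = \<eta> l t * s t - (\<Sum>j<m. (\<pi> j * a j) * (B l j * D t j))" for l
  define E2 where "E2 l = of_bool (l = t) * s t - Z l t" for l
  have E: "\<bar>E1 l\<bar> \<le> \<epsilon>" "\<bar>E2 l\<bar> \<le> \<epsilon>" if "l < m" for l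
    using \<eta>_close[OF that assms(2)] Z_entry[OF that assms(2)] by (simp_all add: E1_def E2_def)
  have S1: "(\<Sum>l<m. Bi k l * E1 l) = (\<Sum>l<m. Bi k l * \<eta> l t) * s t - \<pi> k * a k * D t k"
    unfolding E1_def right_diff_distrib sum_subtractf Bi_rank_sum[OF assms(1)]
    by (simp add: sum_distrib_right mult.assoc)
  have S2: "(\<Sum>l<m. Bi k l * E2 l) = Bi k t * s t - \<pi> k * D t k"
    unfolding E2_def Z_def right_diff_distrib sum_subtractf Bi_rank_sum[OF assms(1)]
    using assms(2) by (simp add: of_bool_def if_distrib if_distribR cong: if_cong)
  have "X k t * s t = (\<Sum>l<m. Bi k l * E1 l) - a k * (\<Sum>l<m. Bi k l * E2 l)"
    unfolding S1 S2 X_def by (simp add: algebra_simps)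
  moreover have le: "\<bar>\<Sum>l<m. Bi k l * e l\<bar> \<le> m * (R * q * \<epsilon>)" if "\<And>l. l < m \<Longrightarrow> \<bar>e l\<bar> \<le> \<epsilon>" for e
  proof -
    have "\<bar>\<Sum>l<m. Bi k l * e l\<bar> \<le> (\<Sum>l<m. \<bar>Bi k l * e l\<bar>)" by (rule sum_abs)
    also have "\<dots> \<le> (\<Sum>l<m. R * q * \<epsilon>)"
      unfolding abs_mult using Bi_le[OF assms(1)] that R1 q1 by (intro sum_mono mult_mono) auto
    finally show ?thesis by simp
  qed
  moreover have "\<bar>a k * (\<Sum>l<m. Bi k l * E2 l)\<bar> \<le> 1 * (m * (R * q * \<epsilon>))"
    unfolding abs_mult using a[OF assms(1)] le[OF E(2)] by (intro mult_mono) auto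
  moreover have "\<bar>\<Sum>l<m. Bi k l * E1 l\<bar> \<le> m * (R * q * \<epsilon>)" by (rule le[OF E(1)])
  ultimately have "\<bar>X k t * s t\<bar> \<le> m * (R * q * \<epsilon>) + m * (R * q * \<epsilon>)" by linarith
  then have "\<bar>X k t\<bar> * s t \<le> 2 * m * R * q * \<epsilon>"
    using s_nonneg[of t] by (simp add: abs_mult mult_ac)
  moreover have "\<bar>X k t\<bar> * (1 / q) \<le> \<bar>X k t\<bar> * s t"
    using singular_value_lower[OF assms(2)] \<epsilon> by (intro mult_left_mono) auto
  ultimately have "\<bar>X k t\<bar> * (1 / q) \<le> 2 * m * R * q * \<epsilon>" by linarith
  then have "\<bar>X k t\<bar> \<le> 2 * m * R * q * \<epsilon> * q" using q(1) by (simp add: field_simps)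
  then show ?thesis by (simp add: \<theta>_def power2_eq_square mult_ac)
qed

lemma Bi_\<eta>_apply:
  fixes v :: "nat \<Rightarrow> complex"
  shows "(\<Sum>l<m. complex_of_real (Bi k l) * (\<Sum>t<m. complex_of_real (\<eta> l t) * v t))
    = (\<Sum>t<m. complex_of_real (X k t) * v t) + complex_of_real (a k) * (\<Sum>t<m. complex_of_real (Bi k t) * v t)"
proof -
  have "(\<Sum>l<m. complex_of_real (Bi k l) * (\<Sum>t<m. complex_of_real (\<eta> l t) * v t))
    = (\<Sum>t<m. complex_of_real (\<Sum>l<m. Bi k l * \<eta> l t) * v t)"
    unfolding sum_distrib_left of_real_sum sum_distrib_right by (subst sum.swap) (simp add: mult_ac)
  also have "\<dots> = (\<Sum>t<m. complex_of_real (X k t) * v t + complex_of_real (a k) * (complex_of_real (Bi k t) * v t))"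
    by (simp add: X_def algebra_simps)
  finally show ?thesis by (simp add: sum.distrib sum_distrib_left)
qed

text \<open>In the coordinates \<open>x\<close>, with \<open>v = B x\<close>, the matrix
  \<open>\<eta>\<close> becomes \<open>diag(a) + X B\<close>, a diagonal matrix with a perturbation
  of entries at most \<open>m * \<theta> * R\<close>. A real eigenvector of this matrix is
  transported back by \<open>B\<close>.\<close>

lemma separated_eigenvalue:
  assumes small: "m * (m * \<theta> * R) < \<delta> / 2" and "k < m"
  shows "\<exists>t v. \<bar>t - a k\<bar> < \<delta> / 2 \<and> (\<exists>j<m. v j \<noteq> 0) \<and>
    (\<forall>l<m. (\<Sum>j<m. complex_of_real (\<eta> l j) * v j) = complex_of_real t * v l)"
proof -
  define E where "E i j = (\<Sum>t<m. X i t * B t j)" for i j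
  have E: "\<bar>E i j\<bar> \<le> m * \<theta> * R" if "i < m" "j < m" for i j
  proof -
    have "\<bar>E i j\<bar> \<le> (\<Sum>t<m. \<bar>X i t * B t j\<bar>)" unfolding E_def by (rule sum_abs)
    also have "\<dots> \<le> (\<Sum>t<m. \<theta> * R)"
      unfolding abs_mult using X_le B_le that \<theta>_nonneg by (intro sum_mono mult_mono) auto
    finally show ?thesis by simp
  qed
  obtain t x where t: "\<bar>t - a k\<bar> < \<delta> / 2" and x0: "\<exists>j<m. x j \<noteq> 0"
    and x: "\<And>i. i < m \<Longrightarrow> a i * x i + (\<Sum>j<m. E i j * x j) = t * x i"
  proof (rule perturbed_diagonal_eigenvalue[of m E "m * \<theta> * R" \<delta> a k])
    show "m * (m * \<theta> * R) < \<delta> / 2" "k < m" by fact+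
  qed (auto intro: E gap)
  define v where "v l = (\<Sum>j<m. complex_of_real (B l j) * complex_of_real (x j))" for l
  have Biv: "(\<Sum>l<m. complex_of_real (Bi i l) * v l) = complex_of_real (x i)" if "i < m" for i
    unfolding v_def by (rule inverse_apply[OF BiB that])
  have eig: "(\<Sum>j<m. complex_of_real (\<eta> l j) * v j) = complex_of_real t * v l" if l: "l < m" for l
  proof -
    have Biz: "(\<Sum>l<m. complex_of_real (Bi i l) * (\<Sum>t<m. complex_of_real (\<eta> l t) * v t)) = complex_of_real (t * x i)"
      if "i < m" for i
    proof -
      have "(\<Sum>t<m. complex_of_real (X i t) * v t) = complex_of_real (\<Sum>j<m. E i j * x j)"
        unfolding v_def E_def sum_distrib_left sum_distrib_right of_real_sum
        by (subst sum.swap) (simp add: mult_ac)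
      then show ?thesis
        unfolding Bi_\<eta>_apply Biv[OF that] x[OF that, symmetric] by simp
    qed
    have "(\<Sum>j<m. complex_of_real (\<eta> l j) * v j)
      = (\<Sum>i<m. complex_of_real (B l i) * complex_of_real (t * x i))"
      using inverse_apply[OF BBi l, of "\<lambda>l. \<Sum>j<m. complex_of_real (\<eta> l j) * v j"] Biz by simp
    then show ?thesis by (simp add: v_def sum_distrib_left mult_ac)
  qed
  have "\<exists>j<m. v j \<noteq> 0"
  proof (rule ccontr)
    assume "\<not> ?thesis"
    then have "complex_of_real (x i) = 0" if "i < m" for i unfolding Biv[OF that, symmetric] by simp
    then show False using x0 by auto
  qed
  with t eig show ?thesis by blast
qed

end

text \<open>\<open>spanning\<close> expresses that the list \<open>w\<close> spans every eigenspace;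
  \<open>phase\<close> is the normalization that turns a complex unit eigenvector into an
  approximation of a density.\<close>

locale recovered_eigenvectors = perturbed_spectrum M N m G H K s \<phi> \<psi> \<pi> \<zeta> \<gamma> \<epsilon> R q Bi a \<eta> \<delta>
  for M :: "'a measure" and N :: "'b measure" and m G H K s \<phi> \<psi> \<pi> \<zeta> \<gamma> \<epsilon> R q Bi a \<eta> \<delta> +
  fixes w :: "nat \<Rightarrow> nat \<Rightarrow> complex" and \<alpha> :: "nat \<Rightarrow> complex"
  assumes eigen: "k < m \<Longrightarrow> l < m \<Longrightarrow> (\<Sum>t<m. complex_of_real (\<eta> l t) * w k t) = \<alpha> k * w k l"
    and unit: "k < m \<Longrightarrow> (\<Sum>h<m. (cmod (w k h))\<^sup>2) = 1"
    and spanning: "(\<And>l. l < m \<Longrightarrow> (\<Sum>t<m. complex_of_real (\<eta> l t) * v t) = b * v l) \<Longrightarrow> \<exists>j<m. v j \<noteq> 0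
      \<Longrightarrow> \<exists>c. \<forall>h<m. v h = (\<Sum>k<m. c k * w k h)"
    and phase: "k < m \<Longrightarrow> (LINT y|M. (\<Sum>h<m. w k h * complex_of_real (\<phi> h y))) \<in> \<real>\<^sub>\<ge>\<^sub>0"
begin

text \<open>Each of the disjoint intervals around the \<open>a l\<close> contains an eigenvalue of
  \<open>\<eta>\<close>, and the spanning property makes it the eigenvalue of some
  \<open>w k\<close>. The resulting map from components to eigenvectors is injective, hence
  bijective on \<open>m\<close> indices, and \<open>\<sigma>\<close> is its inverse.\<close>

lemma matching:
  assumes small: "m * (m * \<theta> * R) < \<delta> / 2"
  obtains \<sigma> where "\<sigma> permutes {..<m}" "\<And>k. k < m \<Longrightarrow> cmod (\<alpha> k - a (\<sigma> k)) < \<delta> / 2"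
proof -
  have "\<exists>k<m. cmod (\<alpha> k - a l) < \<delta> / 2" if l: "l < m" for l
  proof -
    obtain t v where t: "\<bar>t - a l\<bar> < \<delta> / 2" and v0: "\<exists>j<m. v j \<noteq> 0"
      and v': "\<forall>l<m. (\<Sum>j<m. complex_of_real (\<eta> l j) * v j) = complex_of_real t * v l"
      using separated_eigenvalue[OF small l] by blast
    note v = v'[rule_format]
    obtain c where "\<forall>h<m. v h = (\<Sum>k<m. c k * w k h)" using spanning[OF v v0] by blast
    then have "\<exists>k<m. \<alpha> k = complex_of_real t"
      by (intro eigenvalue_of_spanning_family[where \<eta> = "\<lambda>l j. complex_of_real (\<eta> l j)", OF eigen v v0]) auto
    then obtain k where "k < m" "\<alpha> k = complex_of_real t" by blast
    moreover have "cmod (complex_of_real t - a l) = \<bar>t - a l\<bar>" by (metis norm_of_real of_real_diff)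
    ultimately show ?thesis using t by auto
  qed
  then obtain f where f: "\<And>l. l < m \<Longrightarrow> f l < m" "\<And>l. l < m \<Longrightarrow> cmod (\<alpha> (f l) - a l) < \<delta> / 2" by metis
  have inj: "inj_on f {..<m}"
  proof (rule inj_onI, rule ccontr)
    fix i j assume ij: "i \<in> {..<m}" "j \<in> {..<m}" "f i = f j" "i \<noteq> j"
    have "cmod (complex_of_real (a i) - a j) = \<bar>a i - a j\<bar>" by (metis norm_of_real of_real_diff)
    moreover have "cmod (complex_of_real (a i) - a j) \<le> cmod (\<alpha> (f i) - a i) + cmod (\<alpha> (f j) - a j)"
      using norm_triangle_ineq4[of "\<alpha> (f j) - a j" "\<alpha> (f i) - a i"] ij(3) by (simp add: add.commute)
    ultimately show False using f(2)[of i] f(2)[of j] gap[of i j] ij by auto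
  qed
  have bij: "bij_betw f {..<m} {..<m}"
    using inj f(1) by (intro bij_betw_imageI endo_inj_surj) auto
  define \<sigma> where "\<sigma> k = (if k < m then inv_into {..<m} f k else k)" for k
  show thesis
  proof (rule that)
    have "bij_betw \<sigma> {..<m} {..<m}"
      using bij_betw_inv_into[OF bij] by (rule bij_betw_cong[THEN iffD1, rotated]) (simp add: \<sigma>_def)
    then show "\<sigma> permutes {..<m}" by (rule bij_imp_permutes) (simp add: \<sigma>_def)
    fix k assume k: "k < m"
    have "\<sigma> k < m" "f (\<sigma> k) = k"
      using k bij_betw_inv_into_right[OF bij, of k] bij_betwE[OF bij_betw_inv_into[OF bij]] by (auto simp: \<sigma>_def)
    then show "cmod (\<alpha> k - a (\<sigma> k)) < \<delta> / 2" using f(2)[of "\<sigma> k"] by simp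
  qed
qed

text \<open>The coordinates of the eigenvector in the basis of components: \<open>w_eq\<close>
  recovers \<open>w k\<close> as \<open>B\<close> applied to \<open>x k\<close>.\<close>

definition x :: "nat \<Rightarrow> nat \<Rightarrow> complex" where "x k j = (\<Sum>h<m. complex_of_real (Bi j h) * w k h)"

definition g :: "nat \<Rightarrow> 'a \<Rightarrow> complex" where "g k y = (\<Sum>h<m. w k h * complex_of_real (\<phi> h y))"

lemma w_le: "k < m \<Longrightarrow> h < m \<Longrightarrow> cmod (w k h) \<le> 1"
proof -
  assume kh: "k < m" "h < m"
  then have "(cmod (w k h))\<^sup>2 \<le> (\<Sum>h<m. (cmod (w k h))\<^sup>2)" by (intro member_le_sum) auto
  then show ?thesis using kh by (simp add: unit abs_square_le_1)
qed

lemma x_le: "k < m \<Longrightarrow> j < m \<Longrightarrow> cmod (x k j) \<le> m * (R * q)"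
  unfolding x_def using norm_sum_mult_le[of m "\<lambda>h. complex_of_real (Bi j h)" "R * q" "w k" 1] Bi_le w_le R1 q1
  by simp

lemma w_eq: "k < m \<Longrightarrow> h < m \<Longrightarrow> w k h = (\<Sum>j<m. complex_of_real (B h j) * x k j)"
  unfolding x_def by (rule inverse_apply[OF BBi, symmetric])

text \<open>Applying \<open>Bi\<close> to the eigenvector equation turns it into
  \<open>(\<alpha> k - a j) * x k j = (X w)_j\<close>, whose right-hand side is small.\<close>

lemma eigen_coord:
  assumes "k < m" "j < m"
  shows "cmod (\<alpha> k - a j) * cmod (x k j) \<le> m * \<theta>"
proof -
  have "\<alpha> k * x k j = (\<Sum>l<m. complex_of_real (Bi j l) * (\<Sum>t<m. complex_of_real (\<eta> l t) * w k t))"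
    using eigen[OF assms(1)] by (simp add: x_def sum_distrib_left mult_ac)
  then have "(\<alpha> k - a j) * x k j = (\<Sum>t<m. complex_of_real (X j t) * w k t)"
    unfolding Bi_\<eta>_apply by (simp add: x_def algebra_simps)
  moreover have "cmod (\<Sum>t<m. complex_of_real (X j t) * w k t) \<le> m * (\<theta> * 1)"
    using X_le w_le assms \<theta>_nonneg by (intro norm_sum_mult_le) auto
  ultimately show ?thesis by (simp add: norm_mult[symmetric])
qed

text \<open>An eigenvalue within \<open>\<delta> / 2\<close> of \<open>a l\<close> is at least
  \<open>\<delta> / 2\<close> away from every other \<open>a j\<close>, so
  \<open>eigen_coord\<close> bounds the remaining coordinates.\<close>

lemma x_off:
  assumes "k < m" "j < m" "l < m" "j \<noteq> l" "cmod (\<alpha> k - a l) < \<delta> / 2"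
  shows "cmod (x k j) \<le> 2 * m * \<theta> / \<delta>"
proof -
  have "\<delta> \<le> cmod (complex_of_real (a l) - a j)"
    using gap[of l j] assms by (metis norm_of_real of_real_diff)
  also have "\<dots> \<le> cmod (\<alpha> k - a j) + cmod (\<alpha> k - a l)"
    using norm_triangle_ineq4[of "\<alpha> k - a j" "\<alpha> k - a l"] by simp
  finally have "\<delta> / 2 \<le> cmod (\<alpha> k - a j)" using assms(5) by simp
  then have "\<delta> / 2 * cmod (x k j) \<le> m * \<theta>"
    using eigen_coord[OF assms(1,2)] by (meson mult_right_mono norm_ge_zero order_trans)
  then show ?thesis using \<delta>(1) by (simp add: field_simps)
qed

lemma sq_g: "sq_integrable M (g k)"
  unfolding g_def[abs_def] by (intro sq_integrable_sum sq_integrable_cmult sq_integrable_of_real sq_basis)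

text \<open>In the coordinates \<open>x\<close>, the function \<open>g k\<close> is a combination of
  the projections of the \<open>G j\<close>, each of which is \<open>G j\<close> minus its
  residual.\<close>

lemma g_eq: "k < m \<Longrightarrow> g k y = (\<Sum>j<m. x k j * complex_of_real (G j y)) - (\<Sum>j<m. x k j * complex_of_real (residual j y))"
proof -
  assume k: "k < m"
  have "g k y = (\<Sum>h<m. (\<Sum>j<m. complex_of_real (B h j) * x k j) * complex_of_real (\<phi> h y))"
    unfolding g_def using w_eq[OF k] by simp
  also have "\<dots> = (\<Sum>j<m. x k j * complex_of_real (\<Sum>h<m. B h j * \<phi> h y))"
    unfolding sum_distrib_left of_real_sum sum_distrib_right by (subst sum.swap) (simp add: mult_ac)
  also have "\<dots> = (\<Sum>j<m. x k j * complex_of_real (G j y) - x k j * complex_of_real (residual j y))"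
    by (simp add: residual_def algebra_simps)
  finally show ?thesis by (simp add: sum_subtractf)
qed

text \<open>Two errors add up: the coordinates off \<open>l\<close> contribute
  \<open>4 * m ^ 3\<close>, since \<open>\<theta>\<close> already carries \<open>2 * m\<close>, and
  the residuals contribute the fifth \<open>m ^ 3\<close>.\<close>

lemma g_close:
  assumes k: "k < m" and l: "l < m" and near: "cmod (\<alpha> k - a l) < \<delta> / 2"
  shows "L2_norm M (\<lambda>y. g k y - x k l * complex_of_real (G l y)) \<le> 5 * m ^ 3 * R\<^sup>2 * q\<^sup>2 * \<epsilon> / \<delta>"
proof -
  let ?u = "\<lambda>y. \<Sum>j\<in>{..<m} - {l}. x k j * complex_of_real (G j y)"
  let ?v = "\<lambda>y. \<Sum>j<m. x k j * complex_of_real (residual j y)"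
  have "(\<Sum>j<m. x k j * complex_of_real (G j y)) = x k l * complex_of_real (G l y) + ?u y" for y
    using l by (subst sum.remove[of _ l]) auto
  then have eq: "g k y - x k l * complex_of_real (G l y) = ?u y - ?v y" for y by (simp add: g_eq[OF k])
  have "L2_norm M (\<lambda>y. ?u y - ?v y) \<le> L2_norm M ?u + L2_norm M ?v"
    by (intro L2_norm_triangle_diff sq_integrable_sum sq_integrable_cmult sq_integrable_of_real sqG sq_residual) auto
  also have "L2_norm M ?u \<le> (\<Sum>j\<in>{..<m} - {l}. norm (x k j) * L2_norm M (\<lambda>y. complex_of_real (G j y)))"
    by (intro L2_norm_sum sq_integrable_of_real sqG) auto
  also have "\<dots> \<le> (\<Sum>j\<in>{..<m} - {l}. 2 * m * \<theta> / \<delta> * R)"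
    using x_off[OF k _ l _ near] G_le \<theta>_nonneg \<delta> R1
    by (intro sum_mono mult_mono) (auto simp: L2_norm_of_real L2_norm_nonneg)
  also have "\<dots> \<le> (\<Sum>j<m. 2 * m * \<theta> / \<delta> * R)"
    using \<theta>_nonneg \<delta> R1 by (intro sum_mono2) auto
  also have "\<dots> = 4 * m ^ 3 * R\<^sup>2 * q\<^sup>2 * \<epsilon> / \<delta>"
    by (simp add: \<theta>_def power2_eq_square power3_eq_cube)
  also have "L2_norm M ?v \<le> (\<Sum>j<m. norm (x k j) * L2_norm M (\<lambda>y. complex_of_real (residual j y)))"
    by (intro L2_norm_sum sq_integrable_of_real sq_residual) auto
  also have "\<dots> \<le> (\<Sum>j<m. m * (R * q) * (\<epsilon> * (q * R)))"
    using x_le[OF k] residual_le R1 q1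
    by (intro sum_mono mult_mono) (auto simp: L2_norm_of_real L2_norm_nonneg)
  also have "\<dots> = m\<^sup>2 * R\<^sup>2 * q\<^sup>2 * \<epsilon> * 1"
    by (simp add: power2_eq_square)
  \<comment> \<open>As \<open>\<delta> \<le> 1 \<le> m\<close>, the factor
    \<open>m / \<delta>\<close> brings the residual term into the same form as the other
    one.\<close>
  also have "\<dots> \<le> m\<^sup>2 * R\<^sup>2 * q\<^sup>2 * \<epsilon> * (m / \<delta>)"
    using \<delta> m \<epsilon> by (intro mult_left_mono) (auto simp: field_simps intro: order_trans)
  also have "\<dots> = m ^ 3 * R\<^sup>2 * q\<^sup>2 * \<epsilon> / \<delta>" by (simp add: power2_eq_square power3_eq_cube)
  finally show ?thesis unfolding eq by (simp add: mult_ac)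
qed

text \<open>Pairing \<open>g k\<close> with the bounded functions \<open>G j\<close> recovers the \<open>\<ell>\<^sup>2\<close>-norm of \<open>w k\<close>, which
  keeps the normalizing constant away from \<open>0\<close>.\<close>

lemma g_L1_lower: "k < m \<Longrightarrow> 1 \<le> m\<^sup>2 * R\<^sup>2 * q * L1_norm M (g k)"
proof -
  assume k: "k < m"
  let ?n = "L1_norm M (g k)"
  have pair: "cmod (\<Sum>h<m. complex_of_real (B h j) * w k h) \<le> R * ?n" if j: "j < m" for j
  proof -
    have int: "integrable M (\<lambda>y. \<phi> h y * G j y)" for h by (intro integrable_mult_sq sq_basis sqG j)
    have "(LINT y|M. complex_of_real (G j y) * g k y) = (LINT y|M. (\<Sum>h<m. w k h * complex_of_real (\<phi> h y * G j y)))"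
      by (simp add: g_def sum_distrib_left mult_ac)
    also have "\<dots> = (\<Sum>h<m. LINT y|M. w k h * complex_of_real (\<phi> h y * G j y))"
      by (intro Bochner_Integration.integral_sum integrable_mult_right integrable_of_real int)
    also have "\<dots> = (\<Sum>h<m. w k h * (LINT y|M. complex_of_real (\<phi> h y * G j y)))"
      by (simp only: integral_mult_right_zero)
    also have "\<dots> = (\<Sum>h<m. complex_of_real (B h j) * w k h)"
      by (simp only: integral_complex_of_real) (simp add: B_def L2_inner_def mult_ac)
    finally have eq: "(\<Sum>h<m. complex_of_real (B h j) * w k h) = (LINT y|M. complex_of_real (G j y) * g k y)" ..
    have "cmod (LINT y|M. complex_of_real (G j y) * g k y) \<le> (LINT y|M. cmod (complex_of_real (G j y) * g k y))"
      by (rule integral_norm_bound)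
    also have "\<dots> \<le> (LINT y|M. R * cmod (g k y))"
    proof (rule integral_mono_AE')
      show "integrable M (\<lambda>y. R * cmod (g k y))" using M1.integrable_sq[OF sq_g] by auto
      show "AE y in M. cmod (complex_of_real (G j y) * g k y) \<le> R * cmod (g k y)"
        using G_bound[OF j] by eventually_elim (simp add: norm_mult mult_right_mono)
    qed (use R1 in simp)
    finally show ?thesis by (simp add: eq L1_norm_def)
  qed
  have n0: "0 \<le> ?n" by (simp add: L1_norm_def)
  \<comment> \<open>Expanding one copy of \<open>w k\<close> as \<open>B x\<close> turns its unit
    length into a sum of \<open>x k j\<close> times the conjugated pairing of \<open>g k\<close>
    with \<open>G j\<close>, so the pairings cannot all be small.\<close>
  have "complex_of_real 1 = (\<Sum>h<m. complex_of_real ((cmod (w k h))\<^sup>2))"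
    unfolding of_real_sum[symmetric] unit[OF k] ..
  also have "\<dots> = (\<Sum>h<m. (\<Sum>j<m. complex_of_real (B h j) * x k j) * cnj (w k h))"
    using w_eq[OF k] by (intro sum.cong) (auto simp: complex_norm_square simp del: of_real_power)
  also have "\<dots> = (\<Sum>j<m. x k j * cnj (\<Sum>h<m. complex_of_real (B h j) * w k h))"
    unfolding sum_distrib_left sum_distrib_right cnj_sum by (subst sum.swap) (simp add: mult_ac)
  finally have "1 = cmod (\<Sum>j<m. x k j * cnj (\<Sum>h<m. complex_of_real (B h j) * w k h))"
    by (metis norm_of_real abs_one)
  also have "\<dots> \<le> m * (m * (R * q) * (R * ?n))"
    using x_le[OF k] pair R1 q1 by (intro norm_sum_mult_le) (auto simp del: cnj_sum)
  finally show ?thesis by (simp add: power2_eq_square mult_ac)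
qed

definition h :: "nat \<Rightarrow> 'a \<Rightarrow> complex" where "h k y = g k y / complex_of_real (L1_norm M (g k))"

lemma h_eq: "h k y = inverse (complex_of_real (L1_norm M (g k))) * g k y"
  by (simp add: h_def field_simps)

lemma sq_h: "sq_integrable M (h k)"
  unfolding h_eq[abs_def] by (intro sq_integrable_cmult sq_g)

lemma L1_pos: "k < m \<Longrightarrow> 0 < L1_norm M (g k)"
proof -
  assume k: "k < m"
  have "L1_norm M (g k) \<noteq> 0" using g_L1_lower[OF k] by auto
  moreover have "0 \<le> L1_norm M (g k)" by (simp add: L1_norm_def)
  ultimately show ?thesis by simp
qed

lemma inverse_L1_le: "k < m \<Longrightarrow> inverse (L1_norm M (g k)) \<le> m\<^sup>2 * R\<^sup>2 * q"
  using g_L1_lower[of k] L1_pos[of k] by (simp add: field_simps)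

text \<open>Write \<open>c\<close> for the coordinate \<open>x k l\<close>. Because
  \<open>g k\<close> is close to \<open>c * G l\<close> in L1 and \<open>G l\<close> is a density,
  the integral of \<open>g k\<close> is close to \<open>c\<close> and its L1 norm is close to the
  modulus of \<open>c\<close>. The integral is a nonnegative real by the phase condition, so the L1
  norm is close to \<open>c\<close> itself, and dividing by it approximates
  \<open>G l\<close>.\<close>

lemma h_close:
  assumes k: "k < m" and l: "l < m" and near: "cmod (\<alpha> k - a l) < \<delta> / 2"
  shows "L2_norm M (\<lambda>y. h k y - complex_of_real (G l y)) \<le> 20 * real m ^ 6 * R ^ 5 * q ^ 3 * \<epsilon> / \<delta>"
proof -
  define e where "e = 5 * m ^ 3 * R\<^sup>2 * q\<^sup>2 * \<epsilon> / \<delta>"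
  define n where "n = L1_norm M (g k)"
  let ?c = "x k l" and ?G = "\<lambda>y. complex_of_real (G l y)"
  let ?d = "\<lambda>y. g k y - ?c * ?G y"
  have e0: "0 \<le> e" using \<epsilon> \<delta> by (simp add: e_def)
  have n0: "0 < n" unfolding n_def by (rule L1_pos[OF k])
  have sqG': "sq_integrable M ?G" by (intro sq_integrable_of_real sqG l)
  have sqd: "sq_integrable M ?d" by (intro sq_integrable_diff sq_integrable_cmult sq_g sqG')
  have d2: "L2_norm M ?d \<le> e" unfolding e_def by (rule g_close[OF k l near])
  then have d1: "L1_norm M ?d \<le> e" using M1.L1_norm_le_L2_norm[OF sqd] by linarith
  have intg: "integrable M (g k)" "integrable M ?G" "integrable M ?d"
    by (intro M1.integrable_sq sq_g sqG' sqd)+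
  have mass: "(LINT y|M. ?G y) = 1" using G_mass[OF l] by (simp add: integral_complex_of_real)
  have L1G: "L1_norm M ?G = 1"
  proof -
    have "L1_norm M ?G = (LINT y|M. G l y)"
      unfolding L1_norm_def using G_nonneg[OF l] intg(2) sqG[OF l]
      by (intro integral_cong_AE) (auto dest: sq_integrableD)
    then show ?thesis by (simp add: G_mass[OF l])
  qed
  define p where "p = (LINT y|M. g k y)"
  have p: "p \<in> \<real>\<^sub>\<ge>\<^sub>0" unfolding p_def g_def by (rule phase[OF k])
  then have p_real: "complex_of_real (cmod p) = p" by (auto simp: nonneg_Reals_def)
  have "(LINT y|M. ?d y) = p - ?c"
    unfolding p_def using intg by (subst Bochner_Integration.integral_diff) (auto simp: mass G_mass[OF l])
  then have pc: "cmod (p - ?c) \<le> e"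
    using integral_norm_bound[of M ?d] d1 by (simp add: L1_norm_def)
  have nc: "\<bar>n - cmod ?c\<bar> \<le> e"
  proof -
    have c1: "cmod ?c = (LINT y|M. cmod (?c * ?G y))" using L1G by (simp add: norm_mult L1_norm_def)
    have diff: "n - cmod ?c = (LINT y|M. cmod (g k y) - cmod (?c * ?G y))"
      unfolding c1 n_def L1_norm_def using intg
      by (intro Bochner_Integration.integral_diff[symmetric] integrable_norm integrable_mult_right)
    have "\<bar>n - cmod ?c\<bar> \<le> (LINT y|M. \<bar>cmod (g k y) - cmod (?c * ?G y)\<bar>)"
      unfolding diff by (rule integral_abs_bound)
    also have "\<dots> \<le> (LINT y|M. cmod (?d y))"
    proof (rule integral_mono_AE')
      show "integrable M (\<lambda>y. cmod (?d y))" by (rule integrable_norm[OF intg(3)])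
      show "AE y in M. \<bar>cmod (g k y) - cmod (?c * ?G y)\<bar> \<le> cmod (?d y)"
        by (rule AE_I2) (rule norm_triangle_ineq3)
      show "AE y in M. 0 \<le> cmod (?d y)" by (rule AE_I2) (rule norm_ge_zero)
    qed
    finally show ?thesis using d1 by (simp add: L1_norm_def)
  qed
  \<comment> \<open>Three steps of size \<open>e\<close> lead from \<open>n\<close> to
    \<open>c\<close>: to the modulus of \<open>c\<close>, to the modulus of \<open>p\<close>, which
    equals \<open>p\<close>, and from \<open>p\<close> to \<open>c\<close>.\<close>
  have "cmod (complex_of_real n - ?c) \<le> 3 * e"
  proof -
    have "complex_of_real n - ?c = complex_of_real (n - cmod ?c) + complex_of_real (cmod ?c - cmod p) + (p - ?c)"
      by (simp add: p_real)
    then have "cmod (complex_of_real n - ?c) \<le> \<bar>n - cmod ?c\<bar> + \<bar>cmod ?c - cmod p\<bar> + cmod (p - ?c)"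
      by (metis (no_types, lifting) norm_of_real norm_triangle_mono norm_triangle_ineq order_refl)
    moreover have "\<bar>cmod ?c - cmod p\<bar> \<le> cmod (p - ?c)"
      by (metis norm_minus_commute norm_triangle_ineq3)
    ultimately show ?thesis using nc pc by linarith
  qed
  then have c3: "cmod (?c - complex_of_real n) \<le> 3 * e" by (simp add: norm_minus_commute)
  have GR: "L2_norm M ?G \<le> R" using G_le[OF l] by (simp add: L2_norm_of_real)
  have eq: "h k y - ?G y = inverse (complex_of_real n) * (?d y + (?c - complex_of_real n) * ?G y)" for y
    using n0 by (simp add: h_def n_def[symmetric] field_simps)
  have "L2_norm M (\<lambda>y. h k y - ?G y) = inverse n * L2_norm M (\<lambda>y. ?d y + (?c - complex_of_real n) * ?G y)"
    unfolding eq L2_norm_cmult using n0 by (simp add: norm_inverse)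
  also have "\<dots> \<le> inverse n * (L2_norm M ?d + L2_norm M (\<lambda>y. (?c - complex_of_real n) * ?G y))"
    using n0 by (intro mult_left_mono L2_norm_triangle sqd sq_integrable_cmult sqG') auto
  also have "\<dots> \<le> inverse n * (e + 3 * e * R)"
    unfolding L2_norm_cmult using n0 d2 c3 GR e0
    by (intro mult_left_mono add_mono mult_mono) (auto simp: L2_norm_nonneg)
  also have "\<dots> \<le> (m\<^sup>2 * R\<^sup>2 * q) * (4 * e * R)"
  proof (rule mult_mono)
    show "inverse n \<le> m\<^sup>2 * R\<^sup>2 * q" unfolding n_def by (rule inverse_L1_le[OF k])
    have "e * 1 \<le> e * R" using R1 e0 by (rule mult_left_mono)
    then show "e + 3 * e * R \<le> 4 * e * R" by linarith
    show "0 \<le> m\<^sup>2 * R\<^sup>2 * q" "0 \<le> e + 3 * e * R" using e0 R1 q1 by auto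
  qed
  also have "\<dots> = (20 * real m ^ 5 * R ^ 5 * q ^ 3 * \<epsilon> / \<delta>) * 1"
    by (simp add: e_def power2_eq_square eval_nat_numeral)
  \<comment> \<open>The additional factor \<open>m\<close> gives the bound the same form as in
    \<open>h_bounded\<close>.\<close>
  also have "\<dots> \<le> (20 * real m ^ 5 * R ^ 5 * q ^ 3 * \<epsilon> / \<delta>) * m"
    using m R1 q1 \<epsilon> \<delta> by (intro mult_left_mono) auto
  also have "\<dots> = 20 * real m ^ 6 * R ^ 5 * q ^ 3 * \<epsilon> / \<delta>" by (simp add: eval_nat_numeral)
  finally show ?thesis .
qed

text \<open>The case of large noise: the L1 lower bound gives a crude estimate of
  \<open>h k - G l\<close> for every \<open>l\<close>, and the failed smallness condition makes the
  claimed bound at least as large.\<close>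

lemma h_bounded:
  assumes k: "k < m" and l: "l < m" and large: "\<not> m * (m * \<theta> * R) < \<delta> / 2"
  shows "L2_norm M (\<lambda>y. h k y - complex_of_real (G l y)) \<le> 20 * real m ^ 6 * R ^ 5 * q ^ 3 * \<epsilon> / \<delta>"
proof -
  have "L2_norm M (g k) \<le> (\<Sum>h<m. norm (w k h) * L2_norm M (\<lambda>y. complex_of_real (\<phi> h y)))"
    unfolding g_def[abs_def] by (intro L2_norm_sum sq_integrable_of_real sq_basis)
  also have "\<dots> \<le> (\<Sum>h<m. 1 :: real)"
    using w_le[OF k] by (intro sum_mono) (simp add: L2_norm_of_real orthonormal_L2_norm[OF ortho(1)])
  finally have g_le: "L2_norm M (g k) \<le> m" by simp
  have "L2_norm M (\<lambda>y. h k y - complex_of_real (G l y)) \<le> L2_norm M (h k) + L2_norm M (\<lambda>y. complex_of_real (G l y))"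
    by (intro L2_norm_triangle_diff sq_h sq_integrable_of_real sqG l)
  also have "\<dots> \<le> m\<^sup>2 * R\<^sup>2 * q * m + R"
  proof (rule add_mono)
    show "L2_norm M (h k) \<le> (m\<^sup>2 * R\<^sup>2 * q) * m"
    unfolding h_eq[abs_def] L2_norm_cmult norm_inverse norm_of_real
    using L1_pos[OF k] inverse_L1_le[OF k] g_le q1 R1 by (intro mult_mono) (auto simp: L2_norm_nonneg)
    show "L2_norm M (\<lambda>y. complex_of_real (G l y)) \<le> R" using G_le[OF l] by (simp add: L2_norm_of_real)
  qed
  also have "\<dots> \<le> m\<^sup>2 * R\<^sup>2 * q * m + m\<^sup>2 * R\<^sup>2 * q * m"
  proof (rule add_left_mono)
    have "1 \<le> real m ^ 3" using m by (intro one_le_power) auto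
    moreover have "1 * 1 \<le> R * q" using R1 q1 by (intro mult_mono) auto
    ultimately have "1 * 1 \<le> real m ^ 3 * (R * q)" by (intro mult_mono) auto
    then have "R * 1 \<le> R * (real m ^ 3 * (R * q))" using R1 by (intro mult_left_mono) auto
    then show "R \<le> m\<^sup>2 * R\<^sup>2 * q * m" by (simp add: power2_eq_square power3_eq_cube mult_ac)
  qed
  also have "\<dots> = 2 * m ^ 3 * R\<^sup>2 * q * 1"
    by (simp add: power2_eq_square power3_eq_cube)
  also have "\<dots> \<le> 2 * m ^ 3 * R\<^sup>2 * q * (4 * m ^ 3 * R\<^sup>2 * q\<^sup>2 * \<epsilon> / \<delta>)"
  proof (rule mult_left_mono)
    \<comment> \<open>This is the negated smallness condition with \<open>\<theta>\<close>
      unfolded.\<close>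
    have "\<delta> \<le> 4 * m ^ 3 * R\<^sup>2 * q\<^sup>2 * \<epsilon>"
      using large by (simp add: \<theta>_def power2_eq_square power3_eq_cube mult_ac)
    then show "1 \<le> 4 * m ^ 3 * R\<^sup>2 * q\<^sup>2 * \<epsilon> / \<delta>" using \<delta> by (simp add: field_simps)
  qed (use q1 in auto)
  also have "\<dots> = (8 * m ^ 6 * R ^ 4 * q ^ 3 * \<epsilon> / \<delta>) * 1" by (simp add: power2_eq_square eval_nat_numeral)
  also have "\<dots> \<le> (20 * real m ^ 6 * R ^ 4 * q ^ 3 * \<epsilon> / \<delta>) * R"
    using R1 q1 \<epsilon> \<delta> by (intro mult_mono divide_right_mono mult_right_mono) auto
  also have "\<dots> = 20 * real m ^ 6 * R ^ 5 * q ^ 3 * \<epsilon> / \<delta>" by (simp add: eval_nat_numeral)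
  finally show ?thesis .
qed

text \<open>The permutation comes from \<open>matching\<close> when the noise is small; otherwise
  the identity serves.\<close>

theorem recovery:
  obtains \<sigma> where "\<sigma> permutes {..<m}"
    "\<And>k. k < m \<Longrightarrow> L2_norm M (\<lambda>y. h k y - complex_of_real (G (\<sigma> k) y)) \<le> 20 * real m ^ 6 * R ^ 5 * q ^ 3 * \<epsilon> / \<delta>"
proof (cases "m * (m * \<theta> * R) < \<delta> / 2")
  case True
  then obtain \<sigma> where \<sigma>: "\<sigma> permutes {..<m}" "\<And>k. k < m \<Longrightarrow> cmod (\<alpha> k - a (\<sigma> k)) < \<delta> / 2"
    using matching by blast
  show thesis
  proof (rule that[OF \<sigma>(1)])
    fix k assume k: "k < m"
    then have "\<sigma> k < m" using permutes_in_image[OF \<sigma>(1), of k] by simp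
    then show "L2_norm M (\<lambda>y. h k y - complex_of_real (G (\<sigma> k) y)) \<le> 20 * real m ^ 6 * R ^ 5 * q ^ 3 * \<epsilon> / \<delta>"
      by (rule h_close[OF k _ \<sigma>(2)[OF k]])
  qed
next
  case False
  show thesis
  proof (rule that[OF permutes_id])
    fix k assume k: "k < m"
    show "L2_norm M (\<lambda>y. h k y - complex_of_real (G (id k) y)) \<le> 20 * real m ^ 6 * R ^ 5 * q ^ 3 * \<epsilon> / \<delta>"
      using h_bounded[OF k k False] by simp
  qed
qed

end

section \<open>Product densities on the cube\<close>

lemma prob_space_unit_interval: "prob_space unit_interval"
  by (rule prob_spaceI) (simp add: emeasure_restrict_space)

interpretation unit: prob_space unit_interval by (rule prob_space_unit_interval)

interpretation cubes: product_prob_space "\<lambda>_ :: nat. unit_interval" UNIV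
  by (rule product_prob_spaceI) (rule prob_space_unit_interval)

lemma prob_space_cube: "prob_space (cube I)"
  unfolding cube_def by (intro prob_space_PiM prob_space_unit_interval)

definition tensor :: "nat set \<Rightarrow> (nat \<Rightarrow> real \<Rightarrow> real) \<Rightarrow> (nat \<Rightarrow> real) \<Rightarrow> real" where
  "tensor I f y = (\<Prod>j\<in>I. f j (y j))"

lemma tensor_measurable:
  assumes "\<And>j. j \<in> I \<Longrightarrow> f j \<in> borel_measurable unit_interval"
  shows "tensor I f \<in> borel_measurable (cube I)"
  unfolding tensor_def[abs_def] cube_def using assms
  by (intro borel_measurable_prod) (auto intro: measurable_compose[OF measurable_component_singleton])

lemma sq_integrable_unit:
  fixes f :: "real \<Rightarrow> real"
  assumes "sq_integrable unit_interval f"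
  shows "integrable unit_interval f" "integrable unit_interval (\<lambda>x. f x * f x)"
  using unit.integrable_sq[OF assms] integrable_mult_sq[OF assms assms] by auto

lemma sq_integrable_tensor_cube:
  assumes "finite I" "\<And>j. j \<in> I \<Longrightarrow> sq_integrable unit_interval (f j)"
  shows "sq_integrable (cube I) (tensor I f)"
  unfolding sq_integrable_def
proof
  show "tensor I f \<in> borel_measurable (cube I)"
    using assms by (intro tensor_measurable) (auto dest: sq_integrableD)
  have "integrable (cube I) (\<lambda>y. \<Prod>j\<in>I. (\<lambda>x. f j x * f j x) (y j))"
    unfolding cube_def using assms by (intro cubes.product_integrable_prod sq_integrable_unit) auto
  then show "integrable (cube I) (\<lambda>y. (norm (tensor I f y))\<^sup>2)"
    by (simp add: tensor_def power2_eq_square prod.distrib)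
qed

lemma L2_inner_tensor_cube:
  assumes "finite I" "\<And>j. j \<in> I \<Longrightarrow> sq_integrable unit_interval (f j)"
    "\<And>j. j \<in> I \<Longrightarrow> sq_integrable unit_interval (g j)"
  shows "L2_inner (cube I) (tensor I f) (tensor I g) = (\<Prod>j\<in>I. L2_inner unit_interval (f j) (g j))"
proof -
  have "L2_inner (cube I) (tensor I f) (tensor I g) = (LINT y|cube I. (\<Prod>j\<in>I. (\<lambda>x. f j x * g j x) (y j)))"
    by (simp add: L2_inner_def tensor_def prod.distrib)
  also have "\<dots> = (\<Prod>j\<in>I. L2_inner unit_interval (f j) (g j))"
    unfolding cube_def L2_inner_def using assms
    by (intro cubes.product_integral_prod) (auto intro: integrable_mult_sq)
  finally show ?thesis .
qed

lemma integral_tensor_cube: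
  assumes "finite I" "\<And>j. j \<in> I \<Longrightarrow> integrable unit_interval (f j)"
  shows "(LINT y|cube I. tensor I f y) = (\<Prod>j\<in>I. LINT x|unit_interval. f j x)"
  unfolding cube_def tensor_def using assms by (intro cubes.product_integral_prod) auto

lemma AE_cube:
  assumes "finite I" "\<And>j. j \<in> I \<Longrightarrow> AE x in unit_interval. P j x"
  shows "AE y in cube I. \<forall>j\<in>I. P j (y j)"
  unfolding cube_def
proof (rule AE_finite_allI[OF assms(1)])
  fix j assume "j \<in> I"
  then show "AE y in PiM I (\<lambda>_. unit_interval). P j (y j)"
    by (intro AE_PiM_component prob_space_unit_interval assms(2))
qed

lemma tensor_bound:
  assumes "finite I" "\<And>j. j \<in> I \<Longrightarrow> AE x in unit_interval. \<bar>f j x\<bar> \<le> C"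
  shows "AE y in cube I. \<bar>tensor I f y\<bar> \<le> C ^ card I"
proof -
  have "AE y in cube I. \<forall>j\<in>I. \<bar>f j (y j)\<bar> \<le> C" by (rule AE_cube[OF assms])
  then show ?thesis
  proof eventually_elim
    case (elim y)
    have "\<bar>tensor I f y\<bar> = (\<Prod>j\<in>I. \<bar>f j (y j)\<bar>)" by (simp add: tensor_def abs_prod)
    also have "\<dots> \<le> (\<Prod>j\<in>I. C)" using elim by (intro prod_mono) auto
    finally show ?case by simp
  qed
qed

lemma tensor_nonneg:
  assumes "finite I" "\<And>j. j \<in> I \<Longrightarrow> AE x in unit_interval. 0 \<le> f j x"
  shows "AE y in cube I. 0 \<le> tensor I f y"
proof -
  have "AE y in cube I. \<forall>j\<in>I. 0 \<le> f j (y j)" by (rule AE_cube[OF assms])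
  then show ?thesis by eventually_elim (auto simp: tensor_def intro: prod_nonneg)
qed

text \<open>For each \<open>k\<close> the product of the functions \<open>d j\<close> below, each orthogonal to a different
  competitor \<open>f (l j) j\<close>, is orthogonal to all tensors except the \<open>k\<close>-th.\<close>

lemma tensor_coefficient_bound:
  assumes I: "finite I" and card: "card I = m - 1" and k: "k < m" and \<mu>: "0 \<le> \<mu>" "\<mu> < 1"
    and sq: "\<And>i j. i < m \<Longrightarrow> j \<in> I \<Longrightarrow> sq_integrable unit_interval (f i j)"
    and ge1: "\<And>i j. i < m \<Longrightarrow> j \<in> I \<Longrightarrow> 1 \<le> L2_norm unit_interval (f i j)"
    and inc: "\<And>j. j \<in> I \<Longrightarrow> incoherent \<mu> unit_interval m (\<lambda>i. f i j)"
  shows "(1 - \<mu>) ^ (m - 1) * (c k)\<^sup>2 \<le> (L2_norm (cube I) (\<lambda>y. \<Sum>i<m. c i * tensor I (f i) y))\<^sup>2"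
proof -
  let ?U = unit_interval
  have "card I = card ({..<m} - {k})" using card k by simp
  \<comment> \<open>There are as many coordinates in \<open>I\<close> as competitors of
    \<open>k\<close>, so each competitor gets a coordinate of its own.\<close>
  then obtain l where l: "bij_betw l I ({..<m} - {k})"
    using finite_same_card_bij[OF I] by blast
  have lm: "l j < m" "l j \<noteq> k" if "j \<in> I" for j using bij_betwE[OF l] that by auto
  \<comment> \<open>\<open>b j\<close> is the Gram-Schmidt coefficient, so \<open>d j\<close> is the
    part of \<open>f k j\<close> orthogonal to the competitor assigned to \<open>j\<close>.\<close>
  define b where "b j = L2_inner ?U (f k j) (f (l j) j) / (L2_norm ?U (f (l j) j))\<^sup>2" for j
  define d where "d j x = f k j x - b j * f (l j) j x" for j x
  define n where "n j = L2_inner ?U (d j) (f k j)" for j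
  have sqd: "sq_integrable ?U (d j)" if "j \<in> I" for j
    unfolding d_def[abs_def] using sq lm[OF that] k that by (intro sq_integrable_diff sq_integrable_cmult) auto
  have d_inner: "L2_inner ?U (d j) g = L2_inner ?U (f k j) g - b j * L2_inner ?U (f (l j) j) g"
    if "j \<in> I" "sq_integrable ?U g" for j g
    unfolding d_def[abs_def] using sq lm[OF that(1)] k that
    by (subst L2_inner_diff_left) (auto intro: sq_integrable_cmult simp: L2_inner_cmult_left)
  have orth: "L2_inner ?U (d j) (f (l j) j) = 0" if j: "j \<in> I" for j
    using ge1[OF lm(1)[OF j] j] by (subst d_inner[OF j sq[OF lm(1)[OF j] j]]) (simp add: b_def L2_inner_self)
  have self: "L2_inner ?U (d j) (d j) = n j" if j: "j \<in> I" for j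
  proof -
    have "L2_inner ?U (d j) (d j) = L2_inner ?U (d j) (f k j) - L2_inner ?U (d j) (\<lambda>x. b j * f (l j) j x)"
      using sq lm[OF j] k j sqd[OF j]
      by (subst (2) d_def[abs_def]) (intro L2_inner_diff_right sq_integrable_cmult, auto)
    then show ?thesis by (simp add: L2_inner_cmult_right orth[OF j] n_def)
  qed
  \<comment> \<open>Incoherence leaves at least the fraction \<open>1 - \<mu>^2\<close> of the
    squared norm of \<open>f k j\<close>. That norm is at least 1, and \<open>1 - \<mu>^2\<close> is
    at least \<open>1 - \<mu>\<close>.\<close>
  have n_ge: "1 - \<mu> \<le> n j" if j: "j \<in> I" for j
  proof -
    let ?p = "L2_norm ?U (f k j)" and ?r = "L2_norm ?U (f (l j) j)" and ?i = "L2_inner ?U (f k j) (f (l j) j)"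
    have p1: "1 \<le> ?p" and r1: "1 \<le> ?r" using ge1 k lm[OF j] j by auto
    have "\<bar>?i\<bar> \<le> \<mu> * ?p * ?r"
      using inc[OF j] k lm[OF j] unfolding incoherent_def by blast
    then have "?i\<^sup>2 \<le> (\<mu> * ?p * ?r)\<^sup>2" by (metis abs_ge_zero power2_abs power_mono)
    then have "?i\<^sup>2 / ?r\<^sup>2 \<le> (\<mu> * ?p)\<^sup>2" using r1 by (simp add: divide_le_eq power_mult_distrib)
    moreover have "n j = ?p\<^sup>2 - ?i\<^sup>2 / ?r\<^sup>2"
      unfolding n_def using d_inner[OF j sq[OF k j]]
      by (simp add: L2_inner_self b_def L2_inner_commute[of ?U "f (l j) j"] power2_eq_square)
    ultimately have "?p\<^sup>2 * (1 - \<mu>\<^sup>2) \<le> n j" by (simp add: power_mult_distrib algebra_simps)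
    moreover have "1 * (1 - \<mu>) \<le> ?p\<^sup>2 * (1 - \<mu>\<^sup>2)"
      using p1 \<mu> mult_left_mono[of \<mu> 1 \<mu>] by (intro mult_mono) (auto simp: power2_eq_square mult_le_one intro: order_trans[OF p1])
    ultimately show ?thesis by simp
  qed
  define P where "P = (\<Prod>j\<in>I. n j)"
  define D where "D = tensor I d"
  define v where "v = (\<lambda>y. \<Sum>i<m. c i * tensor I (f i) y)"
  have sqD: "sq_integrable (cube I) D" unfolding D_def by (intro sq_integrable_tensor_cube I sqd)
  have sqT: "sq_integrable (cube I) (tensor I (f i))" if "i < m" for i
    by (intro sq_integrable_tensor_cube I sq that)
  have sqv: "sq_integrable (cube I) v"
    unfolding v_def by (intro sq_integrable_sum sq_integrable_cmult sqT) auto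
  have D_inner: "L2_inner (cube I) D (tensor I (f i)) = (if i = k then P else 0)" if i: "i < m" for i
  proof -
    have "L2_inner (cube I) D (tensor I (f i)) = (\<Prod>j\<in>I. L2_inner ?U (d j) (f i j))"
      unfolding D_def by (intro L2_inner_tensor_cube I sqd sq i)
    also have "\<dots> = (if i = k then P else 0)"
    proof (cases "i = k")
      case False
      then obtain j where j: "j \<in> I" "l j = i" using l i unfolding bij_betw_def by (metis DiffI imageE lessThan_iff singletonD)
      then show ?thesis using orth[of j] False I by (auto intro!: prod_zero bexI[of _ j])
    qed (simp add: P_def n_def)
    finally show ?thesis .
  qed
  have Dv: "L2_inner (cube I) D v = c k * P"
  proof -
    have "L2_inner (cube I) D v = (\<Sum>i<m. c i * L2_inner (cube I) D (tensor I (f i)))"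
      unfolding v_def by (rule L2_inner_sum_right) (auto intro: sqT sqD)
    also have "\<dots> = (\<Sum>i<m. if i = k then c i * P else 0)" by (rule sum.cong) (auto simp: D_inner)
    finally show ?thesis using k by simp
  qed
  have "(L2_norm (cube I) D)\<^sup>2 = (\<Prod>j\<in>I. L2_inner ?U (d j) (d j))"
    unfolding L2_inner_self[symmetric] D_def by (intro L2_inner_tensor_cube I sqd)
  then have DP: "(L2_norm (cube I) D)\<^sup>2 = P" by (simp add: P_def self)
  have "(\<Prod>j\<in>I. 1 - \<mu>) \<le> P" unfolding P_def using n_ge \<mu> by (intro prod_mono) auto
  then have P_ge: "(1 - \<mu>) ^ (m - 1) \<le> P" by (simp add: card)
  then have P0: "0 < P" using \<mu> zero_less_power[of "1 - \<mu>" "m - 1"] by linarith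
  \<comment> \<open>The test function \<open>D\<close> has inner product \<open>c k * P\<close> with
    \<open>v\<close> and squared norm \<open>P\<close>, so Cauchy-Schwarz loses a single factor
    \<open>P\<close>.\<close>
  have "\<bar>c k * P\<bar> \<le> L2_norm (cube I) D * L2_norm (cube I) v"
    using L2_Cauchy_Schwarz[OF sqD sqv] unfolding Dv .
  then have "\<bar>c k * P\<bar>\<^sup>2 \<le> (L2_norm (cube I) D * L2_norm (cube I) v)\<^sup>2" by (intro power_mono) auto
  then have "P * (P * (c k)\<^sup>2) \<le> P * (L2_norm (cube I) v)\<^sup>2"
    unfolding power_mult_distrib DP by (simp add: power_mult_distrib power2_eq_square mult_ac)
  then have "P * (c k)\<^sup>2 \<le> (L2_norm (cube I) v)\<^sup>2" unfolding mult_le_cancel_left_pos[OF P0] .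
  moreover have "(1 - \<mu>) ^ (m - 1) * (c k)\<^sup>2 \<le> P * (c k)\<^sup>2" using P_ge by (intro mult_right_mono) auto
  ultimately show ?thesis unfolding v_def by linarith
qed

text \<open>Expand the squared norm; by incoherence and the inequality of arithmetic and geometric
  means, the cross term is at most \<open>\<mu>\<close> times the diagonal terms.\<close>

lemma incoherent_pair_bound:
  assumes inc: "incoherent \<mu> M 2 u" and sq: "\<And>i. i < 2 \<Longrightarrow> sq_integrable M (u i)"
    and ge1: "\<And>i. i < 2 \<Longrightarrow> 1 \<le> L2_norm M (u i)" and \<mu>: "0 \<le> \<mu>" "\<mu> < 1"
  shows "(1 - \<mu>) * (\<Sum>i<2. (c i)\<^sup>2) \<le> (L2_norm M (\<lambda>y. \<Sum>i<2. c i * u i y))\<^sup>2"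
proof -
  let ?v = "\<lambda>y. \<Sum>i<2. c i * u i y"
  define p r i where "p = L2_norm M (u 0)" "r = L2_norm M (u 1)" "i = L2_inner M (u 0) (u 1)"
  have p1: "1 \<le> p" "1 \<le> r" using ge1[of 0] ge1[of 1] by (auto simp: p_r_i_def)
  have ile: "\<bar>i\<bar> \<le> \<mu> * p * r" using inc by (auto simp: incoherent_def p_r_i_def)
  have sqv: "sq_integrable M ?v" by (intro sq_integrable_sum sq_integrable_cmult sq) auto
  have "(L2_norm M ?v)\<^sup>2 = L2_inner M ?v ?v" by (simp add: L2_inner_self)
  also have "\<dots> = (\<Sum>k<2. c k * L2_inner M (u k) ?v)" by (rule L2_inner_sum_left) (auto intro: sq sqv)
  also have "\<dots> = (\<Sum>k<2. c k * (\<Sum>l<2. c l * L2_inner M (u k) (u l)))"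
    by (intro sum.cong refl arg_cong[where f = "(*) _"] L2_inner_sum_right sq) auto
  also have "\<dots> = (c 0 * p)\<^sup>2 + (c 1 * r)\<^sup>2 + 2 * (c 0 * c 1 * i)"
    by (simp add: numeral_2_eq_2 L2_inner_self p_r_i_def L2_inner_commute[of M "u (Suc 0)" "u 0"]
        power2_eq_square algebra_simps)
  finally have eq: "(L2_norm M ?v)\<^sup>2 = (c 0 * p)\<^sup>2 + (c 1 * r)\<^sup>2 + 2 * (c 0 * c 1 * i)" .
  have "\<bar>c 0 * c 1 * i\<bar> \<le> \<bar>c 0 * c 1\<bar> * (\<mu> * p * r)" unfolding abs_mult[of _ i] using ile by (intro mult_left_mono) auto
  also have "\<dots> = \<mu> * (\<bar>c 0 * p\<bar> * \<bar>c 1 * r\<bar>)" using p1 by (simp add: abs_mult)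
  finally have 1: "\<bar>c 0 * c 1 * i\<bar> \<le> \<mu> * (\<bar>c 0 * p\<bar> * \<bar>c 1 * r\<bar>)" .
  have "2 * (\<bar>c 0 * p\<bar> * \<bar>c 1 * r\<bar>) \<le> (c 0 * p)\<^sup>2 + (c 1 * r)\<^sup>2"
    using sum_squares_bound[of "\<bar>c 0 * p\<bar>" "\<bar>c 1 * r\<bar>"] by simp
  then have 2: "\<mu> * (2 * (\<bar>c 0 * p\<bar> * \<bar>c 1 * r\<bar>)) \<le> \<mu> * ((c 0 * p)\<^sup>2 + (c 1 * r)\<^sup>2)"
    using \<mu> by (intro mult_left_mono) auto
  have lower: "(1 - \<mu>) * ((c 0 * p)\<^sup>2 + (c 1 * r)\<^sup>2) \<le> (L2_norm M ?v)\<^sup>2"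
    unfolding eq using 1 2 by (simp add: algebra_simps)
  have sq_ge: "z\<^sup>2 \<le> (z * t)\<^sup>2" if "1 \<le> t" for z t :: real
    using that mult_left_mono[of 1 "t\<^sup>2" "z\<^sup>2"] by (simp add: power_mult_distrib one_le_power)
  have "(1 - \<mu>) * (\<Sum>i<2. (c i)\<^sup>2) \<le> (1 - \<mu>) * ((c 0 * p)\<^sup>2 + (c 1 * r)\<^sup>2)"
    using \<mu> sq_ge p1 by (intro mult_left_mono) (auto simp: numeral_2_eq_2 intro!: add_mono)
  then show ?thesis using lower by linarith
qed

text \<open>For \<open>m = 2\<close> the general constant \<open>1 / m\<close> would only give \<open>2 \<epsilon> < \<zeta> \<gamma>\<close>, without a margin, when
  \<open>\<mu> = 0\<close>.\<close>

definition gram_const :: "nat \<Rightarrow> real" where "gram_const m = (if m = 2 then 1 else 1 / m)"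

text \<open>In general \<open>tensor_coefficient_bound\<close> is summed over all \<open>m\<close>
  coefficients, which costs the factor \<open>m\<close>. For \<open>m = 2\<close> the tensors depend
  on a single coordinate, where the two functions are incoherent themselves.\<close>

lemma gram_tensor:
  assumes m: "2 \<le> m" and I: "finite I" and card: "card I = m - 1" and \<mu>: "0 \<le> \<mu>" "\<mu> < 1"
    and sq: "\<And>i j. i < m \<Longrightarrow> j \<in> I \<Longrightarrow> sq_integrable unit_interval (f i j)"
    and ge1: "\<And>i j. i < m \<Longrightarrow> j \<in> I \<Longrightarrow> 1 \<le> L2_norm unit_interval (f i j)"
    and inc: "\<And>j. j \<in> I \<Longrightarrow> incoherent \<mu> unit_interval m (\<lambda>i. f i j)"
  shows "gram_const m * (1 - \<mu>) ^ (m - 1) * (\<Sum>i<m. (c i)\<^sup>2)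
    \<le> (L2_norm (cube I) (\<lambda>y. \<Sum>i<m. c i * tensor I (f i) y))\<^sup>2" (is "_ \<le> ?v")
proof (cases "m = 2")
  case True
  then obtain j where j: "I = {j}" using card by (metis card_1_singletonE diff_add_inverse one_add_one)
  have sqT: "sq_integrable (cube I) (tensor I (f i))" if "i < m" for i
    by (intro sq_integrable_tensor_cube I sq that)
  have inner: "L2_inner (cube I) (tensor I (f i)) (tensor I (f k)) = L2_inner unit_interval (f i j) (f k j)"
    if "i < m" "k < m" for i k
    using L2_inner_tensor_cube[OF I, of "f i" "f k"] sq that j by simp
  have norm: "L2_norm (cube I) (tensor I (f i)) = L2_norm unit_interval (f i j)" if "i < m" for i
    using inner[OF that that] unfolding L2_inner_self by (rule power2_eq_imp_eq) (rule L2_norm_nonneg)+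
  have "(1 - \<mu>) * (\<Sum>i<2. (c i)\<^sup>2) \<le> (L2_norm (cube I) (\<lambda>y. \<Sum>i<2. c i * tensor I (f i) y))\<^sup>2"
  proof (rule incoherent_pair_bound[OF _ _ _ \<mu>])
    show "incoherent \<mu> (cube I) 2 (\<lambda>i. tensor I (f i))"
      unfolding incoherent_def
    proof (intro allI impI)
      fix k k' :: nat assume k: "k < 2" "k' < 2" "k \<noteq> k'"
      then have km: "k < m" "k' < m" using True by auto
      show "\<bar>L2_inner (cube I) (tensor I (f k)) (tensor I (f k'))\<bar>
        \<le> \<mu> * L2_norm (cube I) (tensor I (f k)) * L2_norm (cube I) (tensor I (f k'))"
        unfolding inner[OF km] norm[OF km(1)] norm[OF km(2)]
        using inc[of j] j k(3) km unfolding incoherent_def by blast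
    qed
  qed (use True sqT norm ge1 j in auto)
  then show ?thesis using True by (simp add: gram_const_def)
next
  case False
  have "(\<Sum>i<m. (1 - \<mu>) ^ (m - 1) * (c i)\<^sup>2) \<le> (\<Sum>i<m. ?v)"
    using assms by (intro sum_mono tensor_coefficient_bound) auto
  then have "(1 - \<mu>) ^ (m - 1) * (\<Sum>i<m. (c i)\<^sup>2) \<le> m * ?v" by (simp add: sum_distrib_left)
  then show ?thesis using False m by (simp add: gram_const_def field_simps)
qed

section \<open>Measure-preserving identifications of the cubes\<close>

lemma sq_integrable_transfer:
  fixes f :: "'b \<Rightarrow> 'c::{banach, second_countable_topology}"
  assumes T: "T \<in> P \<rightarrow>\<^sub>M Q" "distr P Q T = Q" and f: "f \<in> borel_measurable Q"
  shows "sq_integrable P (\<lambda>p. f (T p)) \<longleftrightarrow> sq_integrable Q f" "L2_norm P (\<lambda>p. f (T p)) = L2_norm Q f"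
proof -
  have m2: "(\<lambda>x. (norm (f x))\<^sup>2) \<in> borel_measurable Q" using f by measurable
  have "integrable P (\<lambda>p. (norm (f (T p)))\<^sup>2) \<longleftrightarrow> integrable Q (\<lambda>x. (norm (f x))\<^sup>2)"
    using integrable_distr_eq[OF T(1) m2] T(2) by simp
  moreover have "(\<lambda>p. f (T p)) \<in> borel_measurable P" using T(1) f by (rule measurable_compose)
  ultimately show "sq_integrable P (\<lambda>p. f (T p)) \<longleftrightarrow> sq_integrable Q f" using f by (simp add: sq_integrable_def)
  show "L2_norm P (\<lambda>p. f (T p)) = L2_norm Q f"
    using integral_distr[OF T(1) m2] T(2) by (simp add: L2_norm_def)
qed

lemma cube_insert_first:
  fixes i :: nat
  assumes "i \<notin> I"
  shows "(\<lambda>(x, y). y(i := x)) \<in> unit_interval \<Otimes>\<^sub>M cube I \<rightarrow>\<^sub>M cube (insert i I)"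
    and "distr (unit_interval \<Otimes>\<^sub>M cube I) (cube (insert i I)) (\<lambda>(x, y). y(i := x)) = cube (insert i I)"
proof -
  show m: "(\<lambda>(x, y). y(i := x)) \<in> unit_interval \<Otimes>\<^sub>M cube I \<rightarrow>\<^sub>M cube (insert i I)"
    unfolding cube_def case_prod_unfold
    by (rule measurable_fun_upd[OF _ measurable_snd measurable_fst]) simp
  show "distr (unit_interval \<Otimes>\<^sub>M cube I) (cube (insert i I)) (\<lambda>(x, y). y(i := x)) = cube (insert i I)"
    unfolding cube_def by (rule distr_pair_PiM_eq_PiM[where M = "\<lambda>_. unit_interval"]) (auto intro: prob_space_unit_interval assms)
qed

text \<open>The map is a composite of measure-preserving ones: merge the first two blocks, swap, and
  insert the last coordinate.\<close>

lemma cube_merge_last: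
  fixes i :: nat
  assumes "finite I" "finite J" "I \<inter> J = {}" "i \<notin> I \<union> J"
  defines "P \<equiv> (cube I \<Otimes>\<^sub>M cube J) \<Otimes>\<^sub>M unit_interval"
    and "T \<equiv> \<lambda>(p, x). (merge I J p)(i := x)"
  shows "T \<in> P \<rightarrow>\<^sub>M cube (insert i (I \<union> J))" "distr P (cube (insert i (I \<union> J))) T = cube (insert i (I \<union> J))"
proof -
  let ?K = "I \<union> J" and ?U = unit_interval
  interpret K: prob_space "cube ?K" by (rule prob_space_cube)
  interpret IJ: pair_prob_space "cube I" "cube J" by (intro pair_prob_space.intro pair_sigma_finite.intro prob_space_cube prob_space_imp_sigma_finite)
  interpret KU: pair_prob_space "cube ?K" ?U by (intro pair_prob_space.intro pair_sigma_finite.intro prob_space_cube prob_space_unit_interval prob_space_imp_sigma_finite)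
  interpret UK: pair_prob_space ?U "cube ?K" by (intro pair_prob_space.intro pair_sigma_finite.intro prob_space_cube prob_space_unit_interval prob_space_imp_sigma_finite)
  have mm: "merge I J \<in> cube I \<Otimes>\<^sub>M cube J \<rightarrow>\<^sub>M cube ?K" unfolding cube_def by simp
  have dm: "distr (cube I \<Otimes>\<^sub>M cube J) (cube ?K) (merge I J) = cube ?K"
    unfolding cube_def using assms by (intro cubes.distr_merge) auto
  have d1: "distr P (cube ?K \<Otimes>\<^sub>M ?U) (\<lambda>(p, x). (merge I J p, x)) = cube ?K \<Otimes>\<^sub>M ?U"
  proof -
    have "distr (cube I \<Otimes>\<^sub>M cube J) (cube ?K) (merge I J) \<Otimes>\<^sub>M distr ?U ?U (\<lambda>x. x)
      = distr P (cube ?K \<Otimes>\<^sub>M ?U) (\<lambda>(p, x). (merge I J p, x))"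
      unfolding P_def by (rule pair_measure_distr[OF mm]) (auto simp: unit.sigma_finite_measure_axioms)
    then show ?thesis by (simp add: dm)
  qed
  have m1: "(\<lambda>(p, x). (merge I J p, x)) \<in> P \<rightarrow>\<^sub>M cube ?K \<Otimes>\<^sub>M ?U" unfolding P_def using mm by measurable
  have m2: "(\<lambda>(y, x). (x, y)) \<in> cube ?K \<Otimes>\<^sub>M ?U \<rightarrow>\<^sub>M ?U \<Otimes>\<^sub>M cube ?K" by measurable
  have d2: "distr (cube ?K \<Otimes>\<^sub>M ?U) (?U \<Otimes>\<^sub>M cube ?K) (\<lambda>(y, x). (x, y)) = ?U \<Otimes>\<^sub>M cube ?K"
    using UK.distr_pair_swap by simp
  note c = cube_insert_first[OF assms(4)]
  have T: "T = (\<lambda>(x, y). y(i := x)) \<circ> ((\<lambda>(y, x). (x, y)) \<circ> (\<lambda>(p, x). (merge I J p, x)))"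
    by (auto simp: T_def)
  show "T \<in> P \<rightarrow>\<^sub>M cube (insert i ?K)"
    unfolding T by (intro measurable_comp[OF _ c(1)] measurable_comp[OF m1 m2])
  show "distr P (cube (insert i ?K)) T = cube (insert i ?K)"
    unfolding T
    by (subst distr_distr[symmetric, OF c(1) measurable_comp[OF m1 m2]], subst distr_distr[symmetric, OF m2 m1])
       (simp add: d1 d2 c(2))
qed

section \<open>Integrating out the last coordinate\<close>

context pair_prob_space
begin

text \<open>Multiplying by a weight between 0 and 1 and integrating over a probability space both
  contract the L2 norm, so the error stays at most \<open>\<epsilon>\<close>. The weight 1 gives the
  kernel \<open>T_plus\<close>, the indicator of \<open>A\<close> the kernel behind
  \<open>eta\<close>.\<close>

lemma weighted_partial_integral:
  fixes F :: "'a \<times> 'b \<Rightarrow> real"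
  assumes F: "sq_integrable (M1 \<Otimes>\<^sub>M M2) F" and g: "\<And>k. k < m \<Longrightarrow> sq_integrable M1 (g k)"
    and f: "\<And>k. k < m \<Longrightarrow> sq_integrable M2 (f k)"
    and close: "L2_norm (M1 \<Otimes>\<^sub>M M2) (\<lambda>(p, x). F (p, x) - (\<Sum>k<m. g k p * f k x)) \<le> \<epsilon>"
    and b: "b \<in> borel_measurable M2" "\<And>x. 0 \<le> b x" "\<And>x. b x \<le> 1"
  shows "sq_integrable (M1 \<Otimes>\<^sub>M M2) (\<lambda>(p, x). b x * F (p, x))"
    "sq_integrable M1 (\<lambda>p. LINT x|M2. b x * F (p, x))"
    "L2_norm M1 (\<lambda>p. (LINT x|M2. b x * F (p, x)) - (\<Sum>k<m. g k p * (LINT x|M2. b x * f k x))) \<le> \<epsilon>"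
proof -
  let ?P = "M1 \<Otimes>\<^sub>M M2"
  define E where "E = (\<lambda>(p, x). \<Sum>k<m. g k p * f k x)"
  have E_alt: "E = (\<lambda>z. \<Sum>k<m. (case z of (p, x) \<Rightarrow> g k p * f k x))" by (auto simp: E_def)
  have sqE: "sq_integrable ?P E" unfolding E_alt by (intro sq_integrable_sum sq_integrable_tensor g f) auto
  have weight: "sq_integrable ?P (\<lambda>z. b (snd z) * h z)" "L2_norm ?P (\<lambda>z. b (snd z) * h z) \<le> L2_norm ?P h"
    if h: "sq_integrable ?P h" for h
  proof -
    note [measurable] = sq_integrableD(1)[OF h] b(1)
    have meas: "(\<lambda>z. b (snd z) * h z) \<in> borel_measurable ?P" by measurable
    have le: "norm (b (snd z) * h z) \<le> norm (h z)" for z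
      using b(2,3)[of "snd z"] by (simp add: abs_mult mult_left_le_one_le)
    have le2: "(norm (b (snd z) * h z))\<^sup>2 \<le> (norm (h z))\<^sup>2" for z by (rule power_mono[OF le norm_ge_zero])
    show "sq_integrable ?P (\<lambda>z. b (snd z) * h z)"
      unfolding sq_integrable_def
    proof (intro conjI meas Bochner_Integration.integrable_bound[OF sq_integrableD(2)[OF h]])
      show "(\<lambda>z. (norm (b (snd z) * h z))\<^sup>2) \<in> borel_measurable ?P" by measurable
      show "AE z in ?P. norm ((norm (b (snd z) * h z))\<^sup>2) \<le> norm ((norm (h z))\<^sup>2)"
        using le2 by simp
    qed
    show "L2_norm ?P (\<lambda>z. b (snd z) * h z) \<le> L2_norm ?P h"
      by (rule L2_norm_mono[OF h meas]) (simp only: le AE_I2)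
  qed
  show s1: "sq_integrable ?P (\<lambda>(p, x). b x * F (p, x))"
    using weight(1)[OF F] by (simp add: case_prod_unfold)
  show s2: "sq_integrable M1 (\<lambda>p. LINT x|M2. b x * F (p, x))"
    using partial_integral_L2(1)[OF s1] by simp
  define d where "d = (\<lambda>z. b (snd z) * (F z - E z))"
  have sqd: "sq_integrable ?P d" unfolding d_def by (intro weight(1) sq_integrable_diff F sqE)
  have dle: "L2_norm ?P d \<le> \<epsilon>"
    using weight(2)[OF sq_integrable_diff[OF F sqE]] close
    by (simp add: d_def E_def case_prod_unfold)
  have int1: "integrable ?P (\<lambda>z. b (snd z) * F z)" by (rule integrable_sq[OF weight(1)[OF F]])
  \<comment> \<open>The fibre of \<open>F\<close> over \<open>p\<close> is integrable only for
    almost every \<open>p\<close>, so the integral splits only almost everywhere.\<close>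
  have eq: "AE p in M1. (LINT x|M2. d (p, x))
    = (LINT x|M2. b x * F (p, x)) - (\<Sum>k<m. g k p * (LINT x|M2. b x * f k x))"
    using AE_integrable_fst'[OF int1]
  proof eventually_elim
    case (elim p)
    have bf: "integrable M2 (\<lambda>x. b x * f k x)" if "k < m" for k
      using b f[OF that] M2.integrable_sq[OF f[OF that]]
      by (intro Bochner_Integration.integrable_bound[OF M2.integrable_sq[OF f[OF that]]])
         (auto simp: abs_mult mult_left_le_one_le dest: sq_integrableD)
    have "(LINT x|M2. d (p, x)) = (LINT x|M2. b x * F (p, x) - (\<Sum>k<m. g k p * (b x * f k x)))"
      by (simp add: d_def E_def right_diff_distrib sum_distrib_left mult_ac)
    also have "\<dots> = (LINT x|M2. b x * F (p, x)) - (LINT x|M2. (\<Sum>k<m. g k p * (b x * f k x)))"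
      using elim bf by (intro Bochner_Integration.integral_diff Bochner_Integration.integrable_sum integrable_mult_right) auto
    also have "(LINT x|M2. (\<Sum>k<m. g k p * (b x * f k x))) = (\<Sum>k<m. LINT x|M2. g k p * (b x * f k x))"
      using bf by (intro Bochner_Integration.integral_sum integrable_mult_right) auto
    finally show ?case by simp
  qed
  have "L2_norm M1 (\<lambda>p. (LINT x|M2. b x * F (p, x)) - (\<Sum>k<m. g k p * (LINT x|M2. b x * f k x)))
    \<le> L2_norm M1 (\<lambda>p. LINT x|M2. d (p, x))"
  proof (rule L2_norm_mono)
    show "sq_integrable M1 (\<lambda>p. LINT x|M2. d (p, x))" by (rule partial_integral_L2(1)[OF sqd])
    have "sq_integrable M1 (\<lambda>p. (LINT x|M2. b x * F (p, x)) - (\<Sum>k<m. (LINT x|M2. b x * f k x) * g k p))"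
      by (intro sq_integrable_diff s2 sq_integrable_sum sq_integrable_cmult g) auto
    then show "(\<lambda>p. (LINT x|M2. b x * F (p, x)) - (\<Sum>k<m. g k p * (LINT x|M2. b x * f k x))) \<in> borel_measurable M1"
      by (auto dest: sq_integrableD simp: mult.commute)
    show "AE p in M1. norm ((LINT x|M2. b x * F (p, x)) - (\<Sum>k<m. g k p * (LINT x|M2. b x * f k x)))
      \<le> norm (LINT x|M2. d (p, x))"
      using eq by eventually_elim simp
  qed
  also have "\<dots> \<le> \<epsilon>" using partial_integral_L2(2)[OF sqd] dle by linarith
  finally show "L2_norm M1 (\<lambda>p. (LINT x|M2. b x * F (p, x)) - (\<Sum>k<m. g k p * (LINT x|M2. b x * f k x))) \<le> \<epsilon>" .
qed

end

section \<open>The recovery algorithm\<close>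

lemma eigenvector_mat_iff:
  fixes \<eta> :: "nat \<Rightarrow> nat \<Rightarrow> complex"
  shows "eigenvector (mat m m (\<lambda>(l, t). \<eta> l t)) v b \<longleftrightarrow>
    v \<in> carrier_vec m \<and> (\<exists>j<m. vec_index v j \<noteq> 0) \<and>
    (\<forall>l<m. (\<Sum>t<m. \<eta> l t * vec_index v t) = b * vec_index v l)"
proof (cases "v \<in> carrier_vec m")
  case True
  have "v \<noteq> 0\<^sub>v m \<longleftrightarrow> (\<exists>j<m. vec_index v j \<noteq> 0)"
    using True by (metis carrier_vecD eq_vecI index_zero_vec)
  moreover have "mat m m (\<lambda>(l, t). \<eta> l t) *\<^sub>v v = b \<cdot>\<^sub>v v \<longleftrightarrow>
    (\<forall>l<m. (\<Sum>t<m. \<eta> l t * vec_index v t) = b * vec_index v l)"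
    using True by (auto simp: vec_eq_iff scalar_prod_def lessThan_atLeast0)
  ultimately show ?thesis using True by (simp add: eigenvector_def)
qed (simp add: eigenvector_def)

text \<open>Fubini, in the order of integration used by \<open>eta\<close>: it identifies the
  iterated integral with the bilinear form of the partially integrated kernel, so that
  \<open>kernel_form_close\<close> applies to the entries of \<open>eta\<close>.\<close>

lemma triple_integral_form:
  fixes F :: "('a \<times> 'b) \<times> 'c \<Rightarrow> real"
  assumes prob: "prob_space M" "prob_space N" "prob_space U"
    and F: "sq_integrable ((M \<Otimes>\<^sub>M N) \<Otimes>\<^sub>M U) F"
    and b: "b \<in> borel_measurable U" and bF: "sq_integrable ((M \<Otimes>\<^sub>M N) \<Otimes>\<^sub>M U) (\<lambda>(p, x). b x * F (p, x))"
    and \<phi>: "sq_integrable M \<phi>" and \<psi>: "sq_integrable N \<psi>"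
  shows "(LINT x|U. b x * (LINT z|N. LINT y|M. \<phi> y * F ((y, z), x) * \<psi> z))
    = L2_inner (M \<Otimes>\<^sub>M N) (\<lambda>p. LINT x|U. b x * F (p, x)) (\<lambda>(y, z). \<phi> y * \<psi> z)"
proof -
  interpret M: prob_space M by fact
  interpret N: prob_space N by fact
  interpret U: prob_space U by fact
  interpret MN: pair_prob_space M N ..
  interpret MNU: pair_prob_space "M \<Otimes>\<^sub>M N" U ..
  note [measurable] = sq_integrableD(1)[OF F] b sq_integrableD(1)[OF \<phi>] sq_integrableD(1)[OF \<psi>]
  define W where "W p x = b x * F (p, x) * (case p of (y, z) \<Rightarrow> \<phi> y * \<psi> z)" for p x
  have one: "sq_integrable U (\<lambda>x. 1 :: real)" by (auto simp: sq_integrable_def)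
  have "integrable ((M \<Otimes>\<^sub>M N) \<Otimes>\<^sub>M U) (\<lambda>z. (case z of (p, x) \<Rightarrow> b x * F (p, x)) *
      (case z of (p, x) \<Rightarrow> (case p of (y, z) \<Rightarrow> \<phi> y * \<psi> z) * 1))"
    by (intro integrable_mult_sq bF MNU.sq_integrable_tensor MN.sq_integrable_tensor \<phi> \<psi> one)
  then have int: "integrable ((M \<Otimes>\<^sub>M N) \<Otimes>\<^sub>M U) (case_prod W)"
    by (simp add: W_def[abs_def] case_prod_unfold)
  have inner: "b x * (LINT z|N. LINT y|M. \<phi> y * F ((y, z), x) * \<psi> z) = (LINT z|N. LINT y|M. W (y, z) x)" for x
    by (simp add: W_def integral_mult_right_zero[symmetric] mult_ac del: integral_mult_right_zero)
  have "(LINT x|U. b x * (LINT z|N. LINT y|M. \<phi> y * F ((y, z), x) * \<psi> z)) = (LINT x|U. LINT p|(M \<Otimes>\<^sub>M N). W p x)"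
    unfolding inner
  proof (rule integral_cong_AE)
    \<comment> \<open>Measurability in \<open>x\<close> of the iterated integral follows from joint
      measurability of the integrand on the product taken in the order \<open>U\<close>,
      \<open>N\<close>, \<open>M\<close>.\<close>
    have "(\<lambda>t. b (fst (fst t)) * F ((snd t, snd (fst t)), fst (fst t)) * (\<phi> (snd t) * \<psi> (snd (fst t))))
      \<in> borel_measurable ((U \<Otimes>\<^sub>M N) \<Otimes>\<^sub>M M)"
      by measurable
    then have m2: "(\<lambda>(x, z). LINT y|M. W (y, z) x) \<in> borel_measurable (U \<Otimes>\<^sub>M N)"
      using M.borel_measurable_lebesgue_integral[of "\<lambda>xz y. W (y, snd xz) (fst xz)" "U \<Otimes>\<^sub>M N"]
      by (simp add: case_prod_unfold W_def)
    show "(\<lambda>x. LINT z|N. LINT y|M. W (y, z) x) \<in> borel_measurable U"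
      using N.borel_measurable_lebesgue_integral[of "\<lambda>x z. LINT y|M. W (y, z) x" U] m2 by simp
    show "(\<lambda>x. LINT p|(M \<Otimes>\<^sub>M N). W p x) \<in> borel_measurable U"
      using borel_measurable_integrable[OF MNU.integrable_snd[OF int]] .
    show "AE x in U. (LINT z|N. LINT y|M. W (y, z) x) = (LINT p|(M \<Otimes>\<^sub>M N). W p x)"
      using MNU.AE_integrable_snd[OF int]
    proof eventually_elim
      case (elim x)
      then have "integrable (M \<Otimes>\<^sub>M N) (\<lambda>(y, z). W (y, z) x)" by (simp add: case_prod_unfold)
      from MN.integral_snd[OF this] show ?case by (simp add: case_prod_unfold)
    qed
  qed
  also have "\<dots> = (LINT p|(M \<Otimes>\<^sub>M N). LINT x|U. W p x)"
    by (rule MNU.Fubini_integral[OF int])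
  also have "\<dots> = L2_inner (M \<Otimes>\<^sub>M N) (\<lambda>p. LINT x|U. b x * F (p, x)) (\<lambda>(y, z). \<phi> y * \<psi> z)"
    by (simp add: L2_inner_def W_def)
  finally show ?thesis .
qed

text \<open>The first marginal of the product density is \<open>f 0\<close>, the other factors
  having mass 1, and integrating out coordinates contracts the L2 norm. For \<open>m = 2\<close> the
  cube integrated over has no coordinates.\<close>

lemma first_marginal_close:
  assumes m: "2 \<le> m"
    and h: "sq_integrable (cube {..<m - 1}) h"
    and f: "\<And>j. j < m - 1 \<Longrightarrow> sq_integrable unit_interval (f j)"
    and f1: "\<And>j. j < m - 1 \<Longrightarrow> (LINT x|unit_interval. f j x) = 1"
  shows "sq_integrable unit_interval (\<lambda>x. first_marginal m h x - complex_of_real (f 0 x))"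
    and "L2_norm unit_interval (\<lambda>x. first_marginal m h x - complex_of_real (f 0 x))
      \<le> L2_norm (cube {..<m - 1}) (\<lambda>y. h y - complex_of_real (tensor {..<m - 1} f y))"
proof -
  let ?I = "{1..<m - 1}" and ?U = unit_interval
  have ins: "insert 0 ?I = {..<m - 1}" using m by auto
  interpret I: prob_space "cube ?I" by (rule prob_space_cube)
  interpret UI: pair_prob_space ?U "cube ?I" ..
  define T :: "real \<times> (nat \<Rightarrow> real) \<Rightarrow> nat \<Rightarrow> real" where "T = (\<lambda>(x, y). y(0 := x))"
  have T: "T \<in> ?U \<Otimes>\<^sub>M cube ?I \<rightarrow>\<^sub>M cube {..<m - 1}"
    "distr (?U \<Otimes>\<^sub>M cube ?I) (cube {..<m - 1}) T = cube {..<m - 1}"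
    using cube_insert_first[of 0 ?I] unfolding ins T_def by auto
  define d where "d = (\<lambda>y. h y - complex_of_real (tensor {..<m - 1} f y))"
  have sqd: "sq_integrable (cube {..<m - 1}) d"
    unfolding d_def by (intro sq_integrable_diff h sq_integrable_of_real sq_integrable_tensor_cube f) auto
  have sqhT: "sq_integrable (?U \<Otimes>\<^sub>M cube ?I) (\<lambda>p. h (T p))"
    using sq_integrable_transfer(1)[OF T sq_integrableD(1)[OF h]] h by simp
  have sqdT: "sq_integrable (?U \<Otimes>\<^sub>M cube ?I) (\<lambda>p. d (T p))"
    using sq_integrable_transfer(1)[OF T sq_integrableD(1)[OF sqd]] sqd by simp
  have fm: "first_marginal m h = (\<lambda>x. LINT y|cube ?I. h (T (x, y)))"
    by (simp add: first_marginal_def[abs_def] T_def)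
  have sqf0: "sq_integrable ?U (f 0)" using f m by simp
  show sq: "sq_integrable ?U (\<lambda>x. first_marginal m h x - complex_of_real (f 0 x))"
    unfolding fm by (intro sq_integrable_diff UI.partial_integral_L2(1)[OF sqhT] sq_integrable_of_real sqf0)
  have tens: "tensor {..<m - 1} f (T (x, y)) = f 0 x * tensor ?I f y" for x y
    unfolding tensor_def ins[symmetric] by (subst prod.insert) (auto simp: T_def)
  have mass: "(LINT y|cube ?I. tensor ?I f y) = 1"
    using f1 f by (subst integral_tensor_cube) (auto intro: sq_integrable_unit)
  have int_t: "integrable (cube ?I) (tensor ?I f)"
    using f by (intro I.integrable_sq sq_integrable_tensor_cube) auto
  have "AE x in ?U. first_marginal m h x - complex_of_real (f 0 x) = (LINT y|cube ?I. d (T (x, y)))"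
    using UI.AE_integrable_fst'[OF UI.integrable_sq[OF sqhT]]
  proof eventually_elim
    case (elim x)
    have "(LINT y|cube ?I. d (T (x, y))) = (LINT y|cube ?I. h (T (x, y)) - complex_of_real (f 0 x * tensor ?I f y))"
      by (simp only: d_def tens)
    also have "\<dots> = (LINT y|cube ?I. h (T (x, y))) - (LINT y|cube ?I. complex_of_real (f 0 x * tensor ?I f y))"
      by (intro Bochner_Integration.integral_diff elim integrable_of_real integrable_mult_right int_t)
    also have "(LINT y|cube ?I. complex_of_real (f 0 x * tensor ?I f y)) = complex_of_real (f 0 x)"
      unfolding integral_complex_of_real by (simp only: mass integral_mult_right_zero mult_1_right)
    finally show ?case by (simp add: fm)
  qed
  then have "L2_norm ?U (\<lambda>x. first_marginal m h x - complex_of_real (f 0 x))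
    \<le> L2_norm ?U (\<lambda>x. LINT y|cube ?I. d (T (x, y)))"
    using sq by (intro L2_norm_mono UI.partial_integral_L2(1)[OF sqdT] sq_integrableD(1)) (auto elim!: eventually_mono)
  also have "\<dots> \<le> L2_norm (?U \<Otimes>\<^sub>M cube ?I) (\<lambda>p. d (T p))" by (rule UI.partial_integral_L2(2)[OF sqdT])
  also have "\<dots> = L2_norm (cube {..<m - 1}) d"
    by (rule sq_integrable_transfer(2)[OF T sq_integrableD(1)[OF sqd]])
  finally show "L2_norm ?U (\<lambda>x. first_marginal m h x - complex_of_real (f 0 x))
    \<le> L2_norm (cube {..<m - 1}) (\<lambda>y. h y - complex_of_real (tensor {..<m - 1} f y))"
    unfolding d_def .
qed

text \<open>The origin of the value of \<open>q\<close>. With \<open>t\<close> as in the proof, for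
  \<open>m = 2\<close> the noise takes at most half of \<open>t\<close>. For
  \<open>m \<ge> 3\<close> the bound \<open>fact (m - 1) \<ge> 2 * m / 3\<close> limits it to three
  quarters of \<open>t / m\<close>, leaving \<open>t / (4 * m)\<close>.\<close>

lemma noise_below_threshold:
  assumes m: "2 \<le> m" and \<mu>: "0 \<le> \<mu>" "\<mu> < 1" and \<zeta>: "0 < \<zeta>"
    and \<epsilon>: "\<epsilon> < \<zeta> * (1 - \<mu>) ^ m / (4 * fact (m - 1))"
  shows "\<zeta> * (1 - \<mu>) ^ m / (4 * m) \<le> \<zeta> * (gram_const m * (1 - \<mu>) ^ (m - 1)) - 2 * \<epsilon>"
proof -
  define t where "t = \<zeta> * (1 - \<mu>) ^ m"
  have t0: "0 < t" using \<mu> \<zeta> by (simp add: t_def)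
  have "(1 - \<mu>) ^ m \<le> (1 - \<mu>) ^ (m - 1)" using \<mu> by (intro power_decreasing) auto
  then have t_le: "t \<le> \<zeta> * (1 - \<mu>) ^ (m - 1)" unfolding t_def using \<zeta> by (intro mult_left_mono) auto
  show ?thesis
  proof (cases "m = 2")
    case True
    then have "\<epsilon> < t / 4" using \<epsilon> by (simp add: t_def)
    moreover have "t \<le> \<zeta> * (gram_const m * (1 - \<mu>) ^ (m - 1))" using t_le True by (simp add: gram_const_def)
    moreover have "t / (4 * m) \<le> t / 2" using t0 True by (intro divide_left_mono) auto
    ultimately show ?thesis unfolding t_def[symmetric] by linarith
  next
    case False
    then have m3: "3 \<le> m" using m by simp
    have "m - 1 \<le> fact (m - 1)" by (rule fact_ge_self)
    then have "real m - 1 \<le> real (fact (m - 1))" using m3 by linarith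
    then have fact_ge: "2 * real m / 3 \<le> fact (m - 1)" using m3 by (simp add: field_simps)
    have "\<epsilon> < t / (4 * fact (m - 1))" using \<epsilon> by (simp add: t_def)
    also have "\<dots> \<le> t / (4 * (2 * real m / 3))" using t0 m3 fact_ge by (intro divide_left_mono) auto
    finally have "2 * \<epsilon> \<le> 3 / 4 * (t / m)" by (simp add: field_simps)
    moreover have "t / m \<le> \<zeta> * (gram_const m * (1 - \<mu>) ^ (m - 1))"
      using divide_right_mono[OF t_le, of "real m"] False by (simp add: gram_const_def)
    moreover have "t / (4 * m) = 1 / 4 * (t / m)" by simp
    ultimately show ?thesis unfolding t_def[symmetric] by linarith
  qed
qed

text \<open>This supplies the lower bound on the component norms that the Gram estimates
  use.\<close>

lemma prob_density_L2_norm_ge1: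
  assumes "prob_density unit_interval f" "sq_integrable unit_interval f"
  shows "1 \<le> L2_norm unit_interval f"
proof -
  have "(LINT x|unit_interval. f x) \<le> L1_norm unit_interval f"
    unfolding L1_norm_def using assms(1)
    by (intro integral_mono) (auto simp: prob_density_def)
  also have "\<dots> \<le> L2_norm unit_interval f" by (rule unit.L1_norm_le_L2_norm[OF assms(2)])
  finally show ?thesis using assms(1) by (simp add: prob_density_def)
qed

lemma prob_density_bound_ge1:
  assumes "prob_density unit_interval f" "AE x in unit_interval. \<bar>f x\<bar> \<le> C"
  shows "1 \<le> C"
proof -
  have "(LINT x|unit_interval. f x) \<le> (LINT x|unit_interval. C)"
    using assms by (intro integral_mono_AE) (auto simp: prob_density_def)
  then show ?thesis using assms(1) unit.prob_space by (simp add: prob_density_def)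
qed

text \<open>Instantiates the abstract perturbation argument with the cubes, and passes from the
  error of \<open>h_hat\<close> to that of its first marginal.\<close>

lemma recovery_estimate:
  assumes m: "2 \<le> m" and \<mu>: "0 \<le> \<mu>" "\<mu> < 1" and \<zeta>: "0 < \<zeta>" and \<delta>: "0 < \<delta>"
    and weights: "mixture_weights m \<pi>"
    and dens: "\<And>k j. k < m \<Longrightarrow> j < 2 * m - 1 \<Longrightarrow> prob_density unit_interval (fc k j)"
    and est: "estimable \<mu> \<zeta> m \<pi> fc"
    and bound: "\<And>k j. k < m \<Longrightarrow> j < 2 * m - 1 \<Longrightarrow> AE x in unit_interval. \<bar>fc k j x\<bar> \<le> C"
    and A: "A \<subseteq> {0..1}" "A \<in> sets lebesgue"
    and gap: "\<And>k k'. k < m \<Longrightarrow> k' < m \<Longrightarrow> k \<noteq> k' \<Longrightarrow>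
      \<delta> \<le> \<bar>(LINT x:A|unit_interval. fc k (2 * m - 2) x) - (LINT x:A|unit_interval. fc k' (2 * m - 2) x)\<bar>"
    and fhat: "sq_integrable (cube {..<2 * m - 1}) fhat"
    and close: "L2_norm (cube {..<2 * m - 1}) (\<lambda>x. fhat x - mixture m \<pi> fc x) \<le> \<epsilon>"
    and small: "\<epsilon> < \<zeta> * (1 - \<mu>) ^ m / (4 * fact (m - 1))"
    and out: "recovery_output m fhat A out"
  shows "\<exists>\<sigma>. \<sigma> permutes {..<m} \<and> (\<forall>k<m.
    sq_integrable unit_interval (\<lambda>x. out k x - complex_of_real (fc (\<sigma> k) 0 x)) \<and>
    L2_norm unit_interval (\<lambda>x. out k x - complex_of_real (fc (\<sigma> k) 0 x))
      \<le> 20 * real m ^ 6 * (C ^ (m - 1)) ^ 5 * (4 * real m / (\<zeta> * (1 - \<mu>) ^ m)) ^ 3 * \<epsilon> / \<delta>)"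
proof -
  let ?U = unit_interval
  define I where "I = {..<m - 1}"
  define J where "J = {m - 1..<2 * m - 2}"
  define M where "M = cube I"
  define N where "N = cube J"
  define G where "G k = tensor I (fc k)" for k
  define H where "H k = tensor J (fc k)" for k
  define f where "f k = fc k (2 * m - 2)" for k
  define b :: "real \<Rightarrow> real" where "b = indicator A"
  define a where "a k = (LINT x|?U. b x * f k x)" for k
  \<comment> \<open>A product of \<open>m - 1\<close> factors bounded by \<open>C\<close>; on a
    probability space this also bounds the L2 norm.\<close>
  define R where "R = C ^ (m - 1)"
  define q where "q = 4 * real m / (\<zeta> * (1 - \<mu>) ^ m)"
  define \<gamma> where "\<gamma> = gram_const m * (1 - \<mu>) ^ (m - 1)"
  have I: "finite I" "card I = m - 1" and J: "finite J" "card J = m - 1"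
    unfolding I_def J_def using m by auto
  have IJ: "I \<inter> J = {}" "2 * m - 2 \<notin> I \<union> J" and all: "insert (2 * m - 2) (I \<union> J) = {..<2 * m - 1}"
    unfolding I_def J_def using m by auto
  have inI: "j < 2 * m - 1" if "j \<in> I" for j using that all by blast
  have inJ: "j < 2 * m - 1" if "j \<in> J" for j using that all by blast
  have last: "2 * m - 2 < 2 * m - 1" using m by simp
  interpret M: prob_space M unfolding M_def by (rule prob_space_cube)
  interpret N: prob_space N unfolding N_def by (rule prob_space_cube)
  interpret MN: pair_prob_space M N ..
  interpret MNU: pair_prob_space "M \<Otimes>\<^sub>M N" ?U ..
  have sq: "sq_integrable ?U (fc k j)" if "k < m" "j < 2 * m - 1" for k j
    using est that by (simp add: estimable_def)
  have inc: "incoherent \<mu> ?U m (\<lambda>k. fc k j)" if "j < 2 * m - 1" for j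
    using est that by (simp add: estimable_def)
  have \<pi>: "\<zeta> \<le> \<pi> k" "0 < \<pi> k" "\<pi> k \<le> 1" if "k < m" for k
  proof -
    show "\<zeta> \<le> \<pi> k" "0 < \<pi> k" using est weights that by (auto simp: estimable_def mixture_weights_def)
    have "\<pi> k \<le> (\<Sum>k<m. \<pi> k)" using weights that by (intro member_le_sum) (auto simp: mixture_weights_def)
    then show "\<pi> k \<le> 1" using weights by (simp add: mixture_weights_def)
  qed
  have ge1: "1 \<le> L2_norm ?U (fc k j)" if "k < m" "j < 2 * m - 1" for k j
    by (intro prob_density_L2_norm_ge1 dens sq that)
  have C1: "1 \<le> C" using prob_density_bound_ge1[OF dens bound, of 0 0] m by auto
  have R1: "1 \<le> R" unfolding R_def using C1 by (rule one_le_power)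
  have sqG: "sq_integrable M (G k)" if "k < m" for k
    unfolding M_def G_def by (intro sq_integrable_tensor_cube I sq that inI)
  have sqH: "sq_integrable N (H k)" if "k < m" for k
    unfolding N_def H_def by (intro sq_integrable_tensor_cube J sq that inJ)
  have sqf: "sq_integrable ?U (f k)" if "k < m" for k unfolding f_def by (intro sq that last)
  have f_int: "integrable ?U (f k)" "AE x in ?U. 0 \<le> f k x" "(LINT x|?U. f k x) = 1" if "k < m" for k
    using dens[OF that last] by (auto simp: f_def prob_density_def)
  have Gb: "AE y in M. \<bar>G k y\<bar> \<le> R" if "k < m" for k
    unfolding M_def G_def R_def I(2)[symmetric] using bound[OF that inI] by (intro tensor_bound I)
  have Hb: "AE z in N. \<bar>H k z\<bar> \<le> R" if "k < m" for k
    unfolding N_def H_def R_def J(2)[symmetric] using bound[OF that inJ] by (intro tensor_bound J)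
  have G_le: "L2_norm M (G k) \<le> R" if "k < m" for k
    using Gb[OF that] R1 by (intro M.L2_norm_le_bound) auto
  have H_le: "L2_norm N (H k) \<le> R" if "k < m" for k
    using Hb[OF that] R1 by (intro N.L2_norm_le_bound) auto
  have gramG: "\<gamma> * (\<Sum>k<m. (c k)\<^sup>2) \<le> (L2_norm M (\<lambda>y. \<Sum>k<m. c k * G k y))\<^sup>2" for c
    unfolding \<gamma>_def M_def G_def using sq ge1 inc inI by (intro gram_tensor m I \<mu>) auto
  have gramH: "\<gamma> * (\<Sum>k<m. (c k)\<^sup>2) \<le> (L2_norm N (\<lambda>y. \<Sum>k<m. c k * H k y))\<^sup>2" for c
    unfolding \<gamma>_def N_def H_def using sq ge1 inc inJ by (intro gram_tensor m J \<mu>) auto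
  have \<gamma>0: "0 < \<gamma>" using \<mu> m by (simp add: \<gamma>_def gram_const_def)

  define T :: "((nat \<Rightarrow> real) \<times> (nat \<Rightarrow> real)) \<times> real \<Rightarrow> nat \<Rightarrow> real"
    where "T = (\<lambda>(p, x). (merge I J p)(2 * m - 2 := x))"
  have T: "T \<in> (M \<Otimes>\<^sub>M N) \<Otimes>\<^sub>M ?U \<rightarrow>\<^sub>M cube {..<2 * m - 1}"
    "distr ((M \<Otimes>\<^sub>M N) \<Otimes>\<^sub>M ?U) (cube {..<2 * m - 1}) T = cube {..<2 * m - 1}"
    using cube_merge_last[OF I(1) J(1) IJ] unfolding all M_def N_def T_def by auto
  define F where "F z = fhat (T z)" for z
  have F_point: "F ((y, z), x) = fhat (point m y z x)" for y z x
    by (simp add: F_def T_def point_def I_def J_def)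
  have sqF: "sq_integrable ((M \<Otimes>\<^sub>M N) \<Otimes>\<^sub>M ?U) F"
    unfolding F_def[abs_def] using sq_integrable_transfer(1)[OF T sq_integrableD(1)[OF fhat]] fhat by simp
  define g where "g k p = \<pi> k * (case p of (y, z) \<Rightarrow> G k y * H k z)" for k p
  have sqg: "sq_integrable (M \<Otimes>\<^sub>M N) (g k)" if "k < m" for k
    unfolding g_def[abs_def] by (intro sq_integrable_cmult MN.sq_integrable_tensor sqG sqH that)
  have mix: "mixture m \<pi> fc (T (p, x)) = (\<Sum>k<m. g k p * f k x)" for p x
  proof -
    have "(\<Prod>j<2 * m - 1. fc k j (T (p, x) j)) = (case p of (y, z) \<Rightarrow> G k y * H k z) * f k x" for k
    proof -
      have "(\<Prod>j<2 * m - 1. fc k j (T (p, x) j))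
        = fc k (2 * m - 2) x * (\<Prod>j\<in>I \<union> J. fc k j (T (p, x) j))"
        unfolding all[symmetric] using I J IJ by (subst prod.insert) (auto simp: T_def)
      also have "(\<Prod>j\<in>I \<union> J. fc k j (T (p, x) j)) = (\<Prod>j\<in>I. fc k j (fst p j)) * (\<Prod>j\<in>J. fc k j (snd p j))"
        using I J IJ by (subst prod.union_disjoint) (auto simp: T_def merge_def case_prod_unfold intro!: arg_cong2[where f = "(*)"] prod.cong)
      finally show ?thesis by (simp add: G_def H_def f_def tensor_def case_prod_unfold mult_ac)
    qed
    then show ?thesis by (simp add: mixture_def g_def mult_ac)
  qed
  have mix_meas: "mixture m \<pi> fc \<in> borel_measurable (cube {..<2 * m - 1})"
  proof -
    have "mixture m \<pi> fc = (\<lambda>x. \<Sum>k<m. \<pi> k * tensor {..<2 * m - 1} (fc k) x)"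
      by (simp add: mixture_def[abs_def] tensor_def)
    moreover have "sq_integrable (cube {..<2 * m - 1}) (\<lambda>x. \<Sum>k<m. \<pi> k * tensor {..<2 * m - 1} (fc k) x)"
      by (intro sq_integrable_sum sq_integrable_cmult sq_integrable_tensor_cube sq) auto
    ultimately show ?thesis by (simp add: sq_integrable_def)
  qed
  have closeF: "L2_norm ((M \<Otimes>\<^sub>M N) \<Otimes>\<^sub>M ?U) (\<lambda>(p, x). F (p, x) - (\<Sum>k<m. g k p * f k x)) \<le> \<epsilon>"
  proof -
    have "(\<lambda>x. fhat x - mixture m \<pi> fc x) \<in> borel_measurable (cube {..<2 * m - 1})"
      using sq_integrableD(1)[OF fhat] mix_meas by (rule borel_measurable_diff)
    from sq_integrable_transfer(2)[OF T this] close show ?thesis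
      by (simp add: F_def mix[symmetric] case_prod_unfold)
  qed
  have b: "b \<in> borel_measurable ?U" "0 \<le> b x" "b x \<le> 1" for x
    using A by (auto simp: b_def indicator_def sets_restrict_space_iff intro!: borel_measurable_indicator)
  note weighted = MNU.weighted_partial_integral[where F = F and g = g and f = f and m = m, OF sqF _ _ closeF]
  have full: "sq_integrable (M \<Otimes>\<^sub>M N) (\<lambda>p. LINT x|?U. F (p, x))"
    "L2_norm (M \<Otimes>\<^sub>M N) (\<lambda>p. (LINT x|?U. F (p, x)) - (\<Sum>k<m. g k p * (LINT x|?U. f k x))) \<le> \<epsilon>"
    using weighted(2,3)[of "\<lambda>_. 1"] sqg sqf by simp_all
  have part: "sq_integrable ((M \<Otimes>\<^sub>M N) \<Otimes>\<^sub>M ?U) (\<lambda>(p, x). b x * F (p, x))"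
    "sq_integrable (M \<Otimes>\<^sub>M N) (\<lambda>p. LINT x|?U. b x * F (p, x))"
    "L2_norm (M \<Otimes>\<^sub>M N) (\<lambda>p. (LINT x|?U. b x * F (p, x)) - (\<Sum>k<m. g k p * (LINT x|?U. b x * f k x))) \<le> \<epsilon>"
    by (rule weighted[of b]; simp add: sqg sqf b)+
  define K where "K = T_plus m fhat"
  have K: "(case p of (y, z) \<Rightarrow> K y z) = (LINT x|?U. F (p, x))" for p
    by (cases p) (simp add: K_def T_plus_def F_point)
  have sqK: "sq_integrable (M \<Otimes>\<^sub>M N) (\<lambda>(y, z). K y z)"
    using full(1) unfolding K[symmetric] by simp
  have rank: "MN.rank_kernel m c G H p = (\<Sum>k<m. c k * (case p of (y, z) \<Rightarrow> G k y * H k z))" for c p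
    by (simp add: MN.rank_kernel_eq)
  have K_close: "L2_norm (M \<Otimes>\<^sub>M N) (\<lambda>p. (case p of (y, z) \<Rightarrow> K y z) - MN.rank_kernel m \<pi> G H p) \<le> \<epsilon>"
  proof -
    have "(\<Sum>k<m. g k p * (LINT x|?U. f k x)) = MN.rank_kernel m \<pi> G H p" for p
      unfolding rank by (rule sum.cong) (simp_all add: g_def f_int)
    then show ?thesis using full(2) unfolding K by simp
  qed
  define KA where "KA p = (LINT x|?U. b x * F (p, x))" for p
  have sqKA: "sq_integrable (M \<Otimes>\<^sub>M N) KA" unfolding KA_def[abs_def] by (rule part(2))
  have KA_close: "L2_norm (M \<Otimes>\<^sub>M N) (\<lambda>p. KA p - MN.rank_kernel m (\<lambda>k. \<pi> k * a k) G H p) \<le> \<epsilon>"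
  proof -
    have "(\<Sum>k<m. g k p * (LINT x|?U. b x * f k x)) = MN.rank_kernel m (\<lambda>k. \<pi> k * a k) G H p" for p
      unfolding rank by (rule sum.cong) (simp_all add: g_def a_def mult_ac)
    then show ?thesis using part(3) unfolding KA_def by simp
  qed

  obtain s \<phi> \<psi> w where svd: "is_SVD M N K s \<phi> \<psi>"
    and w: "unit_eigenvectors m (eta_matrix m fhat A s \<phi> \<psi>) w"
    and phase: "\<And>k. k < m \<Longrightarrow> (LINT y|M. g_hat m \<phi> (w k) y) \<in> \<real>\<^sub>\<ge>\<^sub>0"
    and out': "\<And>k. k < m \<Longrightarrow> out k = first_marginal m (h_hat m \<phi> (w k))"
    using out unfolding recovery_output_def K_def M_def N_def I_def J_def by blast
  have q0: "0 < q" unfolding q_def using m \<zeta> \<mu> by simp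
  have q_le: "1 / q \<le> \<zeta> * \<gamma> - 2 * \<epsilon>"
    using noise_below_threshold[OF m \<mu> \<zeta> small] by (simp add: q_def \<gamma>_def)
  have q1: "1 \<le> q"
  proof -
    have "\<zeta> * (1 - \<mu>) ^ m \<le> 1 * 1"
      using \<pi>(1,3)[of 0] m \<mu> \<zeta> by (intro mult_mono power_le_one) auto
    then show ?thesis using m \<mu> \<zeta> by (simp add: q_def field_simps)
  qed
  interpret pm: perturbed_mixture M N m G H K s \<phi> \<psi> \<pi> \<zeta> \<gamma> \<epsilon> R q
    by unfold_locales (use m sqG sqH G_le H_le gramG gramH \<gamma>0 \<zeta> \<pi> sqK K_close svd q0 q_le in auto)
  obtain Bi where Bi: "\<And>i j. i < m \<Longrightarrow> j < m \<Longrightarrow> (\<Sum>k<m. pm.B i k * Bi k j) = of_bool (i = j)"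
    "\<And>i j. i < m \<Longrightarrow> j < m \<Longrightarrow> (\<Sum>k<m. Bi i k * pm.B k j) = of_bool (i = j)"
    "\<And>i j. i < m \<Longrightarrow> j < m \<Longrightarrow> \<bar>Bi i j\<bar> \<le> R * q"
    "\<And>k. k < m \<Longrightarrow> L2_norm M (pm.residual k) \<le> \<epsilon> * (q * R)"
    using pm.inverse_and_residual by blast
  define \<eta> where "\<eta> = eta m fhat A s \<phi> \<psi>"
  have a_eq: "(LINT x:A|?U. fc k (2 * m - 2) x) = a k" for k
    by (simp add: set_lebesgue_integral_def a_def b_def f_def)
  have a01: "0 \<le> a k" "a k \<le> 1" if k: "k < m" for k
  proof -
    have nonneg: "AE x in ?U. 0 \<le> b x * f k x" using f_int(2)[OF k] by eventually_elim (simp add: b)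
    show "0 \<le> a k" unfolding a_def by (rule integral_nonneg_AE[OF nonneg])
    have "a k \<le> (LINT x|?U. f k x)"
      unfolding a_def
      by (rule integral_mono_AE'[OF f_int(1)[OF k] _ f_int(2)[OF k]])
         (use f_int(2)[OF k] in \<open>eventually_elim, simp add: b mult_left_le_one_le\<close>)
    then show "a k \<le> 1" by (simp add: f_int(3)[OF k])
  qed
  have gap': "\<delta> \<le> \<bar>a i - a j\<bar>" if "i < m" "j < m" "i \<noteq> j" for i j using gap[OF that] by (simp add: a_eq)
  \<comment> \<open>As \<open>m \<ge> 2\<close> there are two numbers \<open>a k\<close>, both in
    [0,1], at distance at least \<open>\<delta>\<close>.\<close>
  have \<delta>1: "\<delta> \<le> 1" using gap'[of 0 1] a01[of 0] a01[of 1] m by auto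
  have \<eta>_close: "\<bar>\<eta> l t * s t - (\<Sum>k<m. (\<pi> k * a k) * (pm.B l k * pm.D t k))\<bar> \<le> \<epsilon>" if lt: "l < m" "t < m" for l t
  proof -
    \<comment> \<open>The singular value is positive for \<open>t < m\<close>, so the division in
      \<open>eta\<close> cancels.\<close>
    have "\<eta> l t * s t = (LINT x|?U. b x * (LINT z|N. LINT y|M. \<phi> l y * F ((y, z), x) * \<psi> t z))"
      using pm.singular_value_pos[OF lt(2)]
      by (simp add: \<eta>_def eta_def set_lebesgue_integral_def b_def F_point M_def N_def I_def J_def)
    also have "\<dots> = L2_inner (M \<Otimes>\<^sub>M N) KA (\<lambda>(y, z). \<phi> l y * \<psi> t z)"
      unfolding KA_def[abs_def]
      by (intro triple_integral_form M.prob_space_axioms N.prob_space_axioms prob_space_unit_interval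
          sqF b(1) part(1) pm.sq_basis)
    finally show ?thesis
      using MN.kernel_form_close[where g = G and h = H and n = m, OF sqKA sqG sqH pm.sq_basis KA_close, of l t]
      by (simp add: pm.B_def pm.D_def L2_inner_commute orthonormal_L2_norm[OF pm.ortho(1)] orthonormal_L2_norm[OF pm.ortho(2)])
  qed
  have G_nonneg: "AE y in M. 0 \<le> G k y" if "k < m" for k
    unfolding M_def G_def using dens[OF that inI] by (intro tensor_nonneg I) (auto simp: prob_density_def)
  have G_mass: "(LINT y|M. G k y) = 1" if "k < m" for k
    unfolding M_def G_def using dens[OF that inI] I by (subst integral_tensor_cube) (auto simp: prob_density_def)
  interpret ps: perturbed_spectrum M N m G H K s \<phi> \<psi> \<pi> \<zeta> \<gamma> \<epsilon> R q Bi a \<eta> \<delta>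
    by unfold_locales (use Bi a01 gap' \<delta> \<delta>1 \<eta>_close R1 q1 Gb G_nonneg G_mass in auto)
  have eig: "eigenvector (eta_matrix m fhat A s \<phi> \<psi>) v c \<longleftrightarrow>
    v \<in> carrier_vec m \<and> (\<exists>j<m. vec_index v j \<noteq> 0) \<and>
    (\<forall>l<m. (\<Sum>t<m. complex_of_real (\<eta> l t) * vec_index v t) = c * vec_index v l)" for v c
    unfolding eta_matrix_def \<eta>_def by (rule eigenvector_mat_iff)
  have "\<exists>c. eigenvector (eta_matrix m fhat A s \<phi> \<psi>) (w k) c" if "k < m" for k
    using w that by (simp add: unit_eigenvectors_def)
  then obtain \<alpha> where \<alpha>: "\<And>k. k < m \<Longrightarrow> eigenvector (eta_matrix m fhat A s \<phi> \<psi>) (w k) (\<alpha> k)" by metis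
  interpret re: recovered_eigenvectors M N m G H K s \<phi> \<psi> \<pi> \<zeta> \<gamma> \<epsilon> R q Bi a \<eta> \<delta> "\<lambda>k. vec_index (w k)" \<alpha>
  proof
    show "(\<Sum>t<m. complex_of_real (\<eta> l t) * vec_index (w k) t) = \<alpha> k * vec_index (w k) l" if "k < m" "l < m" for k l
      using \<alpha>[OF that(1)] that(2) unfolding eig by blast
    show "(\<Sum>h<m. (cmod (vec_index (w k) h))\<^sup>2) = 1" if "k < m" for k
      using w that by (simp add: unit_eigenvectors_def)
    show "(LINT y|M. (\<Sum>h<m. vec_index (w k) h * complex_of_real (\<phi> h y))) \<in> \<real>\<^sub>\<ge>\<^sub>0" if "k < m" for k
      using phase[OF that] by (simp add: g_hat_def)
    show "\<exists>c. \<forall>h<m. v h = (\<Sum>k<m. c k * vec_index (w k) h)"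
      if v: "\<And>l. l < m \<Longrightarrow> (\<Sum>t<m. complex_of_real (\<eta> l t) * v t) = d * v l" "\<exists>j<m. v j \<noteq> 0" for v d
    proof -
      have "eigenvector (eta_matrix m fhat A s \<phi> \<psi>) (vec m v) d"
        unfolding eig using v by auto
      then have "\<exists>c. \<forall>h<m. vec_index (vec m v) h = (\<Sum>k<m. c k * vec_index (w k) h)"
        using w unfolding unit_eigenvectors_def by blast
      then show ?thesis by simp
    qed
  qed
  obtain \<sigma> where \<sigma>: "\<sigma> permutes {..<m}"
    "\<And>k. k < m \<Longrightarrow> L2_norm M (\<lambda>y. re.h k y - complex_of_real (G (\<sigma> k) y)) \<le> 20 * real m ^ 6 * R ^ 5 * q ^ 3 * \<epsilon> / \<delta>"
    using re.recovery by blast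
  have h: "re.h k = h_hat m \<phi> (w k)" for k
  proof -
    have g: "re.g k = g_hat m \<phi> (w k)" by (simp add: re.g_def[abs_def] g_hat_def[abs_def])
    show ?thesis unfolding fun_eq_iff re.h_def g h_hat_def by (simp add: M_def I_def)
  qed
  show ?thesis
  proof (intro exI conjI allI impI)
    show "\<sigma> permutes {..<m}" by (rule \<sigma>(1))
    fix k assume k: "k < m"
    then have \<sigma>k: "\<sigma> k < m" using permutes_in_image[OF \<sigma>(1), of k] by simp
    have sqh: "sq_integrable (cube {..<m - 1}) (h_hat m \<phi> (w k))"
      using re.sq_h[of k] unfolding h by (simp add: M_def I_def)
    have fm: "sq_integrable ?U (fc (\<sigma> k) j)" "(LINT x|?U. fc (\<sigma> k) j x) = 1" if "j < m - 1" for j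
      using sq[OF \<sigma>k, of j] dens[OF \<sigma>k, of j] that by (auto simp: prob_density_def)
    note marg = first_marginal_close[where f = "fc (\<sigma> k)", OF m sqh fm]
    show "sq_integrable ?U (\<lambda>x. out k x - complex_of_real (fc (\<sigma> k) 0 x))"
      using marg(1) by (simp add: out'[OF k])
    show "L2_norm ?U (\<lambda>x. out k x - complex_of_real (fc (\<sigma> k) 0 x))
      \<le> 20 * real m ^ 6 * (C ^ (m - 1)) ^ 5 * (4 * real m / (\<zeta> * (1 - \<mu>) ^ m)) ^ 3 * \<epsilon> / \<delta>"
    proof -
      have "L2_norm ?U (\<lambda>x. out k x - complex_of_real (fc (\<sigma> k) 0 x))
        \<le> L2_norm M (\<lambda>y. h_hat m \<phi> (w k) y - complex_of_real (G (\<sigma> k) y))"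
        using marg(2) unfolding out'[OF k] by (simp add: M_def I_def G_def)
      also have "\<dots> \<le> 20 * real m ^ 6 * R ^ 5 * q ^ 3 * \<epsilon> / \<delta>" using \<sigma>(2)[OF k] unfolding h .
      finally show ?thesis unfolding R_def q_def .
    qed
  qed
qed

theorem theorem14:
  fixes m :: nat and C :: real
  assumes "2 \<le> m" and "0 < C"
  shows "\<exists>L>0. \<forall>(\<mu>::real) (\<zeta>::real) (\<mu>0::real) (\<delta>::real) (\<epsilon>::real)
           (\<pi> :: nat \<Rightarrow> real) (fc :: nat \<Rightarrow> nat \<Rightarrow> real \<Rightarrow> real) (A :: real set)
           (fhat :: (nat \<Rightarrow> real) \<Rightarrow> real) (out :: nat \<Rightarrow> real \<Rightarrow> complex).
         0 \<le> \<mu> \<longrightarrow> \<mu> < 1 \<longrightarrow> 0 < \<zeta> \<longrightarrow> 0 < \<mu>0 \<longrightarrow> 0 < \<delta> \<longrightarrow>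
         mixture_weights m \<pi> \<longrightarrow>
         (\<forall>k<m. \<forall>j<2 * m - 1. prob_density unit_interval (fc k j)) \<longrightarrow>
         estimable \<mu> \<zeta> m \<pi> fc \<longrightarrow>
         (\<forall>k<m. \<forall>j<2 * m - 1. AE x in unit_interval. \<bar>fc k j x\<bar> \<le> C) \<longrightarrow>
         A \<subseteq> {0..1} \<longrightarrow> A \<in> sets lebesgue \<longrightarrow>
         \<mu>0 \<le> measure lebesgue A \<longrightarrow>
         (\<forall>k<m. \<delta> \<le> (LINT x:A|unit_interval. fc k (2 * m - 2) x)) \<longrightarrow>
         (\<forall>k<m. \<forall>k'<m. k \<noteq> k' \<longrightarrow>
            \<delta> \<le> \<bar>(LINT x:A|unit_interval. fc k (2 * m - 2) x)
                 - (LINT x:A|unit_interval. fc k' (2 * m - 2) x)\<bar>) \<longrightarrow>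
         sq_integrable (cube {..<2 * m - 1}) fhat \<longrightarrow>
         L2_norm (cube {..<2 * m - 1}) (\<lambda>x. fhat x - mixture m \<pi> fc x) \<le> \<epsilon> \<longrightarrow>
         \<epsilon> < \<zeta> * (1 - \<mu>) ^ m / (4 * fact (m - 1)) \<longrightarrow>
         recovery_output m fhat A out \<longrightarrow>
         (\<exists>\<sigma>. \<sigma> permutes {..<m} \<and>
            (\<forall>k<m.
               sq_integrable unit_interval (\<lambda>x. out k x - complex_of_real (fc (\<sigma> k) 0 x)) \<and>
               L2_norm unit_interval (\<lambda>x. out k x - complex_of_real (fc (\<sigma> k) 0 x))
                 \<le> L * \<epsilon> / (\<zeta> ^ 3 * (1 - \<mu>) ^ (3 * m) * \<delta> * sqrt \<mu>0)))"
proof -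
  \<comment> \<open>The constant of \<open>recovery_estimate\<close> with the cube of
    \<open>4 * m\<close> multiplied out: \<open>1280 = 20 * 4 ^ 3\<close> and
    \<open>m ^ 9 = m ^ 6 * m ^ 3\<close>.\<close>
  define L where "L = 1280 * real m ^ 9 * (C ^ (m - 1)) ^ 5"
  have L0: "0 < L" using assms by (simp add: L_def)
  show ?thesis
  proof (intro exI[of _ L] conjI L0 allI impI, goal_cases)
    case (1 \<mu> \<zeta> \<mu>0 \<delta> \<epsilon> \<pi> fc A fhat out)
    let ?b = "20 * real m ^ 6 * (C ^ (m - 1)) ^ 5 * (4 * real m / (\<zeta> * (1 - \<mu>) ^ m)) ^ 3 * \<epsilon> / \<delta>"
    obtain \<sigma> where \<sigma>: "\<sigma> permutes {..<m}"
      and est: "\<forall>k<m. sq_integrable unit_interval (\<lambda>x. out k x - complex_of_real (fc (\<sigma> k) 0 x)) \<and>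
        L2_norm unit_interval (\<lambda>x. out k x - complex_of_real (fc (\<sigma> k) 0 x)) \<le> ?b"
      using recovery_estimate[OF assms(1) 1(1-3,5,6) _ 1(8) _ 1(10,11) _ 1(15-18)] 1(7,9,14) by blast
    \<comment> \<open>\<open>A\<close> lies in the unit interval, so \<open>\<mu>0 \<le> 1\<close>
      and dividing by its square root does not decrease the bound.\<close>
    have "measure lebesgue A \<le> measure lebesgue {0..1 :: real}"
      using 1(10,11) by (intro measure_mono_fmeasurable) auto
    then have "sqrt \<mu>0 \<le> 1" using 1(12) by simp
    have "0 \<le> \<epsilon>" using 1(16) L2_norm_nonneg order_trans by blast
    define X where "X = L * \<epsilon> / (\<zeta> ^ 3 * (1 - \<mu>) ^ (3 * m) * \<delta>)"
    have cube: "(1 - \<mu>) ^ (3 * m) = ((1 - \<mu>) ^ m) ^ 3" by (simp add: power_mult[symmetric] mult.commute)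
    have "20 * M ^ 6 * c ^ 5 * (4 * M / (\<zeta> * d)) ^ 3 * \<epsilon> / \<delta> = 1280 * M ^ 9 * c ^ 5 * \<epsilon> / (\<zeta> ^ 3 * d ^ 3 * \<delta>)"
      for M c d :: real
      by (simp add: power_divide power_mult_distrib eval_nat_numeral mult_ac)
    then have "?b = X" unfolding X_def L_def cube .
    also have "X \<le> X / sqrt \<mu>0"
    proof -
      have "0 \<le> X" using \<open>0 \<le> \<epsilon>\<close> L0 1(2,3,5) by (simp add: X_def)
      then have "X * sqrt \<mu>0 \<le> X * 1" using \<open>sqrt \<mu>0 \<le> 1\<close> by (intro mult_left_mono)
      then show ?thesis using 1(4) by (simp add: le_divide_eq)
    qed
    also have "X / sqrt \<mu>0 = L * \<epsilon> / (\<zeta> ^ 3 * (1 - \<mu>) ^ (3 * m) * \<delta> * sqrt \<mu>0)" by (simp add: X_def)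
    finally have le: "?b \<le> L * \<epsilon> / (\<zeta> ^ 3 * (1 - \<mu>) ^ (3 * m) * \<delta> * sqrt \<mu>0)" .
    show ?case
    proof (intro exI[of _ \<sigma>] conjI allI impI \<sigma>)
      fix k assume k: "k < m"
      show "sq_integrable unit_interval (\<lambda>x. out k x - complex_of_real (fc (\<sigma> k) 0 x))"
        using est k by blast
      have "L2_norm unit_interval (\<lambda>x. out k x - complex_of_real (fc (\<sigma> k) 0 x)) \<le> ?b"
        using est k by blast
      also note le
      finally show "L2_norm unit_interval (\<lambda>x. out k x - complex_of_real (fc (\<sigma> k) 0 x))
        \<le> L * \<epsilon> / (\<zeta> ^ 3 * (1 - \<mu>) ^ (3 * m) * \<delta> * sqrt \<mu>0)" .
    qed
  qed
qed

end
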